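(* Let $r\ge 2$, let $p_1,\dots,p_r$ be distinct primes, let $\alpha_1,\dots,\alpha_{r-1},\alpha'_{r-1}$ be nonnegative integers with $\alpha_{r-1}\ge\alpha'_{r-1}$, let $s$ be a nonnegative integer, and suppose that $$p_i\prec p_{i+1}^{\alpha_{i+1}}\cdots p_{r-1}^{\alpha_{r-1}}p_r\qquad\text{for all integers } i \text{ with } 1\le i\le r-2.$$ If $G$ is a finite abelian group of the form $$G=C_{p_1^{\alpha_1}}\oplus C_{p_2^{\alpha_2}}\oplus\cdots\oplus C_{p_{r-2}^{\alpha_{r-2}}}\oplus C_{p_{r-1}^{\alpha_{r-1}}}\oplus C_{p_{r-1}^{\alpha'_{r-1}}}\oplus C_{p_r}^{s},$$ then $\mathsf{k}(G)=\mathsf{k}^{*}(G)$.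
   Context: Groups are finite abelian, written additively; $C_m$ is the cyclic group of order $m$ and $C_m^s$ is the direct sum of $s$ copies of it; $\mathbb{N}=\mathbb{Z}_{\ge 0}$; $G^{\bullet}=G\setminus\{0\}$. An indexed sequence over $G$ is an element of the free abelian monoid (written multiplicatively, identity $1$) on $G^{\bullet}\times\mathbb{N}$; all indexed sequences are assumed squarefree, i.e. every pair $(g,n)$ occurs with multiplicity at most one, so an indexed sequence is a finite set of labelled nonzero elements of $G$ (the same $g$ may occur with several labels). For an indexed sequence $S$, $\overline{v}_g(S)$ is the number of terms of $S$ with first coordinate $g$, and $\overline{\sigma}(S)=\sum_{g\in G^\bullet}\overline{v}_g(S)\,g\in G$. A subsequence $T$ of $S$ (written $T\mid S$) is a divisor in the monoid. $S$ is zero-sum free if there is no $T\mid S$, $T\neq 1$, with $\overline{\sigma}(T)=0$. The cross number of $S$ is $\mathsf{k}(S)=\sum_{g\in G^\bullet}\overline{v}_g(S)/\mathrm{ord}(g)$. The little cross number of $G$ is $$\mathsf{k}(G)=\max\{\mathsf{k}(S): S \text{ a zero-sum free indexed sequence over } G\}.$$ Writing $G\cong\bigoplus_{i}C_{p_i^{\alpha_i}}$ as a direct sum of cyclic groups of prime power order ($p_i$ not necessarily distinct), define $\mathsf{k}^{*}(G)=\sum_{i}\bigl(1-p_i^{-\alpha_i}\bigr)$. A prime $p$ is wide with respect to a positive integer $n$, written $p\prec n$, if $p\nmid n$ and, with prime factorization $n=q_1^{\beta_1}\cdots q_t^{\beta_t}$, $$\frac{p}{p-1}\ge\prod_{j=1}^{t}\frac{q_j^{\beta_j+1}-1}{q_j^{\beta_j+1}-q_j^{\beta_j}},$$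 the empty product being $1$. *)

theory Defs
  imports Complex_Main "HOL-Algebra.Multiplicative_Group" "HOL-Algebra.Product_Groups" "HOL-Computational_Algebra.Primes"
begin

text \<open>
  Abelian groups are written multiplicatively, as in HOL-Algebra: the neutral element is
  \<open>\<one>\<close>, multiples \<open>n g\<close> are powers \<open>g [^] n\<close>, and sums are \<open>finprod\<close>. The cyclic group of
  order \<open>m > 0\<close> is \<open>integer_mod_group m\<close>.
\<close>

text \<open>A squarefree indexed sequence is the finite set of its pairs (term, label); divisibility
  of such sequences is set inclusion.\<close>

definition indexed_sequence :: "('a, 'b) monoid_scheme \<Rightarrow> ('a \<times> nat) set \<Rightarrow> bool" where
  "indexed_sequence G S \<longleftrightarrow> finite S \<and> S \<subseteq> (carrier G - {\<one>\<^bsub>G\<^esub>}) \<times> UNIV"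

definition iseq_mult :: "'a \<Rightarrow> ('a \<times> nat) set \<Rightarrow> nat" where
  "iseq_mult g S = card {n. (g, n) \<in> S}"

definition iseq_sum :: "('a, 'b) monoid_scheme \<Rightarrow> ('a \<times> nat) set \<Rightarrow> 'a" where
  "iseq_sum G S = finprod G (\<lambda>g. g [^]\<^bsub>G\<^esub> iseq_mult g S) (carrier G - {\<one>\<^bsub>G\<^esub>})"

definition zero_sum_free :: "('a, 'b) monoid_scheme \<Rightarrow> ('a \<times> nat) set \<Rightarrow> bool" where
  "zero_sum_free G S \<longleftrightarrow> \<not> (\<exists>T \<subseteq> S. T \<noteq> {} \<and> iseq_sum G T = \<one>\<^bsub>G\<^esub>)"

definition cross_number :: "('a, 'b) monoid_scheme \<Rightarrow> ('a \<times> nat) set \<Rightarrow> real" where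
  "cross_number G S =
     (\<Sum>g\<in>carrier G - {\<one>\<^bsub>G\<^esub>}. real (iseq_mult g S) / real (group.ord G g))"

definition little_cross_number :: "('a, 'b) monoid_scheme \<Rightarrow> real" where
  "little_cross_number G = Max {cross_number G S | S. indexed_sequence G S \<and> zero_sum_free G S}"

text \<open>The set in the preceding definition is finite (and nonempty, as the empty sequence is
  zero-sum free), so \<open>Max\<close> is a genuine maximum.\<close>

lemma iseq_mult_less_ord:
  assumes G: "comm_group G" and fin: "finite (carrier G)"
    and S: "indexed_sequence G S" "zero_sum_free G S" and g: "g \<in> carrier G - {\<one>\<^bsub>G\<^esub>}"
  shows "iseq_mult g S < group.ord G g"
proof (rule ccontr)
  interpret comm_group G by fact
  assume "\<not> ?thesis"
  then have le: "ord g \<le> card {n. (g, n) \<in> S}" by (simp add: iseq_mult_def)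
  obtain N where N: "N \<subseteq> {n. (g, n) \<in> S}" "card N = ord g"
    using le by (meson obtain_subset_with_card_n)
  have pos: "ord g > 0" using g fin ord_ge_1 by fastforce
  let ?T = "{g} \<times> N"
  have m: "iseq_mult h ?T = (if h = g then ord g else 0)" for h
    using N by (auto simp: iseq_mult_def)
  have "iseq_sum G ?T = finprod G (\<lambda>h. \<one>\<^bsub>G\<^esub>) (carrier G - {\<one>\<^bsub>G\<^esub>})"
    unfolding iseq_sum_def using g by (intro finprod_cong') (auto simp: m)
  then have "iseq_sum G ?T = \<one>\<^bsub>G\<^esub>" by simp
  moreover have "?T \<subseteq> S" using N by auto
  moreover have "?T \<noteq> {}" using N pos by auto
  ultimately show False using S(2) unfolding zero_sum_free_def by blast
qed

lemma finite_zero_sum_free_cross_numbers: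
  assumes "comm_group G" and "finite (carrier G)"
  shows "finite {cross_number G S | S. indexed_sequence G S \<and> zero_sum_free G S}"
proof -
  let ?A = "carrier G - {\<one>\<^bsub>G\<^esub>}"
  let ?k = "\<lambda>v. \<Sum>g\<in>?A. real (v g) / real (group.ord G g)"
  let ?P = "\<Pi>\<^sub>E g\<in>?A. {..<group.ord G g}"
  have "cross_number G S \<in> ?k ` ?P" if "indexed_sequence G S" "zero_sum_free G S" for S
  proof (rule image_eqI[of _ _ "\<lambda>g\<in>?A. iseq_mult g S"])
    show "(\<lambda>g\<in>?A. iseq_mult g S) \<in> ?P"
      using iseq_mult_less_ord[OF assms that] by auto
  qed (simp add: cross_number_def)
  then have "{cross_number G S | S. indexed_sequence G S \<and> zero_sum_free G S} \<subseteq> ?k ` ?P"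
    by blast
  then show ?thesis
    using assms(2) by (meson finite_Diff finite_PiE finite_imageI finite_lessThan finite_subset)
qed

text \<open>The number below does not depend on the decomposition of the finite abelian group \<open>G\<close>
  into cyclic groups of prime power order, which is unique up to the order of the summands.\<close>

definition kstar :: "('a, 'b) monoid_scheme \<Rightarrow> real" where
  "kstar G = (THE x. \<exists>n (p :: nat \<Rightarrow> nat) (a :: nat \<Rightarrow> nat).
     (\<forall>i<n. prime (p i) \<and> a i \<ge> 1) \<and>
     G \<cong> product_group {..<n} (\<lambda>i. integer_mod_group (p i ^ a i)) \<and>
     x = (\<Sum>i<n. 1 - 1 / real (p i ^ a i)))"

definition wide :: "nat \<Rightarrow> nat \<Rightarrow> bool" where
  "wide p n \<longleftrightarrow> prime p \<and> n > 0 \<and> \<not> p dvd n \<and>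
     real p / (real p - 1) \<ge>
       (\<Prod>q\<in>prime_factors n.
          (real q ^ (multiplicity q n + 1) - 1) /
          (real q ^ (multiplicity q n + 1) - real q ^ multiplicity q n))"

end

theory Submission
  imports Defs "HOL-Library.Function_Algebras" "HOL-Library.Multiset"
begin

text \<open>
  The lower bound \<open>k(G) \<ge> k\<^sup>*(G)\<close> holds for all finite abelian groups: the sequence with \<open>m - 1\<close> copies of a generator of
  every cyclic summand of order \<open>m\<close> is zero-sum free. The work is in the upper bound. Groups are handled
  in coordinates: an integer vector stands for a group element, a modulus for every coordinate says
  when a vector is zero, and sequences are multisets of vectors. The cross numbers are bounded by
  induction over the cyclic summands, starting from those of \<open>p\<^sub>r\<^sub>-\<^sub>1\<close> and \<open>p\<^sub>r\<close> and adding those of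
  \<open>p\<^sub>r\<^sub>-\<^sub>2, \<dots>, p\<^sub>1\<close> one after the other.

  For a single prime the bound is Olson's theorem (\<open>cross_number_p_group\<close>). The proof
  applies iterated differences to the indicator function of the zero element, modulo \<open>p\<close>: a zero-sum
  free sequence of length \<open>n\<close> gives the value \<open>(-1)\<^sup>n\<close> at \<open>0\<close>, whereas a sequence of large cross number
  gives zero, since \<open>p\<^sup>t\<close>-fold differences are differences along \<open>p\<^sup>t\<close>-fold multiples.
  In a cyclic \<open>p\<close>-group one gets more (\<open>short_zs_cyclic\<close>): a sequence whose cross number
  exceeds \<open>u = 1 - p\<^sup>-\<^sup>\<alpha>\<close> contains a nonempty zero-sum subsequence whose cross number is at most \<open>1\<close>.

  Let now \<open>G = A \<oplus> H\<close> with \<open>A\<close> cyclic of order \<open>p\<^sup>\<alpha>\<close> and \<open>|H|\<close> coprime to \<open>p\<close>, and let \<open>S\<close> be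
  zero-sum free. If disjoint subsequences of \<open>S\<close> have zero sum in \<open>A\<close>, then their sums form a zero-sum
  free sequence over \<open>H\<close>, whose cross number is at most \<open>k(H)\<close>. So it suffices to find such
  subsequences whose sums retain as much weight as possible; the weight not retained is called the loss.
  Let \<open>q\<^sup>e n\<close> be a multiple of the exponent of \<open>H\<close>. The terms of \<open>S\<close> whose orders in \<open>H\<close> are \<open>d, d q, d q\<^sup>2, \<dots>\<close>
  form a chain for every \<open>d\<close> dividing \<open>n\<close>. Extracting short zero-sum subsequences along the chain, terms
  of small order first, loses no more than \<open>u / d\<close>, because at most the weight \<open>u\<close> remains unused at any time.
  For \<open>d = 1\<close> the terms of order \<open>1\<close> in \<open>H\<close> are zero-sum free; if their cross number is \<open>L\<close>, the loss is
  \<open>L + (u - L) / q\<close>. Altogether (\<open>peel_core\<close>), with \<open>\<rho>(n)\<close> the sum of \<open>1 / d\<close> over the divisors \<open>d \<noteq> 1\<close> of \<open>n\<close>,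
  \<open>k(S) \<le> k(H) + L + (u - L) / q + u \<rho>(n)\<close>. This has to be at most \<open>k(H) + u\<close>, and one may assume that
  \<open>L \<le> u - 1 / p\<close> (\<open>peel_frame\<close>): otherwise \<open>S\<close> can be shortened by replacing a subsequence by its
  sum, or it has \<open>p - 1\<close> terms of order \<open>p\<close> that lie in \<open>A\<close>, and then the remaining terms are zero-sum free modulo
  the subgroup of order \<open>p\<close>. Hence the summand \<open>A\<close> can be added if \<open>p q \<rho>(n) \<le> q - 1\<close> (\<open>peel\<close>).

  This is where wide primes enter. That \<open>p\<close> is wide with respect to \<open>N\<close> means that the abundancy of \<open>N\<close>, the
  sum of \<open>1 / d\<close> over its divisors, is at most \<open>p / (p - 1)\<close>. Therefore all primes dividing \<open>N\<close> are
  larger than \<open>p\<close>, save for \<open>p = 3\<close> and \<open>N = 2\<close>; with \<open>q\<close> the smallest of the relevant ones and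
  \<open>N = q\<^sup>e n\<close>, the hypothesis for \<open>q\<close> itself yields \<open>\<rho>(n) \<le> 1 / (q - 1)\<close>. If \<open>q \<ge> p + 2\<close>, this suffices. What remains
  is \<open>p = 2\<close>, \<open>q = 3\<close>, where the estimate can fail by a small margin if the next prime is \<open>5\<close> or \<open>7\<close>; there the chains
  are arranged according to which zero-sum subsequences exist among the terms of small order
  (\<open>two_three_core\<close>, \<open>two_three\<close>). The start of the induction is \<open>cross_bound_base\<close>.

  Finally, \<open>k\<^sup>*\<close> is well defined because it can be computed from the numbers of solutions of \<open>P\<^sup>k g = 0\<close>
  in the group (\<open>kstar_value\<close>).
\<close>

declare plus_fun_apply [simp del]

type_synonym vec = "nat \<Rightarrow> int"

section \<open>Zero-sum free sequences of integer vectors\<close>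

text \<open>A vector \<open>x\<close> represents an element of the direct sum of the cyclic groups of order \<open>m i\<close>; it represents
  \<open>0\<close> iff \<open>nul m x\<close>. Vectors are never reduced, so that sums of sequences are sums in \<open>vec\<close> and one and the
  same sequence can be viewed in several quotients at once. A modulus \<open>1\<close> makes a coordinate
  irrelevant, and almost all moduli are \<open>1\<close>.\<close>

definition nul :: "(nat \<Rightarrow> nat) \<Rightarrow> vec \<Rightarrow> bool" where
  "nul m x \<longleftrightarrow> (\<forall>i. int (m i) dvd x i)"

definition scale :: "nat \<Rightarrow> vec \<Rightarrow> vec" where
  "scale k x = (\<lambda>i. int k * x i)"

definition moduli :: "(nat \<Rightarrow> nat) \<Rightarrow> bool" where
  "moduli m \<longleftrightarrow> (\<forall>i. m i > 0) \<and> finite {i. m i \<noteq> 1}"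

text \<open>The order of the element represented by \<open>x\<close>, see \<open>nul_scale_iff\<close> below.\<close>

definition vord :: "(nat \<Rightarrow> nat) \<Rightarrow> vec \<Rightarrow> nat" where
  "vord m x = Lcm (range (\<lambda>i. m i div gcd (m i) (nat \<bar>x i\<bar>)))"

lemma moduliD [simp]: "moduli m \<Longrightarrow> m i > 0"
  by (simp add: moduli_def)

lemma sum_mset_apply: "(sum_mset T :: vec) i = (\<Sum>x\<in>#T. x i)"
  by (induction T) (auto simp: plus_fun_apply)

lemma nul_0 [simp]: "nul m 0"
  by (simp add: nul_def)

lemma nul_add: "nul m x \<Longrightarrow> nul m y \<Longrightarrow> nul m (x + y)"
  by (simp add: nul_def plus_fun_apply)

lemma nul_add_cancel: "nul m x \<Longrightarrow> nul m (x + y) \<longleftrightarrow> nul m y"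
  by (simp add: nul_def plus_fun_apply dvd_add_right_iff)

text \<open>Cancel the greatest common divisor: its two cofactors are coprime.\<close>

lemma dvd_mult_iff_div_gcd_nat:
  fixes a k y :: nat
  assumes "a > 0"
  shows "a dvd k * y \<longleftrightarrow> a div gcd a y dvd k"
proof -
  have g: "gcd a y > 0" using assms by simp
  have "a dvd k * y \<longleftrightarrow> (a div gcd a y) * gcd a y dvd k * (y div gcd a y) * gcd a y"
    by (simp add: mult.assoc)
  also have "\<dots> \<longleftrightarrow> a div gcd a y dvd k * (y div gcd a y)"
    using g by (intro dvd_times_right_cancel_iff) simp
  also have "\<dots> \<longleftrightarrow> a div gcd a y dvd k"
    by (rule coprime_dvd_mult_left_iff, rule div_gcd_coprime) (use assms in auto)
  finally show ?thesis .
qed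

lemma dvd_mult_iff_div_gcd:
  fixes a k :: nat and x :: int
  assumes "a > 0"
  shows "int a dvd int k * x \<longleftrightarrow> a div gcd a (nat \<bar>x\<bar>) dvd k"
proof -
  let ?y = "nat \<bar>x\<bar>"
  have "int a dvd int k * x \<longleftrightarrow> int a dvd int (k * ?y)"
    by (simp add: dvd_abs_iff abs_mult flip: dvd_abs_iff[of _ "int k * x"])
  also have "\<dots> \<longleftrightarrow> a dvd k * ?y" by (rule int_dvd_int_iff)
  also have "\<dots> \<longleftrightarrow> a div gcd a ?y dvd k" by (rule dvd_mult_iff_div_gcd_nat[OF assms])
  finally show ?thesis .
qed

lemma nul_scale_iff:
  assumes "moduli m"
  shows "nul m (scale k x) \<longleftrightarrow> vord m x dvd k"
  using assms by (simp add: nul_def scale_def vord_def Lcm_dvd_iff dvd_mult_iff_div_gcd)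

lemma vord_pos [simp]:
  assumes "moduli m" shows "vord m x > 0"
proof -
  have "finite (range (\<lambda>i. m i div gcd (m i) (nat \<bar>x i\<bar>)))"
  proof (rule finite_subset)
    show "range (\<lambda>i. m i div gcd (m i) (nat \<bar>x i\<bar>)) \<subseteq>
      insert 1 ((\<lambda>i. m i div gcd (m i) (nat \<bar>x i\<bar>)) ` {i. m i \<noteq> 1})"
    proof safe
      fix i assume "m i div gcd (m i) (nat \<bar>x i\<bar>) \<notin> (\<lambda>i. m i div gcd (m i) (nat \<bar>x i\<bar>)) ` {i. m i \<noteq> 1}"
      then have "m i = 1" by blast
      then show "m i div gcd (m i) (nat \<bar>x i\<bar>) = 1" by simp
    qed
    show "finite (insert 1 ((\<lambda>i. m i div gcd (m i) (nat \<bar>x i\<bar>)) ` {i. m i \<noteq> 1}))"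
      using assms by (simp add: moduli_def)
  qed
  moreover have "m i div gcd (m i) (nat \<bar>x i\<bar>) \<noteq> 0" for i
    using assms by (metis dvd_div_eq_0_iff gcd_dvd1 moduliD not_gr_zero)
  ultimately have "vord m x \<noteq> 0"
    unfolding vord_def by (subst Lcm_0_iff) (assumption, simp only: image_iff, metis)
  then show ?thesis by simp
qed

lemma vord_eq_1_iff: "moduli m \<Longrightarrow> vord m x = 1 \<longleftrightarrow> nul m x"
  using nul_scale_iff[of m 1 x] by (simp add: scale_def)

lemma vord_dvdI: "moduli m \<Longrightarrow> (\<And>i. m i dvd N) \<Longrightarrow> vord m x dvd N"
  by (subst nul_scale_iff[symmetric]) (auto simp: nul_def scale_def)

lemma scale_add: "scale k (x + y) = scale k x + scale k y"
  by (auto simp: scale_def plus_fun_apply algebra_simps)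

lemma scale_sum_mset: "scale k (sum_mset T) = (\<Sum>x\<in>#T. scale k x)"
  by (induction T) (simp_all add: scale_add, simp add: scale_def zero_fun_def)

lemma nul_sum_mset: "(\<And>x. x \<in># T \<Longrightarrow> nul m x) \<Longrightarrow> nul m (sum_mset T)"
  by (induction T) (auto intro: nul_add)

lemma vord_sum_mset_dvd:
  assumes "moduli m" "\<And>x. x \<in># T \<Longrightarrow> vord m x dvd N"
  shows "vord m (sum_mset T) dvd N"
proof -
  have "nul m (\<Sum>x\<in>#T. scale N x)"
    using assms by (intro nul_sum_mset) (auto simp: nul_scale_iff)
  then show ?thesis using assms(1) by (simp add: scale_sum_mset flip: nul_scale_iff)
qed

definition zs_free :: "(nat \<Rightarrow> nat) \<Rightarrow> vec multiset \<Rightarrow> bool" where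
  "zs_free m S \<longleftrightarrow> (\<forall>T. T \<subseteq># S \<longrightarrow> nul m (sum_mset T) \<longrightarrow> T = {#})"

definition xnum :: "(nat \<Rightarrow> nat) \<Rightarrow> vec multiset \<Rightarrow> real" where
  "xnum m S = (\<Sum>x\<in>#S. 1 / real (vord m x))"

text \<open>The upper bounds for little cross numbers in terms of the representation.\<close>

definition cross_bound :: "(nat \<Rightarrow> nat) \<Rightarrow> real \<Rightarrow> bool" where
  "cross_bound m B \<longleftrightarrow> (\<forall>S. zs_free m S \<longrightarrow> xnum m S \<le> B)"

lemma zsfD: "zs_free m S \<Longrightarrow> T \<subseteq># S \<Longrightarrow> nul m (sum_mset T) \<Longrightarrow> T = {#}"
  by (simp add: zs_free_def)

lemma zs_free_not_nul: "zs_free m S \<Longrightarrow> x \<in># S \<Longrightarrow> \<not> nul m x"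
  using zsfD[of m S "{#x#}"] by auto

lemma xnum_empty [simp]: "xnum m {#} = 0" by (simp add: xnum_def)
lemma xnum_add [simp]: "xnum m (S + T) = xnum m S + xnum m T" by (simp add: xnum_def)
lemma xnum_add_mset [simp]: "xnum m (add_mset x S) = 1 / real (vord m x) + xnum m S" by (simp add: xnum_def)
lemma xnum_nonneg [simp]: "xnum m S \<ge> 0" by (induction S) auto

lemma xnum_diff: "T \<subseteq># S \<Longrightarrow> xnum m (S - T) = xnum m S - xnum m T"
  by (metis add_diff_cancel_right' subset_mset.diff_add xnum_add)

lemma xnum_mono: "T \<subseteq># S \<Longrightarrow> xnum m T \<le> xnum m S"
  using xnum_diff[of T S m] xnum_nonneg[of m "S - T"] by linarith

section \<open>Difference operators\<close>

type_synonym func = "vec \<Rightarrow> int"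

text \<open>The operator \<open>f \<mapsto> f(\<cdot> + v) - f\<close> is multiplication by \<open>X\<^sup>v - 1\<close> in the group algebra. All identities
  below are used modulo the prime \<open>p\<close>, hence the predicate \<open>dvd_fun\<close> for functions that vanish modulo \<open>p\<close>.\<close>

definition shift_diff :: "vec \<Rightarrow> func \<Rightarrow> func" where
  "shift_diff v f = (\<lambda>x. f (x + v) - f x)"

definition dvd_fun :: "nat \<Rightarrow> func \<Rightarrow> bool" where
  "dvd_fun p f \<longleftrightarrow> (\<forall>x. int p dvd f x)"

lemma shift_diff_commute: "shift_diff v (shift_diff w f) = shift_diff w (shift_diff v f)"
  by (auto simp: shift_diff_def add_ac)

lemma shift_diff_minus: "shift_diff v (\<lambda>x. f x - g x) = (\<lambda>x. shift_diff v f x - shift_diff v g x)"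
  by (auto simp: shift_diff_def)

lemma shift_diff_shift: "shift_diff v (\<lambda>x. f (x + w)) = (\<lambda>x. shift_diff v f (x + w))"
  by (auto simp: shift_diff_def add_ac)

lemma dvd_fun_shift_diff: "dvd_fun p f \<Longrightarrow> dvd_fun p (shift_diff v f)"
  by (auto simp: dvd_fun_def shift_diff_def)

abbreviation shift_diffs :: "vec list \<Rightarrow> func \<Rightarrow> func" where
  "shift_diffs xs f \<equiv> foldr shift_diff xs f"

lemma shift_diffs_shift_diff: "shift_diffs xs (shift_diff v f) = shift_diff v (shift_diffs xs f)"
  by (induction xs) (auto simp: shift_diff_commute)

lemma shift_diffs_minus: "shift_diffs xs (\<lambda>x. f x - g x) = (\<lambda>x. shift_diffs xs f x - shift_diffs xs g x)"
  by (induction xs) (auto simp: shift_diff_minus)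

lemma shift_diffs_shift: "shift_diffs xs (\<lambda>x. f (x + w)) = (\<lambda>x. shift_diffs xs f (x + w))"
  by (induction xs) (auto simp: shift_diff_shift)

lemma dvd_fun_shift_diffs: "dvd_fun p f \<Longrightarrow> dvd_fun p (shift_diffs xs f)"
  by (induction xs) (auto simp: dvd_fun_shift_diff)

text \<open>The binomial theorem for the difference of a shift and the identity.\<close>

lemma pow_shift_diff: "(shift_diff v ^^ n) f x = (\<Sum>k\<le>n. (-1) ^ (n - k) * int (n choose k) * f (x + scale k v))"
proof (induction n arbitrary: x)
  case (Suc n)
  let ?t = "\<lambda>n k. (-1) ^ (n - k) * int (n choose k) * f (x + scale k v)"
  have sc: "x + v + scale k v = x + scale (Suc k) v" for k
    by (auto simp: scale_def plus_fun_apply algebra_simps)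
  have "(shift_diff v ^^ Suc n) f x = (shift_diff v ^^ n) f (x + v) - (shift_diff v ^^ n) f x" by (simp add: shift_diff_def)
  also have "\<dots> = (\<Sum>k\<le>n. (-1) ^ (n - k) * int (n choose k) * f (x + scale (Suc k) v)) -
      (\<Sum>k\<le>n. ?t n k)"
    by (simp add: Suc.IH sc)
  also have "\<dots> = (\<Sum>k\<le>Suc n. ?t (Suc n) k)"
  proof -
    have e: "(\<Sum>k\<le>n. ?t n k) = ?t n 0 + (\<Sum>k\<le>n. (-1) ^ (n - Suc k) * int (n choose Suc k) * f (x + scale (Suc k) v))"
    proof -
      have "(\<Sum>k\<le>n. ?t n k) = (\<Sum>k\<le>Suc n. ?t n k)" by simp
      also have "\<dots> = ?t n 0 + (\<Sum>k\<le>n. ?t n (Suc k))" by (rule sum.atMost_Suc_shift)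
      finally show ?thesis by simp
    qed
    have "(\<Sum>k\<le>Suc n. ?t (Suc n) k) = ?t (Suc n) 0 + (\<Sum>k\<le>n. ?t (Suc n) (Suc k))"
      by (rule sum.atMost_Suc_shift)
    also have "(\<Sum>k\<le>n. ?t (Suc n) (Suc k)) =
       (\<Sum>k\<le>n. (-1) ^ (n - k) * int (n choose k) * f (x + scale (Suc k) v)) -
       (\<Sum>k\<le>n. (-1) ^ (n - Suc k) * int (n choose Suc k) * f (x + scale (Suc k) v))"
      unfolding sum_subtractf[symmetric]
    proof (rule sum.cong[OF refl])
      fix k assume "k \<in> {..n}"
      show "?t (Suc n) (Suc k) = (-1) ^ (n - k) * int (n choose k) * f (x + scale (Suc k) v) -
         (-1) ^ (n - Suc k) * int (n choose Suc k) * f (x + scale (Suc k) v)"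
      proof (cases "k < n")
        case True
        then have "n - k = Suc (n - Suc k)" by simp
        then show ?thesis by (simp add: algebra_simps)
      next
        case False
        then show ?thesis using \<open>k \<in> {..n}\<close> by (simp add: algebra_simps)
      qed
    qed
    finally show ?thesis using e by simp
  qed
  finally show ?case .
qed (simp add: scale_def zero_fun_def[symmetric])

text \<open>The inner binomial coefficients are divisible by \<open>p\<close>; for \<open>p = 2\<close> the sign of \<open>f x\<close> does not
  matter.\<close>

lemma frobenius_step:
  assumes "prime p"
  shows "dvd_fun p (\<lambda>x. (shift_diff v ^^ p) f x - shift_diff (scale p v) f x)"
  unfolding dvd_fun_def
proof
  fix x
  let ?t = "\<lambda>k. (-1) ^ (p - k) * int (p choose k) * f (x + scale k v)"
  have p: "p > 1" using assms prime_gt_1_nat by blast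
  have "(\<Sum>k\<le>p. ?t k) = (\<Sum>k\<in>{0,p}. ?t k) + (\<Sum>k\<in>{..p}-{0,p}. ?t k)"
    by (subst add.commute, rule sum.subset_diff) auto
  moreover have "(\<Sum>k\<in>{0,p}. ?t k) = (-1) ^ p * f x + f (x + scale p v)"
    using p by (simp add: scale_def zero_fun_def[symmetric])
  ultimately have "(shift_diff v ^^ p) f x - shift_diff (scale p v) f x =
     ((-1) ^ p + 1) * f x + (\<Sum>k\<in>{..p}-{0,p}. ?t k)"
    by (simp add: pow_shift_diff shift_diff_def algebra_simps)
  moreover have "int p dvd (\<Sum>k\<in>{..p}-{0,p}. ?t k)"
  proof (rule dvd_sum)
    fix k assume "k \<in> {..p}-{0,p}"
    then have "p dvd (p choose k)" using assms by (intro dvd_choose_prime) auto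
    then show "int p dvd ?t k" by (meson dvd_mult dvd_mult2 int_dvd_int_iff)
  qed
  moreover have "int p dvd ((-1) ^ p + 1)"
  proof (cases "p = 2")
    case False
    then have "odd p" using assms prime_odd_nat p by (metis One_nat_def Suc_lessI numeral_2_eq_2)
    then show ?thesis by simp
  qed simp
  ultimately show "int p dvd (shift_diff v ^^ p) f x - shift_diff (scale p v) f x" by simp
qed

lemma dvd_fun_pow: "(\<And>f. dvd_fun p f \<Longrightarrow> dvd_fun p (A f)) \<Longrightarrow> dvd_fun p f \<Longrightarrow> dvd_fun p ((A ^^ n) f)"
  by (induction n) auto

lemma pow_shift_diff_minus: "(shift_diff v ^^ n) (\<lambda>x. f x - g x) = (\<lambda>x. (shift_diff v ^^ n) f x - (shift_diff v ^^ n) g x)"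
  by (induction n) (auto simp: shift_diff_minus)

text \<open>The group algebra identity \<open>(X\<^sup>v - 1)\<^sup>q = X\<^sup>q\<^sup>v - 1\<close> modulo \<open>p\<close>, where \<open>q = p\<^sup>t\<close>.\<close>

lemma frobenius:
  assumes "prime p"
  shows "dvd_fun p (\<lambda>x. (shift_diff v ^^ (p ^ t)) f x - shift_diff (scale (p ^ t) v) f x)"
proof (induction t arbitrary: v)
  case 0
  then show ?case by (simp add: dvd_fun_def scale_def)
next
  case (Suc t)
  let ?w = "scale p v"
  have "dvd_fun p (\<lambda>x. ((shift_diff v ^^ p) ^^ n) f x - (shift_diff ?w ^^ n) f x)" for n
  proof (induction n)
    case (Suc n)
    let ?g = "((shift_diff v ^^ p) ^^ n) f" and ?h = "(shift_diff ?w ^^ n) f"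
    have "dvd_fun p ((shift_diff v ^^ p) (\<lambda>x. ?g x - ?h x))"
      using Suc by (intro dvd_fun_pow dvd_fun_shift_diff)
    moreover have "dvd_fun p (\<lambda>x. (shift_diff v ^^ p) ?h x - shift_diff ?w ?h x)" by (rule frobenius_step[OF assms])
    ultimately have "dvd_fun p (\<lambda>x. (shift_diff v ^^ p) (\<lambda>x. ?g x - ?h x) x + ((shift_diff v ^^ p) ?h x - shift_diff ?w ?h x))"
      by (simp add: dvd_fun_def)
    then show ?case by (simp add: pow_shift_diff_minus)
  qed (simp add: dvd_fun_def)
  from this[of "p ^ t"] have "dvd_fun p (\<lambda>x. (shift_diff v ^^ p ^ Suc t) f x - (shift_diff ?w ^^ p ^ t) f x)"
    by (simp add: funpow_mult mult.commute)
  moreover have "dvd_fun p (\<lambda>x. (shift_diff ?w ^^ p ^ t) f x - shift_diff (scale (p ^ t) ?w) f x)" by (rule Suc)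
  ultimately have "dvd_fun p (\<lambda>x. ((shift_diff v ^^ p ^ Suc t) f x - (shift_diff ?w ^^ p ^ t) f x) + ((shift_diff ?w ^^ p ^ t) f x - shift_diff (scale (p ^ t) ?w) f x))"
    unfolding dvd_fun_def by (intro allI dvd_add) auto
  moreover have "scale (p ^ t) ?w = scale (p ^ Suc t) v" by (auto simp: scale_def)
  ultimately show ?case by simp
qed

section \<open>The cross number of a finite abelian p-group\<close>

lemma shift_diffs_add: "shift_diffs xs (\<lambda>x. f x + g x) = (\<lambda>x. shift_diffs xs f x + shift_diffs xs g x)"
  by (induction xs) (auto simp: shift_diff_def)

text \<open>Expanding the product of the differences gives the values of \<open>f\<close> at \<open>y\<close> plus all subsums of the
  sequence; the only surviving one belongs to the empty subsum.\<close>

lemma shift_diffs_eval: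
  assumes "\<And>T. T \<subseteq># mset xs \<Longrightarrow> T \<noteq> {#} \<Longrightarrow> f (y + sum_mset T) = 0"
  shows "shift_diffs xs f y = (-1) ^ length xs * f y"
  using assms
proof (induction xs arbitrary: y)
  case (Cons v xs)
  have 1: "shift_diffs xs f y = (-1) ^ length xs * f y"
  proof (rule Cons.IH)
    fix T assume T: "T \<subseteq># mset xs" "T \<noteq> {#}"
    have "T \<subseteq># mset (v # xs)"
      using T(1) by (metis add_mset_add_single mset.simps(2) mset_subset_eq_add_left subset_mset.order_trans)
    then show "f (y + sum_mset T) = 0" using Cons.prems T(2) by blast
  qed
  have 2: "shift_diffs xs f (y + v) = (-1) ^ length xs * f (y + v)"
  proof (rule Cons.IH)
    fix T assume "T \<subseteq># mset xs" "T \<noteq> {#}"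
    then show "f (y + v + sum_mset T) = 0" using Cons.prems[of "add_mset v T"] by (simp add: add_ac)
  qed
  have "f (y + v) = 0" using Cons.prems[of "{#v#}"] by simp
  then show ?case using 1 2 by (simp add: shift_diff_def[where v = v])
qed simp

lemma funpow_shift_diff_commute: "(shift_diff v ^^ n) ((shift_diff w ^^ k) f) = (shift_diff w ^^ k) ((shift_diff v ^^ n) f)"
proof -
  have *: "(shift_diff v ^^ n) (shift_diff w g) = shift_diff w ((shift_diff v ^^ n) g)" for g
    by (induction n) (auto simp: shift_diff_commute)
  show ?thesis by (induction k) (auto simp: *)
qed

text \<open>A function that is invariant under the shift by \<open>u\<close> is invariant under the multiples of \<open>u\<close>.\<close>

lemma dvd_fun_shift_diff_multiple:
  assumes "dvd_fun p (shift_diff u F)"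
  shows "dvd_fun p (shift_diff (\<lambda>j. w * u j) F)"
proof -
  have step: "int p dvd F (x + u) - F x" for x using assms by (simp add: dvd_fun_def shift_diff_def)
  have "int p dvd F (x + (\<lambda>j. w * u j)) - F x" for x
  proof (induction w arbitrary: x rule: int_induct[where k = 0])
    case base
    then show ?case by (simp add: zero_fun_def[symmetric])
  next
    case (step1 i)
    have e: "x + (\<lambda>j. (i + 1) * u j) = x + (\<lambda>j. i * u j) + u"
      by (auto simp: plus_fun_apply algebra_simps)
    show ?case using dvd_add[OF step[of "x + (\<lambda>j. i * u j)"] step1(2)[of x]] by (simp add: e)
  next
    case (step2 i)
    have e: "x + (\<lambda>j. i * u j) = x + (\<lambda>j. (i - 1) * u j) + u"
      by (auto simp: plus_fun_apply algebra_simps)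
    show ?case using dvd_diff[OF step2(2)[of x] step[of "x + (\<lambda>j. (i - 1) * u j)"]] by (simp add: e)
  qed
  then show ?thesis by (simp add: dvd_fun_def shift_diff_def)
qed

definition axis :: "nat \<Rightarrow> nat \<Rightarrow> vec" where
  "axis h i = (\<lambda>j. if j = i then int h else 0)"

definition supported :: "nat set \<Rightarrow> func \<Rightarrow> bool" where
  "supported I f \<longleftrightarrow> (\<forall>x y. (\<forall>i\<in>I. x i = y i) \<longrightarrow> f x = f y)"

lemma supported_pow_shift_diff: "supported I f \<Longrightarrow> supported I ((shift_diff e ^^ n) f)"
proof (induction n)
  case (Suc n)
  then have "supported I ((shift_diff e ^^ n) f)" by simp
  then have "supported I (shift_diff e ((shift_diff e ^^ n) f))"
    unfolding supported_def shift_diff_def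
    by (intro allI impI arg_cong2[where f = minus]) (auto simp: plus_fun_apply)
  then show ?case by simp
qed simp

text \<open>Coordinate \<open>i\<close> has a budget of \<open>k i - 1\<close> differences in direction \<open>axis (h i) i\<close> before \<open>f\<close> vanishes. A
  vector \<open>v\<close> whose \<open>i\<close>-th coordinate is divisible by \<open>p\<^sup>t h i\<close> uses up \<open>p\<^sup>t\<close> of it, by \<open>frobenius\<close>. Since a
  difference along \<open>v\<close> is a sum of (shifted) differences along the coordinates of \<open>v\<close>, it is enough that every one
  of them exhausts its budget. The budgets are compared after division by \<open>p\<^sup>c\<^sup>i\<close>, and \<open>W v\<close> is a lower bound
  for what \<open>v\<close> uses up in every coordinate.\<close>

lemma shift_diffs_vanish:
  assumes "prime p" "finite I"
    and "supported I f" "\<And>i. i \<in> I \<Longrightarrow> dvd_fun p ((shift_diff (axis (h i) i) ^^ k i) f)"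
    and "\<And>v i. v \<in> set xs \<Longrightarrow> i \<in> I \<Longrightarrow>
      \<exists>t. int (p ^ t * h i) dvd v i \<and> W v \<le> real (p ^ t) / real (p ^ c i)"
    and "(\<Sum>i\<in>I. (real (k i) - 1) / real (p ^ c i)) < (\<Sum>v\<leftarrow>xs. W v)"
  shows "dvd_fun p (shift_diffs xs f)"
  using assms(3-)
proof (induction xs arbitrary: f k)
  case Nil
  have "\<exists>i\<in>I. k i = 0"
  proof (rule ccontr)
    assume "\<not> ?thesis"
    then have "(\<Sum>i\<in>I. (real (k i) - 1) / real (p ^ c i)) \<ge> 0"
      by (intro sum_nonneg divide_nonneg_nonneg) (auto simp: Suc_le_eq)
    then show False using Nil by simp
  qed
  then show ?case using Nil(2) by force
next
  case (Cons v xs)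
  have p: "p > 0" using assms(1) prime_gt_0_nat by blast
  define r where "r = (\<lambda>I' j. if j \<in> I' then v j else (0::int))"
  \<comment> \<open>The difference along the \<open>i\<close>-th coordinate of \<open>v\<close>, which uses up the budget in this coordinate only.\<close>
  have one: "dvd_fun p (shift_diffs xs (shift_diff (r {i}) f))" if i: "i \<in> I" for i
  proof -
    obtain t where t: "int (p ^ t * h i) dvd v i" "W v \<le> real (p ^ t) / real (p ^ c i)"
      using Cons.prems(3)[of v i] i by auto
    obtain w where w: "v i = int (p ^ t * h i) * w" using t(1) by (auto simp: dvd_def)
    let ?e = "axis (h i) i"
    let ?g = "(shift_diff ?e ^^ (p ^ t)) f"
    have "dvd_fun p (shift_diffs xs ?g)"
    proof (cases "k i \<le> p ^ t")
      case True
      have "?g = (shift_diff ?e ^^ (p ^ t - k i)) ((shift_diff ?e ^^ k i) f)"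
        using True by (metis funpow_add comp_apply le_add_diff_inverse2)
      then have "dvd_fun p ?g" using Cons.prems(2)[OF i] by (simp add: dvd_fun_pow dvd_fun_shift_diff)
      then show ?thesis by (rule dvd_fun_shift_diffs)
    next
      case False
      let ?k = "k(i := k i - p ^ t)"
      show ?thesis
      proof (rule Cons.IH[where k = ?k])
        show "supported I ?g" using Cons.prems(1) by (rule supported_pow_shift_diff)
        show "dvd_fun p ((shift_diff (axis (h j) j) ^^ ?k j) ?g)" if j: "j \<in> I" for j
        proof (cases "j = i")
          case True
          have "(shift_diff ?e ^^ (k i - p ^ t)) ?g = (shift_diff ?e ^^ k i) f"
            using False by (metis funpow_add comp_apply le_add_diff_inverse2 nat_le_linear)
          then show ?thesis using True Cons.prems(2)[OF i] by simp
        next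
          case False
          then show ?thesis using Cons.prems(2)[OF j]
            by (simp add: funpow_shift_diff_commute[where w = ?e] dvd_fun_pow dvd_fun_shift_diff)
        qed
        have "(\<Sum>j\<in>I. (real (?k j) - 1) / real (p ^ c j)) =
           (\<Sum>j\<in>I. (real (k j) - 1) / real (p ^ c j)) - real (p ^ t) / real (p ^ c i)"
          using False i assms(2)
          by (simp add: sum.remove[OF assms(2) i] of_nat_diff diff_divide_distrib)
        then show "(\<Sum>j\<in>I. (real (?k j) - 1) / real (p ^ c j)) < (\<Sum>v\<leftarrow>xs. W v)"
          using Cons.prems(4) t(2) by simp
      qed (use Cons.prems(3) in auto)
    qed
    moreover have "dvd_fun p (\<lambda>x. shift_diffs xs ?g x - shift_diffs xs (shift_diff (scale (p ^ t) ?e) f) x)"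
      using dvd_fun_shift_diffs[OF frobenius[OF assms(1), where v = ?e and t = t and f = f], of xs] by (simp add: shift_diffs_minus)
    ultimately have "dvd_fun p (shift_diffs xs (shift_diff (scale (p ^ t) ?e) f))"
      unfolding dvd_fun_def by (metis dvd_diff_right_iff)
    then have "dvd_fun p (shift_diff (\<lambda>j. w * scale (p ^ t) ?e j) (shift_diffs xs f))"
      unfolding shift_diffs_shift_diff by (rule dvd_fun_shift_diff_multiple)
    moreover have "(\<lambda>j. w * scale (p ^ t) ?e j) = r {i}"
      using w by (auto simp: r_def scale_def axis_def)
    ultimately show ?thesis by (simp add: shift_diffs_shift_diff)
  qed
  \<comment> \<open>Collect the coordinates of \<open>v\<close> one by one.\<close>
  have all: "dvd_fun p (shift_diffs xs (shift_diff (r I') f))" if "finite I'" "I' \<subseteq> I" for I'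
    using that
  proof (induction I' rule: finite_induct)
    case empty
    have "r {} = 0" by (auto simp: r_def zero_fun_def)
    then have "dvd_fun p (shift_diff (r {}) f)" unfolding dvd_fun_def shift_diff_def by (simp only: add_0_right) simp
    then show ?case by (rule dvd_fun_shift_diffs)
  next
    case (insert i I')
    have e: "r (insert i I') = r I' + r {i}" using insert by (auto simp: r_def plus_fun_apply)
    have "shift_diff (r (insert i I')) f = (\<lambda>x. shift_diff (r {i}) f (x + r I') + shift_diff (r I') f x)"
      by (auto simp: shift_diff_def e add_ac)
    then have "shift_diffs xs (shift_diff (r (insert i I')) f) =
        (\<lambda>x. shift_diffs xs (shift_diff (r {i}) f) (x + r I') + shift_diffs xs (shift_diff (r I') f) x)"
      by (simp only: shift_diffs_add shift_diffs_shift)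
    then show ?case using one[of i] insert by (auto simp: dvd_fun_def)
  qed
  have "shift_diff v f = shift_diff (r I) f"
    using Cons.prems(1) unfolding supported_def shift_diff_def
    by (intro ext arg_cong2[of _ _ _ _ minus] refl) (auto simp: r_def plus_fun_apply)
  then have "shift_diffs (v # xs) f = shift_diffs xs (shift_diff (r I) f)" by (simp flip: shift_diffs_shift_diff)
  then show ?case using all[OF assms(2)] by simp
qed

text \<open>Olson's theorem in weighted form. If all terms are killed by \<open>p\<^sup>J\<close>, then they lie in the \<open>p\<^sup>J\<close>-torsion
  subgroup, which is why the exponents are cut off at \<open>J\<close>. For the indicator function of zero the
  difference along \<open>axis (h i) i\<close>, a generator of the torsion of the \<open>i\<close>-th summand, vanishes modulo \<open>p\<close> after
  \<open>p\<^sup>c\<^sup>i\<close> steps, and a term of order \<open>p\<^sup>j\<close> uses up the fraction \<open>p\<^sup>-\<^sup>j\<close> of this.\<close>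

theorem cross_number_p_group:
  assumes p: "prime p" and I: "finite I" and m: "\<And>i. i \<in> I \<Longrightarrow> m i = p ^ a i" "\<And>i. i \<notin> I \<Longrightarrow> m i = 1"
    and S: "zs_free m S" "\<And>x. x \<in># S \<Longrightarrow> vord m x dvd p ^ J"
  shows "xnum m S \<le> (\<Sum>i\<in>I. 1 - 1 / real (p ^ min (a i) J))"
proof (rule ccontr)
  assume neg: "\<not> ?thesis"
  have p0: "p > 0" using p prime_gt_0_nat by blast
  have mod: "moduli m" unfolding moduli_def
  proof
    show "\<forall>i. m i > 0" using m p0 by (metis less_numeral_extra(1) zero_less_power)
    show "finite {i. m i \<noteq> 1}" by (rule finite_subset[OF _ I]) (use m in auto)
  qed
  obtain xs where xs: "mset xs = S" using ex_mset by blast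
  define h where "h = (\<lambda>i. p ^ (a i - J))"
  define c where "c = (\<lambda>i. min (a i) J)"
  have mh: "m i = h i * p ^ c i" if "i \<in> I" for i
    using m(1)[OF that] by (auto simp: h_def c_def min_def simp flip: power_add)
  define f where "f = (\<lambda>x. if nul m x then 1 else (0::int))"
  have "dvd_fun p (shift_diffs xs f)"
  proof (rule shift_diffs_vanish[OF p I, where k = "\<lambda>i. p ^ c i" and h = h and W = "\<lambda>v. 1 / real (vord m v)" and c = c])
    have "nul m x \<longleftrightarrow> nul m y" if "\<forall>i\<in>I. x i = y i" for x y
      unfolding nul_def using that m(2) by (metis dvd_def mult_1 of_nat_1)
    then show "supported I f" by (auto simp: supported_def f_def)
    fix i assume i: "i \<in> I"
    let ?e = "axis (h i) i"
    have "nul m (scale (p ^ c i) ?e)"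
      unfolding nul_def using mh[OF i] by (auto simp: scale_def axis_def)
    then have "shift_diff (scale (p ^ c i) ?e) f x = 0" for x
      unfolding shift_diff_def f_def using nul_add_cancel[of m "scale (p ^ c i) ?e" x] by (simp add: add.commute)
    then show "dvd_fun p ((shift_diff ?e ^^ (p ^ c i)) f)"
      using frobenius[OF p, where v = ?e and t = "c i" and f = f] by (simp add: dvd_fun_def)
    fix v assume "v \<in> set xs"
    then have v: "vord m v dvd p ^ J" using S(2) xs by auto
    then obtain j where j: "j \<le> J" "vord m v = p ^ j"
      using divides_primepow_nat[OF p] by blast
    have "nul m (scale (p ^ j) v)" using nul_scale_iff[OF mod] j by simp
    then have d: "int (m i) dvd int (p ^ j) * v i" by (simp add: nul_def scale_def)
    show "\<exists>t. int (p ^ t * h i) dvd v i \<and> 1 / real (vord m v) \<le> real (p ^ t) / real (p ^ c i)"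
    proof (cases "j \<le> c i")
      case True
      have "m i = p ^ j * (p ^ (c i - j) * h i)"
        using True mh[OF i] by (simp flip: power_add mult.assoc)
      then have "int (p ^ j) * int (p ^ (c i - j) * h i) dvd int (p ^ j) * v i" using d by (metis of_nat_mult)
      then have "int (p ^ (c i - j) * h i) dvd v i" using p0 by (subst (asm) dvd_times_left_cancel_iff) auto
      moreover have "1 / real (vord m v) \<le> real (p ^ (c i - j)) / real (p ^ c i)"
      proof -
        have "p ^ c i = p ^ (c i - j) * p ^ j" using True by (simp flip: power_add)
        then show ?thesis using j p0 by simp
      qed
      ultimately show ?thesis by blast
    next
      case False
      then have "c i = a i" "h i = 1" using j by (auto simp: c_def h_def)
      moreover have "real (p ^ c i) \<le> real (p ^ j)" using False p0 by (simp add: power_increasing)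
      ultimately show ?thesis using j p0 by (intro exI[of _ 0]) (auto simp: frac_le)
    qed
  next
    have "(\<Sum>v\<leftarrow>xs. 1 / real (vord m v)) = xnum m S"
      unfolding xnum_def xs[symmetric] by (simp flip: sum_mset_sum_list)
    moreover have "(\<Sum>i\<in>I. (real (p ^ c i) - 1) / real (p ^ c i)) = (\<Sum>i\<in>I. 1 - 1 / real (p ^ min (a i) J))"
      using p0 by (intro sum.cong) (auto simp: c_def diff_divide_distrib)
    ultimately show "(\<Sum>i\<in>I. (real (p ^ c i) - 1) / real (p ^ c i)) < (\<Sum>v\<leftarrow>xs. 1 / real (vord m v))"
      using neg by simp
  qed
  moreover have "shift_diffs xs f 0 = (-1) ^ length xs * f 0"
    using zsfD[OF S(1)] xs by (intro shift_diffs_eval) (auto simp: f_def)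
  moreover have "int p dvd shift_diffs xs f 0" if "dvd_fun p (shift_diffs xs f)" using that by (simp add: dvd_fun_def)
  ultimately have "int p dvd (-1) ^ length xs" by (simp add: f_def)
  moreover have "(-1::int) ^ length xs dvd 1" by (simp add: minus_one_power_iff)
  ultimately have "int p dvd 1" by (rule dvd_trans)
  then show False using p by auto
qed

section \<open>Short zero-sum subsequences\<close>

lemma weight_integral:
  fixes e :: "'a \<Rightarrow> nat"
  assumes "p > 0" "\<And>x. x \<in># V \<Longrightarrow> e x \<le> J"
  shows "(\<Sum>x\<in>#V. 1 / real (p ^ e x)) * real (p ^ J) = real (\<Sum>x\<in>#V. p ^ (J - e x))"
  using assms(2)
proof (induction V)
  case (add y V)
  then have "p ^ J = p ^ (J - e y) * p ^ e y" by (simp flip: power_add)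
  then have "1 / real (p ^ e y) * real (p ^ J) = real (p ^ (J - e y))"
    using assms(1) by simp
  then show ?case using add by (simp add: distrib_right)
qed simp

lemma max_exponent:
  fixes e :: "'a \<Rightarrow> nat"
  assumes "V \<noteq> {#}"
  shows "\<exists>x\<in>#V. \<forall>y\<in>#V. e y \<le> e x"
proof -
  have "Max (e ` set_mset V) \<in> e ` set_mset V" using assms by (intro Max_in) auto
  then obtain x where "x \<in># V" "e x = Max (e ` set_mset V)" by auto
  then show ?thesis by (intro bexI[of _ x]) simp_all
qed

text \<open>Drop terms of largest order \<open>p\<^sup>J\<close> until the weight is exact: as the weight is a multiple of \<open>p\<^sup>-\<^sup>J\<close>,
  a single such step cannot lead from above \<open>N\<close> to below \<open>N\<close>.\<close>

lemma weight_exact: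
  fixes e :: "'a \<Rightarrow> nat"
  assumes "p > 1" "real N \<le> (\<Sum>x\<in>#U. 1 / real (p ^ e x))"
  shows "\<exists>U'. U' \<subseteq># U \<and> (\<Sum>x\<in>#U'. 1 / real (p ^ e x)) = real N"
  using assms(2)
proof (induction "size U" arbitrary: U rule: less_induct)
  case less
  let ?s = "\<lambda>U. (\<Sum>x\<in>#U. 1 / real (p ^ e x))"
  show ?case
  proof (cases "?s U = real N")
    case False
    then have gt: "?s U > real N" using less.prems by simp
    then have ne: "U \<noteq> {#}" by auto
    obtain x J where x: "x \<in># U" "e x = J" and le: "\<And>y. y \<in># U \<Longrightarrow> e y \<le> J"
      using max_exponent[OF ne, of e] by blast
    have scaled: "?s U * real (p ^ J) = real (\<Sum>x\<in>#U. p ^ (J - e x))"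
      using assms(1) le by (intro weight_integral) auto
    \<comment> \<open>After multiplication by \<open>p\<^sup>J\<close> all weights are integers.\<close>
    have "real N * real (p ^ J) < ?s U * real (p ^ J)"
      using gt assms(1) by (intro mult_strict_right_mono) auto
    then have "real (N * p ^ J) < real (\<Sum>x\<in>#U. p ^ (J - e x))"
      unfolding scaled of_nat_mult .
    then have "N * p ^ J + 1 \<le> (\<Sum>x\<in>#U. p ^ (J - e x))" by linarith
    then have "real (N * p ^ J + 1) \<le> ?s U * real (p ^ J)" unfolding scaled of_nat_le_iff .
    then have "real N + 1 / real (p ^ J) \<le> ?s U"
      using assms(1) by (simp add: field_simps)
    moreover have U: "U = add_mset x (U - {#x#})" using x by simp
    have "?s (add_mset x (U - {#x#})) = 1 / real (p ^ J) + ?s (U - {#x#})" using x(2) by simp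
    then have "?s U = 1 / real (p ^ J) + ?s (U - {#x#})" unfolding U[symmetric] .
    ultimately have "real N \<le> ?s (U - {#x#})" by simp
    moreover have "size (U - {#x#}) < size U" using x by (simp add: size_Diff1_less)
    ultimately obtain U' where "U' \<subseteq># U - {#x#}" "?s U' = real N" using less.hyps by blast
    then show ?thesis by (meson diff_subset_eq_self subset_mset.order_trans)
  qed auto
qed

definition cyc :: "nat \<Rightarrow> nat \<Rightarrow> nat \<Rightarrow> nat" where
  "cyc i q = (\<lambda>j. if j = i then q else 1)"

lemma moduli_cyc [simp]: "q > 0 \<Longrightarrow> moduli (cyc i q)"
  unfolding moduli_def cyc_def by (auto intro: finite_subset[of _ "{i}"])

lemma p_power_orders:
  assumes "prime p" "moduli m" "\<And>i. m i dvd p ^ N"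
  obtains e where "\<And>x. e x \<le> N" "\<And>x. vord m x = p ^ e x"
proof -
  have "\<exists>j\<le>N. vord m x = p ^ j" for x
    using vord_dvdI[OF assms(2,3), of x] divides_primepow_nat[OF assms(1)] by blast
  then show ?thesis using that by metis
qed

definition short_zs :: "(nat \<Rightarrow> nat) \<Rightarrow> real \<Rightarrow> bool" where
  "short_zs a u \<longleftrightarrow> (\<forall>U. xnum a U > u \<longrightarrow>
     (\<exists>T. T \<subseteq># U \<and> T \<noteq> {#} \<and> nul a (sum_mset T) \<and> xnum a T \<le> 1))"

lemma xnum_p_power: "(\<And>x. vord m x = p ^ e x) \<Longrightarrow> xnum m U = (\<Sum>x\<in>#U. 1 / real (p ^ e x))"
  by (simp add: xnum_def)

lemma cross_number_cyclic:
  assumes "prime p" "zs_free (cyc i (p ^ \<alpha>)) U"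
  shows "xnum (cyc i (p ^ \<alpha>)) U \<le> 1 - 1 / real (p ^ \<alpha>)"
proof -
  have p: "p > 0" using assms(1) prime_gt_0_nat by blast
  have "xnum (cyc i (p ^ \<alpha>)) U \<le> (\<Sum>i\<in>{i}. 1 - 1 / real (p ^ min \<alpha> \<alpha>))"
    by (rule cross_number_p_group[OF assms(1)])
      (use assms p in \<open>auto simp: cyc_def intro!: vord_dvdI moduli_cyc[unfolded cyc_def]\<close>)
  then show ?thesis by simp
qed

text \<open>The weights are multiples of \<open>p\<^sup>-\<^sup>\<alpha>\<close>, so a weight above \<open>1 - p\<^sup>-\<^sup>\<alpha>\<close> is at least \<open>1\<close>, and a subsequence has weight
  exactly \<open>1\<close>. It is not zero-sum free by Olson's bound.\<close>

lemma short_zs_cyclic: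
  assumes "prime p"
  shows "short_zs (cyc i (p ^ \<alpha>)) (1 - 1 / real (p ^ \<alpha>))"
  unfolding short_zs_def
proof (intro allI impI)
  fix U
  let ?a = "cyc i (p ^ \<alpha>)"
  assume U: "1 - 1 / real (p ^ \<alpha>) < xnum ?a U"
  have p: "p > 1" using assms prime_gt_1_nat by blast
  have "moduli ?a" "\<And>k. ?a k dvd p ^ \<alpha>" using p by (simp, simp add: cyc_def)
  then obtain e where e: "\<And>x. e x \<le> \<alpha>" "\<And>x. vord ?a x = p ^ e x"
    using p_power_orders[OF assms] by blast
  have xnum: "xnum ?a V = (\<Sum>x\<in>#V. 1 / real (p ^ e x))" for V by (rule xnum_p_power) (rule e)
  have int: "xnum ?a U * real (p ^ \<alpha>) = real (\<Sum>x\<in>#U. p ^ (\<alpha> - e x))"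
    unfolding xnum using p e by (intro weight_integral) auto
  have "real (p ^ \<alpha>) - 1 < xnum ?a U * real (p ^ \<alpha>)"
    using U p by (simp add: field_simps)
  then have "real (p ^ \<alpha>) - 1 < real (\<Sum>x\<in>#U. p ^ (\<alpha> - e x))" unfolding int .
  then have "p ^ \<alpha> \<le> (\<Sum>x\<in>#U. p ^ (\<alpha> - e x))" by linarith
  then have "real (p ^ \<alpha>) \<le> xnum ?a U * real (p ^ \<alpha>)"
    unfolding int of_nat_le_iff .
  then have "real 1 \<le> xnum ?a U" using p by (simp add: field_simps)
  then obtain U' where U': "U' \<subseteq># U" "xnum ?a U' = 1" using weight_exact[OF p, of 1 e U] unfolding xnum by auto
  have "\<not> zs_free ?a U'"
  proof
    assume "zs_free ?a U'"
    then have "1 \<le> 1 - 1 / real (p ^ \<alpha>)" using cross_number_cyclic[OF assms] U'(2) by metis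
    then show False using p by (auto simp: field_simps)
  qed
  then obtain T where T: "T \<subseteq># U'" "nul ?a (sum_mset T)" "T \<noteq> {#}" by (auto simp: zs_free_def)
  then show "\<exists>T. T \<subseteq># U \<and> T \<noteq> {#} \<and> nul ?a (sum_mset T) \<and> xnum ?a T \<le> 1"
    using U' xnum_mono[OF T(1), of ?a] subset_mset.order_trans by (intro exI[of _ T]) auto
qed

definition cyc2 :: "nat \<Rightarrow> nat \<Rightarrow> nat \<Rightarrow> nat \<Rightarrow> nat \<Rightarrow> nat" where
  "cyc2 i q j q' = (\<lambda>k. if k = i then q else if k = j then q' else 1)"

lemma moduli_cyc2 [simp]: "q > 0 \<Longrightarrow> q' > 0 \<Longrightarrow> moduli (cyc2 i q j q')"
  unfolding moduli_def cyc2_def by (auto intro: finite_subset[of _ "{i,j}"])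

lemma cross_number_rank_two:
  assumes p: "prime p" and ij: "i \<noteq> j" and J: "J \<le> A"
    and z: "zs_free (cyc2 i (p ^ A) j (p ^ B)) U"
    and o: "\<And>x. x \<in># U \<Longrightarrow> vord (cyc2 i (p ^ A) j (p ^ B)) x dvd p ^ J"
  shows "xnum (cyc2 i (p ^ A) j (p ^ B)) U \<le> 2 - 1 / real (p ^ J) - 1 / real (p ^ min B J)"
proof -
  have "xnum (cyc2 i (p ^ A) j (p ^ B)) U \<le> (\<Sum>k\<in>{i,j}. 1 - 1 / real (p ^ min (if k = j then B else A) J))"
    by (rule cross_number_p_group[OF p _ _ _ z o]) (use ij in \<open>auto simp: cyc2_def\<close>)
  also have "\<dots> = 2 - 1 / real (p ^ J) - 1 / real (p ^ min B J)" using ij J by (simp add: min_def)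
  finally show ?thesis .
qed

lemma cross_number_rank_two_full:
  assumes p: "prime p" and ij: "i \<noteq> j" and BA: "B \<le> A" and z: "zs_free (cyc2 i (p ^ A) j (p ^ B)) U"
  shows "xnum (cyc2 i (p ^ A) j (p ^ B)) U \<le> 2 - 1 / real (p ^ A) - 1 / real (p ^ B)"
proof -
  have "vord (cyc2 i (p ^ A) j (p ^ B)) x dvd p ^ A" for x
    by (rule vord_dvdI) (use prime_gt_0_nat[OF p] BA in \<open>auto simp: cyc2_def le_imp_power_dvd intro!: moduli_cyc2[unfolded cyc2_def]\<close>)
  then show ?thesis using cross_number_rank_two[OF p ij order_refl z] BA by (simp add: min_def split: if_splits)
qed

text \<open>The bound exceeds the little cross number of the group by one. Add a third coordinate, modulo
  \<open>p\<^sup>A\<close>, in which a term \<open>x\<close> of order \<open>p\<^sup>e\<close> gets the entry \<open>p\<^sup>A\<^sup>-\<^sup>e\<close>. This does not change the order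
  of \<open>x\<close>, and a zero-sum subsequence for the enlarged group has integral weight. Olson's bound for rank
  three, applied to a subsequence of weight less than \<open>3\<close>, produces one of weight \<open>1\<close> or \<open>2\<close>. In the latter case,
  remove a term of largest order; what is left is still too heavy to be zero-sum free, so the
  sequence splits into two zero-sum subsequences, and one of them has weight at most \<open>1\<close>.\<close>

lemma short_zs_rank_two:
  assumes p: "prime p" and ij: "i \<noteq> j" and AB: "B \<le> A"
  shows "short_zs (cyc2 i (p ^ A) j (p ^ B)) (3 - 1 / real (p ^ A) - 1 / real (p ^ B))"
  unfolding short_zs_def
proof (intro allI impI)
  fix U
  let ?a = "cyc2 i (p ^ A) j (p ^ B)"
  assume U: "3 - 1 / real (p ^ A) - 1 / real (p ^ B) < xnum ?a U"
  have p1: "p > 1" using p prime_gt_1_nat by blast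
  have mod: "moduli ?a" using p1 by simp
  have dvd: "?a k dvd p ^ A" for k using AB by (auto simp: cyc2_def le_imp_power_dvd)
  obtain e where e: "\<And>x. e x \<le> A" "\<And>x. vord ?a x = p ^ e x"
    using p_power_orders[OF p mod dvd] by blast
  have xnum: "xnum ?a V = (\<Sum>x\<in>#V. 1 / real (p ^ e x))" for V by (rule xnum_p_power) (rule e)
  \<comment> \<open>The additional coordinate is \<open>l\<close>.\<close>
  define l where "l = i + j + 1"
  have l: "l \<noteq> i" "l \<noteq> j" by (auto simp: l_def)
  define a3 where "a3 = ?a(l := p ^ A)"
  define g where "g = (\<lambda>x::vec. x(l := int (p ^ (A - e x))))"
  have mod3: "moduli a3"
    using p1 unfolding moduli_def a3_def cyc2_def by (auto intro: finite_subset[of _ "{i,j,l}"])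
  have nul3: "nul a3 x \<longleftrightarrow> nul ?a x \<and> int (p ^ A) dvd x l" for x
  proof -
    have 1: "?a l = 1" using l by (simp add: cyc2_def)
    have "a3 k = (if k = l then p ^ A else ?a k)" for k by (simp add: a3_def)
    then have "nul a3 x \<longleftrightarrow> (\<forall>k. k \<noteq> l \<longrightarrow> int (?a k) dvd x k) \<and> int (p ^ A) dvd x l"
      unfolding nul_def by (smt (verit))
    moreover have "nul ?a x \<longleftrightarrow> (\<forall>k. k \<noteq> l \<longrightarrow> int (?a k) dvd x k)"
      unfolding nul_def using 1 by (metis of_nat_1 one_dvd)
    ultimately show ?thesis by simp
  qed
  have nulg: "nul ?a y" if "\<And>k. k \<noteq> l \<Longrightarrow> y k = x k" "nul ?a x" for x y
    unfolding nul_def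
  proof
    fix k show "int (?a k) dvd y k"
      using that l by (cases "k = l") (auto simp: nul_def cyc2_def split: if_splits)
  qed
  have vord3: "vord a3 (g x) = p ^ e x" for x
  proof (rule dvd_antisym)
    have 1: "nul a3 (scale k (g x)) \<longleftrightarrow> p ^ e x dvd k" for k
    proof -
      have "nul ?a (scale k (g x)) \<longleftrightarrow> nul ?a (scale k x)"
        by (rule iffI; erule nulg[rotated]) (auto simp: g_def scale_def)
      also have "\<dots> \<longleftrightarrow> p ^ e x dvd k" by (simp add: nul_scale_iff[OF mod] e)
      finally have *: "nul ?a (scale k (g x)) \<longleftrightarrow> p ^ e x dvd k" .
      have "int (p ^ A) dvd scale k (g x) l" if "p ^ e x dvd k"
      proof -
        have "p ^ A = p ^ e x * p ^ (A - e x)" using e by (simp flip: power_add)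
        then show ?thesis using that unfolding scale_def g_def
          by (metis fun_upd_same int_dvd_int_iff mult_dvd_mono dvd_refl of_nat_mult)
      qed
      then show ?thesis using * by (auto simp: nul3)
    qed
    show "vord a3 (g x) dvd p ^ e x" by (simp add: 1 flip: nul_scale_iff[OF mod3])
    show "p ^ e x dvd vord a3 (g x)" by (simp add: nul_scale_iff[OF mod3] flip: 1)
  qed
  \<comment> \<open>A subsequence of weight less than \<open>3\<close> that is still too heavy for Olson's bound in rank three.\<close>
  have ex: "\<exists>U' J. U' \<subseteq># U \<and> xnum ?a U' < 3 \<and> J \<le> A \<and> (\<forall>x\<in>#U'. e x \<le> J) \<and>
      xnum ?a U' > 3 - 2 / real (p ^ J) - 1 / real (p ^ min B J)"
  proof (cases "xnum ?a U < 3")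
    case True
    have "3 - 2 / real (p ^ A) - 1 / real (p ^ min B A) < xnum ?a U"
    proof -
      have "2 / real (p ^ A) > 1 / real (p ^ A)" using p1 by (simp add: field_simps)
      then show ?thesis using U AB by (simp add: min_def split: if_splits)
    qed
    then show ?thesis using e True by blast
  next
    case False
    then obtain V where V: "V \<subseteq># U" "xnum ?a V = 3" using weight_exact[OF p1, of 3 e U] unfolding xnum by auto
    then have ne: "V \<noteq> {#}" by auto
    obtain x J where x: "x \<in># V" "e x = J" and le: "\<And>y. y \<in># V \<Longrightarrow> e y \<le> J"
      using max_exponent[OF ne, of e] by blast
    have "xnum ?a (V - {#x#}) = 3 - 1 / real (p ^ J)" using x V by (subst xnum_diff) (auto simp: e)
    moreover have "1 / real (p ^ J) > 0" "1 / real (p ^ min B J) > 0" using p1 by auto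
    moreover have "V - {#x#} \<subseteq># U" using V by (meson diff_subset_eq_self subset_mset.order_trans)
    moreover have "J \<le> A" using x e by metis
    moreover have "\<forall>y\<in>#V - {#x#}. e y \<le> J" using le by (meson in_diffD)
    moreover have "3 - 2 / real (p ^ J) - 1 / real (p ^ min B J) < 3 - 1 / real (p ^ J)"
      using \<open>1 / real (p ^ J) > 0\<close> \<open>1 / real (p ^ min B J) > 0\<close> by linarith
    ultimately show ?thesis by (intro exI[of _ "V - {#x#}"] exI[of _ J]) simp
  qed
  then obtain U' J where U': "U' \<subseteq># U" "xnum ?a U' < 3" "J \<le> A" "\<And>x. x \<in># U' \<Longrightarrow> e x \<le> J"
      "xnum ?a U' > 3 - 2 / real (p ^ J) - 1 / real (p ^ min B J)"
    by blast
  have xn3: "xnum a3 (image_mset g V) = xnum ?a V" for V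
    unfolding xnum by (simp add: xnum_def vord3 multiset.map_comp comp_def)
  have "\<not> zs_free a3 (image_mset g U')"
  proof
    assume z: "zs_free a3 (image_mset g U')"
    have "xnum a3 (image_mset g U') \<le> (\<Sum>k\<in>{i,j,l}. 1 - 1 / real (p ^ min (if k = j then B else A) J))"
    proof (rule cross_number_p_group[OF p _ _ _ z])
      fix x assume "x \<in># image_mset g U'"
      then show "vord a3 x dvd p ^ J" using U'(4) by (auto simp: vord3 le_imp_power_dvd)
    qed (use ij l in \<open>auto simp: a3_def cyc2_def\<close>)
    also have "\<dots> = 3 - 2 / real (p ^ J) - 1 / real (p ^ min B J)"
      using ij l U'(3) by (simp add: min_def)
    finally show False using U'(5) xn3 by simp
  qed
  then obtain T' where T': "T' \<subseteq># image_mset g U'" "nul a3 (sum_mset T')" "T' \<noteq> {#}" by (auto simp: zs_free_def)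
  then obtain C where "image_mset g U' = T' + C" by (metis subset_mset.add_diff_inverse)
  then obtain T where T: "T \<subseteq># U'" "T' = image_mset g T"
    by (metis image_mset_eq_plusD mset_subset_eq_add_left)
  have sumg: "sum_mset T' k = sum_mset T k" if "k \<noteq> l" for k
    unfolding T(2) sum_mset_apply using that by (simp add: g_def multiset.map_comp comp_def)
  have nT: "nul ?a (sum_mset T)"
    by (rule nulg[where x = "sum_mset T'"]) (use T'(2) sumg nul3 in auto)
  have TU: "T \<subseteq># U" using T U' subset_mset.order_trans by blast
  have "sum_mset T' l = int (\<Sum>x\<in>#T. p ^ (A - e x))"
    unfolding T(2) sum_mset_apply by (simp add: g_def multiset.map_comp comp_def of_nat_sum_mset)
  then have "p ^ A dvd (\<Sum>x\<in>#T. p ^ (A - e x))" using T'(2) nul3 by (metis int_dvd_int_iff)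
  \<comment> \<open>The zero in coordinate \<open>l\<close> makes the weight of \<open>T\<close> an integer \<open>N\<close>, and \<open>N < 3\<close>.\<close>
  then obtain N where N: "(\<Sum>x\<in>#T. p ^ (A - e x)) = p ^ A * N" by (auto simp: dvd_def)
  have "xnum ?a T * real (p ^ A) = real (\<Sum>x\<in>#T. p ^ (A - e x))"
    unfolding xnum using p1 e by (intro weight_integral) auto
  then have "xnum ?a T * real (p ^ A) = real N * real (p ^ A)" by (simp only: N of_nat_mult mult.commute)
  then have xT: "xnum ?a T = real N" using p1 by simp
  then have "real N < 3" using U'(2) xnum_mono[OF T(1), of ?a] by simp
  show "\<exists>T. T \<subseteq># U \<and> T \<noteq> {#} \<and> nul ?a (sum_mset T) \<and> xnum ?a T \<le> 1"
  proof (cases "N \<le> 1")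
    case True
    then show ?thesis using xT nT TU T' T by (intro exI[of _ T]) auto
  next
    case False
    then have N2: "N = 2" using \<open>real N < 3\<close> by simp
    have ne: "T \<noteq> {#}" using T T' by auto
    obtain x J' where x: "x \<in># T" "e x = J'" and le: "\<And>y. y \<in># T \<Longrightarrow> e y \<le> J'"
      using max_exponent[OF ne, of e] by blast
    have "J' \<le> A" using x e by metis
    have xTx: "xnum ?a (T - {#x#}) = 2 - 1 / real (p ^ J')" using x xT N2 by (subst xnum_diff) (auto simp: e)
    have "\<not> zs_free ?a (T - {#x#})"
    proof
      assume z: "zs_free ?a (T - {#x#})"
      have "xnum ?a (T - {#x#}) \<le> 2 - 1 / real (p ^ J') - 1 / real (p ^ min B J')"
      proof (rule cross_number_rank_two[OF p ij \<open>J' \<le> A\<close> z])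
        fix y assume "y \<in># T - {#x#}"
        then have "y \<in># T" by (rule in_diffD)
        then show "vord ?a y dvd p ^ J'" using le by (auto simp: e le_imp_power_dvd)
      qed
      moreover have "1 / real (p ^ min B J') > 0" using p1 by simp
      ultimately show False using xTx by linarith
    qed
    then obtain T1 where T1: "T1 \<subseteq># T - {#x#}" "nul ?a (sum_mset T1)" "T1 \<noteq> {#}" by (auto simp: zs_free_def)
    define T2 where "T2 = T - T1"
    have T1T: "T1 \<subseteq># T" using T1 by (meson diff_subset_eq_self subset_mset.order_trans)
    have TT: "T = T1 + T2" using T1T by (simp add: T2_def)
    have "nul ?a (sum_mset T2)" using nT T1(2) unfolding TT by (simp add: nul_add_cancel)
    moreover have "T2 \<noteq> {#}"
    proof
      assume "T2 = {#}"
      then have "size T \<le> size (T - {#x#})" using TT T1(1) size_mset_mono by auto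
      then show False using size_Diff1_less[OF x(1)] by simp
    qed
    moreover have "T2 \<subseteq># U" "T1 \<subseteq># U" using T1T TT TU by (metis mset_subset_eq_add_right mset_subset_eq_add_left subset_mset.order_trans)+
    moreover have "xnum ?a T1 + xnum ?a T2 = 2" using xT N2 unfolding TT by simp
    ultimately show ?thesis using T1
      by (cases "xnum ?a T1 \<le> 1") (blast, intro exI[of _ T2], auto)
  qed
qed

section \<open>Families of disjoint zero-sum subsequences\<close>

text \<open>The members of \<open>F\<close> are disjoint subsequences of \<open>U\<close>, as their multiset union is contained in \<open>U\<close>.\<close>

definition zs_family :: "(nat \<Rightarrow> nat) \<Rightarrow> vec multiset \<Rightarrow> vec multiset multiset \<Rightarrow> bool" where
  "zs_family a U F \<longleftrightarrow> sum_mset F \<subseteq># U \<and> (\<forall>T\<in>#F. T \<noteq> {#} \<and> nul a (sum_mset T))"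

lemma zs_family_empty [simp]: "zs_family a U {#}"
  by (simp add: zs_family_def)

lemma zs_family_union: "zs_family a U F \<Longrightarrow> zs_family a V F' \<Longrightarrow> zs_family a (U + V) (F + F')"
  by (auto simp: zs_family_def intro: mset_subset_eq_mono_add)

lemma zs_family_insert:
  assumes "zs_family a (U - T) F" "T \<subseteq># U" "T \<noteq> {#}" "nul a (sum_mset T)"
  shows "zs_family a U (add_mset T F)"
proof -
  have "zs_family a T {#T#}" using assms by (simp add: zs_family_def)
  then have "zs_family a (T + (U - T)) ({#T#} + F)" using assms(1) by (rule zs_family_union)
  then show ?thesis using assms(2) by simp
qed

lemma zs_family_member_subset: "zs_family a U F \<Longrightarrow> T \<in># F \<Longrightarrow> T \<subseteq># U"
  unfolding zs_family_def
  by (metis mset_subset_eq_add_left multi_member_split subset_mset.order_trans sum_mset.add_mset)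

lemma sum_mset_sum_mset: "sum_mset (image_mset sum_mset F) = sum_mset (sum_mset F)"
  for F :: "'a::comm_monoid_add multiset multiset"
  by (induction F) auto

lemma xnum_sum_mset: "xnum m (sum_mset F) = (\<Sum>T\<in>#F. xnum m T)"
  by (induction F) auto

text \<open>Take off short zero-sum subsequences as long as the weight exceeds \<open>u + 1\<close>; from a weight above \<open>u\<close>
  one more can be obtained, of any weight.\<close>

lemma family_rank_two:
  assumes p: "prime p" and ij: "i \<noteq> j" and AB: "B \<le> A"
  shows "\<exists>F. zs_family (cyc2 i (p ^ A) j (p ^ B)) U F \<and>
    xnum (cyc2 i (p ^ A) j (p ^ B)) U \<le> 2 - 1 / real (p ^ A) - 1 / real (p ^ B) + real (size F)"
    (is "\<exists>F. zs_family ?a U F \<and> _ \<le> ?u + _")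
proof (induction "size U" arbitrary: U rule: less_induct)
  case less
  consider "xnum ?a U \<le> ?u" | "?u < xnum ?a U" "xnum ?a U \<le> ?u + 1" | "xnum ?a U > ?u + 1" by linarith
  then show ?case
  proof cases
    case 1
    then show ?thesis by (intro exI[of _ "{#}"]) simp
  next
    case 2
    have "\<not> zs_free ?a U"
    proof
      assume "zs_free ?a U"
      then show False using cross_number_rank_two_full[OF p ij AB] 2 by fastforce
    qed
    then obtain T where "T \<subseteq># U" "nul ?a (sum_mset T)" "T \<noteq> {#}" by (auto simp: zs_free_def)
    then have "zs_family ?a U {#T#}" by (simp add: zs_family_def)
    then show ?thesis using 2 by (intro exI[of _ "{#T#}"]) simp
  next
    case 3
    then obtain T where T: "T \<subseteq># U" "T \<noteq> {#}" "nul ?a (sum_mset T)" "xnum ?a T \<le> 1"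
      using short_zs_rank_two[OF assms] unfolding short_zs_def by (auto simp: algebra_simps)
    have "size (U - T) < size U" using T(1,2)
      by (metis diff_less nonempty_has_size order_less_le_trans size_Diff_submset size_mset_mono)
    then obtain F where F: "zs_family ?a (U - T) F" "xnum ?a (U - T) \<le> ?u + real (size F)"
      using less.hyps by blast
    then show ?thesis using T zs_family_insert[OF F(1) T(1-3)]
      by (intro exI[of _ "add_mset T F"]) (auto simp: xnum_diff)
  qed
qed

text \<open>Greedy extraction. That the members of the family have weight at most \<open>1\<close> means that their number is
  at least the weight that they use up.\<close>

lemma extract_short:
  assumes "short_zs a u"
  shows "\<exists>F. zs_family a U F \<and> (\<forall>T\<in>#F. xnum a T \<le> 1) \<and> xnum a (U - sum_mset F) \<le> u"
proof (induction "size U" arbitrary: U rule: less_induct)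
  case less
  show ?case
  proof (cases "xnum a U \<le> u")
    case True
    then show ?thesis by (intro exI[of _ "{#}"]) simp
  next
    case False
    then obtain T where T: "T \<subseteq># U" "T \<noteq> {#}" "nul a (sum_mset T)" "xnum a T \<le> 1"
      using assms unfolding short_zs_def by (meson not_le_imp_less)
    have "size (U - T) < size U" using T(1,2)
      by (metis diff_less nonempty_has_size order_less_le_trans size_Diff_submset size_mset_mono)
    then obtain F where F: "zs_family a (U - T) F" "\<forall>T\<in>#F. xnum a T \<le> 1" "xnum a (U - T - sum_mset F) \<le> u"
      using less.hyps by blast
    then show ?thesis using T zs_family_insert[OF F(1) T(1-3)]
      by (intro exI[of _ "add_mset T F"]) (auto simp: diff_diff_add_mset)
  qed
qed

text \<open>The terms of \<open>U\<close> come in stages, and a subsequence with terms up to stage \<open>t\<close> is worth \<open>w t\<close>, where \<open>w\<close>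
  decreases. Proceed stage by stage and always extract short zero-sum subsequences from the terms
  available so far. The unused weight never exceeds \<open>u\<close>; each unit of it was lost at the rate
  of the stage from which it comes, so the loss is greatest if the weight \<open>L\<close> of stage \<open>0\<close> is never used
  and the rest of \<open>u\<close> is lost at stage \<open>1\<close>.\<close>

lemma chain_extraction:
  fixes stage :: "vec \<Rightarrow> nat" and w :: "nat \<Rightarrow> real" and f :: "vec \<Rightarrow> real"
  assumes sh: "short_zs a u"
    and w: "\<And>t. w (Suc t) \<le> w t"
    and gain: "\<And>t T. T \<subseteq># U \<Longrightarrow> T \<noteq> {#} \<Longrightarrow> nul a (sum_mset T) \<Longrightarrow>
      (\<And>x. x \<in># T \<Longrightarrow> stage x \<le> t) \<Longrightarrow> w t \<le> f (sum_mset T)"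
    and wpos: "\<And>t. w t \<ge> 0"
    and L: "L = xnum a {#x \<in># U. stage x = 0#}" "L \<le> u"
  shows "\<exists>F. zs_family a U F \<and> (\<Sum>x\<in>#U. w (stage x) / real (vord a x)) \<le>
    (\<Sum>T\<in>#F. f (sum_mset T)) + w 0 * L + w 1 * (u - L)"
proof -
  define V where "V = (\<lambda>t. {#x \<in># U. stage x \<le> t#})"
  define s where "s = (\<lambda>U. \<Sum>x\<in>#U. w (stage x) / real (vord a x))"
  have s_add: "s (A + B) = s A + s B" for A B by (simp add: s_def)
  have s_const: "s {#x \<in># U. stage x = t#} = w t * xnum a {#x \<in># U. stage x = t#}" for t
  proof -
    have "s {#x \<in># U. stage x = t#} = (\<Sum>x\<in>#{#x \<in># U. stage x = t#}. w t * (1 / real (vord a x)))"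
      unfolding s_def by (intro arg_cong[of _ _ sum_mset] image_mset_cong) auto
    then show ?thesis unfolding xnum_def by (simp only: sum_mset_distrib_left)
  qed
  \<comment> \<open>After stage \<open>t\<close> there is room for \<open>u\<close> minus the unused weight, to be lost at the rate of the next stage at most.\<close>
  have "\<exists>F. zs_family a (V t) F \<and> xnum a (V t - sum_mset F) \<le> u \<and>
     s (V t) + w (Suc t) * (u - xnum a (V t - sum_mset F)) \<le>
     (\<Sum>T\<in>#F. f (sum_mset T)) + w 0 * L + w 1 * (u - L)" for t
  proof (induction t)
    case 0
    have "V 0 = {#x \<in># U. stage x = 0#}" by (simp add: V_def)
    then show ?case using L s_const[of 0] by (intro exI[of _ "{#}"]) simp
  next
    case (Suc t)
    then obtain F where F: "zs_family a (V t) F" "xnum a (V t - sum_mset F) \<le> u"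
      "s (V t) + w (Suc t) * (u - xnum a (V t - sum_mset F)) \<le>
       (\<Sum>T\<in>#F. f (sum_mset T)) + w 0 * L + w 1 * (u - L)" by blast
    define C where "C = {#x \<in># U. stage x = Suc t#}"
    have VC: "V (Suc t) = V t + C"
      unfolding V_def C_def by (rule multiset_eqI) (auto simp: le_Suc_eq)
    define M where "M = V t - sum_mset F"
    have Vt: "V t = sum_mset F + M" using F(1) by (simp add: zs_family_def M_def)
    obtain F' where F': "zs_family a (M + C) F'" "\<forall>T\<in>#F'. xnum a T \<le> 1" "xnum a (M + C - sum_mset F') \<le> u"
      using extract_short[OF sh] by blast
    define M' where "M' = M + C - sum_mset F'"
    have MC: "M + C = sum_mset F' + M'" using F'(1) by (simp add: zs_family_def M'_def)
    have fam1: "zs_family a (V (Suc t)) (F + F')"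
    proof -
      have "zs_family a (sum_mset F) F" using F(1) by (simp add: zs_family_def)
      then have "zs_family a (sum_mset F + (M + C)) (F + F')" using F'(1) by (rule zs_family_union)
      then show ?thesis by (simp add: VC Vt add.assoc)
    qed
    have left: "V (Suc t) - sum_mset (F + F') = M'"
      unfolding VC Vt by (simp add: add.assoc MC)
    have "(\<Sum>T\<in>#F'. xnum a T) \<le> (\<Sum>T\<in>#F'. 1)" using F'(2) by (intro sum_mset_mono) auto
    then have "xnum a (sum_mset F') \<le> real (size F')" by (simp add: xnum_sum_mset)
    then have size: "xnum a M + xnum a C \<le> real (size F') + xnum a M'"
      using MC by (metis add_right_mono xnum_add)
    have "(\<Sum>T\<in>#F'. w (Suc t)) \<le> (\<Sum>T\<in>#F'. f (sum_mset T))"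
    proof (rule sum_mset_mono)
      fix T assume T: "T \<in># F'"
      have "T \<subseteq># M + C" using F'(1) T by (rule zs_family_member_subset)
      moreover have "M + C \<subseteq># V (Suc t)" by (simp add: VC Vt add.assoc)
      ultimately have TV: "T \<subseteq># V (Suc t)" by (rule subset_mset.order_trans)
      show "w (Suc t) \<le> f (sum_mset T)"
      proof (rule gain)
        show "T \<subseteq># U" using TV unfolding V_def by (meson multiset_filter_subset subset_mset.order_trans)
        show "T \<noteq> {#}" "nul a (sum_mset T)" using F'(1) T by (auto simp: zs_family_def)
        fix x assume "x \<in># T"
        then have "x \<in># V (Suc t)" using TV by (rule mset_subset_eqD[rotated])
        then show "stage x \<le> Suc t" by (simp add: V_def)
      qed
    qed
    then have g: "w (Suc t) * real (size F') \<le> (\<Sum>T\<in>#F'. f (sum_mset T))" by (simp add: mult.commute)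
    have "s (V (Suc t)) + w (Suc (Suc t)) * (u - xnum a M') \<le>
        s (V t) + w (Suc t) * xnum a C + w (Suc t) * (u - xnum a M')"
    proof -
      have "w (Suc (Suc t)) * (u - xnum a M') \<le> w (Suc t) * (u - xnum a M')"
        using w[of "Suc t"] F'(3) unfolding M'_def by (intro mult_right_mono) auto
      then show ?thesis unfolding VC s_add by (simp add: C_def s_const)
    qed
    also have "\<dots> = s (V t) + w (Suc t) * (u - xnum a M) + w (Suc t) * (xnum a M + xnum a C - xnum a M')"
      by (simp add: algebra_simps)
    also have "\<dots> \<le> s (V t) + w (Suc t) * (u - xnum a M) + w (Suc t) * real (size F')"
      using size wpos[of "Suc t"] by (intro add_left_mono mult_left_mono) auto
    also have "\<dots> \<le> (\<Sum>T\<in>#F. f (sum_mset T)) + w 0 * L + w 1 * (u - L) + (\<Sum>T\<in>#F'. f (sum_mset T))"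
      using g F(3) unfolding M_def by linarith
    finally show ?case
      using fam1 left F'(3) unfolding M'_def[symmetric] by (intro exI[of _ "F + F'"]) (auto simp: add_ac)
  qed
  note all = this
  have U: "V t = U" if "\<And>x. x \<in># U \<Longrightarrow> stage x \<le> t" for t
    unfolding V_def by (rule filter_mset_eq_conv[THEN iffD2]) (use that in auto)
  define t where "t = Max (insert 0 (stage ` set_mset U))"
  have "V t = U" by (rule U) (simp add: t_def)
  then obtain F where "zs_family a U F" "xnum a (U - sum_mset F) \<le> u"
     "s U + w (Suc t) * (u - xnum a (U - sum_mset F)) \<le>
     (\<Sum>T\<in>#F. f (sum_mset T)) + w 0 * L + w 1 * (u - L)" using all[of t] by auto
  moreover have "w (Suc t) * (u - xnum a (U - sum_mset F)) \<ge> 0"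
    using wpos[of "Suc t"] \<open>xnum a (U - sum_mset F) \<le> u\<close> by simp
  ultimately show ?thesis unfolding s_def by (intro exI[of _ F]) auto
qed

section \<open>Coprime moduli\<close>

lemma Lcm_range_dvd_prod:
  assumes "moduli m"
  shows "m i dvd (\<Prod>i | m i \<noteq> 1. m i)"
proof (cases "m i = 1")
  case False
  have "finite {i. m i \<noteq> 1}" using assms by (simp add: moduli_def)
  then show ?thesis using False by (intro dvd_prodI) auto
qed simp

definition mprod :: "(nat \<Rightarrow> nat) \<Rightarrow> (nat \<Rightarrow> nat) \<Rightarrow> nat \<Rightarrow> nat" where
  "mprod a b = (\<lambda>i. a i * b i)"

lemma mprod_commute: "mprod a b = mprod b a"
  by (simp add: mprod_def mult.commute)

lemma mprod_left_commute: "mprod a (mprod b c) = mprod b (mprod a c)"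
  by (simp add: mprod_def mult.left_commute)

text \<open>The group is the direct sum of the groups given by \<open>a\<close> and by \<open>b\<close>; the coprimality of all moduli makes the
  order of an element the product of the orders of its two components. The two moduli may be nontrivial
  in the same coordinate, where the Chinese remainder theorem applies.\<close>

locale coprime_moduli =
  fixes a b :: "nat \<Rightarrow> nat"
  assumes a: "moduli a" and b: "moduli b" and cop: "\<And>i j. coprime (a i) (b j)"
begin

abbreviation ab where "ab \<equiv> mprod a b"

lemma moduli_ab [simp]: "moduli ab"
proof -
  have "{i. ab i \<noteq> 1} \<subseteq> {i. a i \<noteq> 1} \<union> {i. b i \<noteq> 1}" by (auto simp: mprod_def)
  then show ?thesis using a b unfolding moduli_def
    by (auto simp: mprod_def intro: finite_subset)
qed

lemma nul_ab: "nul ab x \<longleftrightarrow> nul a x \<and> nul b x"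
proof -
  have "int (a i * b i) dvd x i \<longleftrightarrow> int (a i) dvd x i \<and> int (b i) dvd x i" for i
  proof
    assume "int (a i * b i) dvd x i"
    then show "int (a i) dvd x i \<and> int (b i) dvd x i" by (metis dvd_mult_left dvd_mult_right of_nat_mult)
  next
    assume "int (a i) dvd x i \<and> int (b i) dvd x i"
    then show "int (a i * b i) dvd x i" using cop[of i i] by (simp add: divides_mult)
  qed
  then show ?thesis by (auto simp: nul_def mprod_def)
qed

lemma coprime_vord: "coprime (vord a x) (vord b y)"
proof -
  have "vord a x dvd (\<Prod>i | a i \<noteq> 1. a i)" using a by (intro vord_dvdI Lcm_range_dvd_prod)
  moreover have "vord b y dvd (\<Prod>i | b i \<noteq> 1. b i)" using b by (intro vord_dvdI Lcm_range_dvd_prod)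
  moreover have "coprime (\<Prod>i | a i \<noteq> 1. a i) (\<Prod>i | b i \<noteq> 1. b i)"
    by (intro prod_coprime_left prod_coprime_right cop)
  ultimately show ?thesis by (meson coprime_divisors)
qed

lemma vord_ab: "vord ab x = vord a x * vord b x"
proof -
  have "vord ab x dvd k \<longleftrightarrow> vord a x * vord b x dvd k" for k
  proof -
    have "vord ab x dvd k \<longleftrightarrow> nul ab (scale k x)" by (simp add: nul_scale_iff)
    also have "\<dots> \<longleftrightarrow> vord a x dvd k \<and> vord b x dvd k" by (simp add: nul_ab nul_scale_iff a b)
    also have "\<dots> \<longleftrightarrow> vord a x * vord b x dvd k"
      using coprime_vord[of x x] by (metis divides_mult dvd_mult_left dvd_mult_right)
    finally show ?thesis .
  qed
  then show ?thesis by (meson dvd_antisym dvd_refl)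
qed

text \<open>Replacing subsequences by their sums creates no zero-sums, and on sums that vanish for \<open>a\<close> only \<open>b\<close>
  matters.\<close>

lemma zs_free_amalgamate:
  assumes "zs_free ab S" "zs_family a S F"
  shows "zs_free b (image_mset sum_mset F)"
  unfolding zs_free_def
proof (intro allI impI)
  fix Y assume Y: "Y \<subseteq># image_mset sum_mset F" "nul b (sum_mset Y)"
  then obtain C where "image_mset sum_mset F = Y + C" by (metis subset_mset.add_diff_inverse)
  then obtain E D where E: "F = E + D" "Y = image_mset sum_mset E" by (metis image_mset_eq_plusD)
  have "sum_mset E \<subseteq># S" using assms(2) unfolding E zs_family_def
    by (metis mset_subset_eq_add_left subset_mset.order_trans sum_mset.union)
  moreover have "nul a (sum_mset Y)"
    unfolding E by (rule nul_sum_mset) (use assms(2) E in \<open>auto simp: zs_family_def\<close>)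
  ultimately have "sum_mset E = {#}"
    using Y(2) zsfD[OF assms(1), of "sum_mset E"] by (simp add: E nul_ab sum_mset_sum_mset)
  then have "E = {#}" using assms(2) unfolding E zs_family_def
    by (metis multiset_nonemptyE sum_mset.remove union_eq_empty union_iff)
  then show "Y = {#}" by (simp add: E)
qed

lemma cross_bound_amalgamate:
  assumes "cross_bound b B" "zs_free ab S" "zs_family a S F"
  shows "(\<Sum>T\<in>#F. 1 / real (vord b (sum_mset T))) \<le> B"
proof -
  have "xnum b (image_mset sum_mset F) \<le> B"
    using assms(1) zs_free_amalgamate[OF assms(2,3)] unfolding cross_bound_def by blast
  then show ?thesis by (simp add: xnum_def multiset.map_comp comp_def)
qed

lemma zs_free_part:
  assumes "zs_free ab S"
  shows "zs_free a {#x \<in># S. nul b x#}"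
  unfolding zs_free_def
proof (intro allI impI)
  fix T assume T: "T \<subseteq># {#x \<in># S. nul b x#}" "nul a (sum_mset T)"
  have "nul b (sum_mset T)" using T(1) by (intro nul_sum_mset) (auto dest: mset_subset_eqD)
  moreover have "T \<subseteq># S" using T(1) multiset_filter_subset subset_mset.order_trans by blast
  ultimately show "T = {#}" using zsfD[OF assms] T(2) by (simp add: nul_ab)
qed

lemma swap: "coprime_moduli b a"
  using a b cop by unfold_locales (auto simp: coprime_commute)

lemma zs_free_part': "zs_free ab S \<Longrightarrow> zs_free b {#x \<in># S. nul a x#}"
  using coprime_moduli.zs_free_part[OF swap] by (simp add: mprod_commute)

text \<open>The value \<open>f z\<close> credits an amalgamated element \<open>z\<close>, in most cases with \<open>1 / vord b z\<close>, its weight over \<open>b\<close>.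
  The predicate says that \<open>U\<close> can be amalgamated so that at most the weight \<open>X\<close> is not credited.\<close>

definition loss :: "(vec \<Rightarrow> real) \<Rightarrow> vec multiset \<Rightarrow> real \<Rightarrow> bool" where
  "loss f U X \<longleftrightarrow> (\<exists>F. zs_family a U F \<and> xnum ab U \<le> (\<Sum>T\<in>#F. f (sum_mset T)) + X)"

lemma loss_mono: "loss f U X \<Longrightarrow> X \<le> Y \<Longrightarrow> loss f U Y"
  unfolding loss_def by force

lemma loss_union: "loss f U X \<Longrightarrow> loss f V Y \<Longrightarrow> loss f (U + V) (X + Y)"
  unfolding loss_def
proof (elim exE conjE)
  fix F F' assume "zs_family a U F" "xnum ab U \<le> (\<Sum>T\<in>#F. f (sum_mset T)) + X"
     "zs_family a V F'" "xnum ab V \<le> (\<Sum>T\<in>#F'. f (sum_mset T)) + Y"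
  then show "\<exists>F. zs_family a (U + V) F \<and> xnum ab (U + V) \<le> (\<Sum>T\<in>#F. f (sum_mset T)) + (X + Y)"
    by (intro exI[of _ "F + F'"]) (auto intro: zs_family_union)
qed

lemma loss_empty: "loss f {#} 0"
  unfolding loss_def by (intro exI[of _ "{#}"]) simp

lemma loss_classes:
  assumes "finite K" "\<And>k. k \<in> K \<Longrightarrow> loss f {#x \<in># S. g x = k#} (X k)"
  shows "loss f {#x \<in># S. g x \<in> K#} (\<Sum>k\<in>K. X k)"
  using assms
proof (induction K rule: finite_induct)
  case empty
  then show ?case by (simp add: loss_empty)
next
  case (insert k K)
  have "{#x \<in># S. g x \<in> insert k K#} = {#x \<in># S. g x = k#} + {#x \<in># S. g x \<in> K#}"
    using insert(2) by (intro multiset_eqI) auto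
  then show ?case using insert by (auto intro: loss_union)
qed

lemma loss_bound:
  assumes "cross_bound b B" "zs_free ab S" "loss (\<lambda>z. 1 / real (vord b z)) S X"
  shows "xnum ab S \<le> B + X"
proof -
  obtain F where "zs_family a S F" "xnum ab S \<le> (\<Sum>T\<in>#F. 1 / real (vord b (sum_mset T))) + X"
    using assms(3) by (auto simp: loss_def)
  then show ?thesis using cross_bound_amalgamate[OF assms(1,2)] by fastforce
qed

lemma xnum_ab_class:
  assumes "\<And>x. x \<in># U \<Longrightarrow> vord b x = d"
  shows "xnum ab U = xnum a U / real d"
  using assms by (induction U) (auto simp: vord_ab add_divide_distrib)

lemma gain_vord:
  assumes "vord b z dvd D" "D > 0"
  shows "1 / real D \<le> 1 / real (vord b z)"
  using assms b by (intro divide_left_mono) (auto dest: dvd_imp_le)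

text \<open>The chain \<open>d, d q, d q\<^sup>2, \<dots>\<close> of orders in \<open>b\<close>, with the terms of order \<open>d\<close> as stage \<open>0\<close> of
  \<open>chain_extraction\<close>.\<close>

lemma loss_chain:
  fixes d q :: nat and tt :: "vec \<Rightarrow> nat"
  assumes sh: "short_zs a u" and d: "d > 0" and q: "q > 1"
    and U: "\<And>x. x \<in># U \<Longrightarrow> vord b x = d * q ^ tt x"
    and gain: "\<And>t T. T \<subseteq># U \<Longrightarrow> T \<noteq> {#} \<Longrightarrow> nul a (sum_mset T) \<Longrightarrow>
      (\<And>x. x \<in># T \<Longrightarrow> vord b x dvd d * q ^ t) \<Longrightarrow> vord b (sum_mset T) dvd d * q ^ t \<Longrightarrow>
      1 / real (d * q ^ t) \<le> f (sum_mset T)"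
    and L: "L = xnum a {#x \<in># U. vord b x = d#}" "L \<le> u"
  shows "loss f U (L / real d + (u - L) / real (d * q))"
proof -
  let ?w = "\<lambda>t. 1 / real (d * q ^ t)"
  have "\<exists>F. zs_family a U F \<and> (\<Sum>x\<in>#U. ?w (tt x) / real (vord a x)) \<le>
    (\<Sum>T\<in>#F. f (sum_mset T)) + ?w 0 * L + ?w 1 * (u - L)"
  proof (rule chain_extraction[OF sh])
    show "?w (Suc t) \<le> ?w t" for t
      using d q by (intro divide_left_mono) (auto simp: mult_le_mono)
    show "L = xnum a {#x \<in># U. tt x = 0#}"
      unfolding L(1) using U q d by (intro arg_cong[of _ _ "xnum a"] filter_mset_cong) auto
    fix t T assume T: "T \<subseteq># U" "T \<noteq> {#}" "nul a (sum_mset T)" "\<And>x. x \<in># T \<Longrightarrow> tt x \<le> t"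
    have *: "vord b x dvd d * q ^ t" if "x \<in># T" for x
      using U[OF mset_subset_eqD[OF T(1) that]] T(4)[OF that] by (simp add: le_imp_power_dvd)
    show "?w t \<le> f (sum_mset T)"
      by (rule gain[OF T(1-3) *]) (use vord_sum_mset_dvd[OF b] * in auto)
  qed (use L in auto)
  moreover have "(\<Sum>x\<in>#U. ?w (tt x) / real (vord a x)) = xnum ab U"
    unfolding xnum_def using U by (intro arg_cong[of _ _ sum_mset] image_mset_cong) (simp add: vord_ab)
  ultimately show ?thesis unfolding loss_def by (simp add: add.assoc)
qed

text \<open>Same chain, with an empty stage inserted at the bottom: the short zero-sum subsequences among the
  terms of order \<open>d\<close> are extracted as well, and the loss depends on \<open>d\<close> only.\<close>

lemma loss_chain0:
  fixes d q :: nat and tt :: "vec \<Rightarrow> nat"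
  assumes sh: "short_zs a u" and u: "u \<ge> 0" and d: "d > 0" and q: "q > 1"
    and U: "\<And>x. x \<in># U \<Longrightarrow> vord b x = d * q ^ tt x"
    and gain: "\<And>t T. T \<subseteq># U \<Longrightarrow> T \<noteq> {#} \<Longrightarrow> nul a (sum_mset T) \<Longrightarrow>
      (\<And>x. x \<in># T \<Longrightarrow> vord b x dvd d * q ^ t) \<Longrightarrow> vord b (sum_mset T) dvd d * q ^ t \<Longrightarrow>
      1 / real (d * q ^ t) \<le> f (sum_mset T)"
  shows "loss f U (u / real d)"
proof -
  \<comment> \<open>The term \<open>x\<close> has stage \<open>tt x + 1\<close>; the truncated subtraction gives the empty stage \<open>0\<close> the weight of stage \<open>1\<close>.\<close>
  define w where "w = (\<lambda>s. 1 / real (d * q ^ (s - 1)))"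
  have "\<exists>F. zs_family a U F \<and> (\<Sum>x\<in>#U. w (Suc (tt x)) / real (vord a x)) \<le>
    (\<Sum>T\<in>#F. f (sum_mset T)) + w 0 * 0 + w 1 * (u - 0)"
  proof (rule chain_extraction[OF sh])
    show "w (Suc t) \<le> w t" for t
      unfolding w_def using d q by (intro divide_left_mono) (auto intro!: mult_le_mono power_increasing)
    fix t T assume T: "T \<subseteq># U" "T \<noteq> {#}" "nul a (sum_mset T)" "\<And>x. x \<in># T \<Longrightarrow> Suc (tt x) \<le> t"
    have *: "vord b x dvd d * q ^ (t - 1)" if "x \<in># T" for x
      using U[OF mset_subset_eqD[OF T(1) that]] T(4)[OF that] by (simp add: le_imp_power_dvd)
    show "w t \<le> f (sum_mset T)"
      unfolding w_def by (rule gain[OF T(1-3) *]) (use vord_sum_mset_dvd[OF b] * in auto)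
  qed (use u in \<open>auto simp: w_def\<close>)
  moreover have "(\<Sum>x\<in>#U. w (Suc (tt x)) / real (vord a x)) = xnum ab U"
    unfolding xnum_def w_def using U by (intro arg_cong[of _ _ sum_mset] image_mset_cong) (simp add: vord_ab)
  ultimately show ?thesis unfolding loss_def by (simp add: w_def)
qed

end

lemma coprime_moduli_cyc:
  assumes "prime p" "moduli b" "\<And>k. coprime p (b k)"
  shows "coprime_moduli (cyc i (p ^ \<alpha>)) b"
proof
  show "moduli (cyc i (p ^ \<alpha>))" using assms(1) prime_gt_0_nat by simp
  show "moduli b" by fact
  show "coprime (cyc i (p ^ \<alpha>) j) (b k)" for j k using assms(3) by (simp add: cyc_def)
qed

lemma mset_subset_of_size:
  assumes "k \<le> size M"
  obtains Y where "Y \<subseteq># M" "size Y = k"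
proof -
  obtain xs where xs: "mset xs = M" using ex_mset by blast
  have "M = mset (take k xs) + mset (drop k xs)" using xs by (metis append_take_drop_id mset_append)
  moreover have "size (mset (take k xs)) = k" using assms xs by auto
  ultimately show ?thesis using that by (metis mset_subset_eq_add_left)
qed

lemma convex_rearrange:
  fixes u k L q :: real
  shows "u * (1 - 1 / q) + (u + k) / q = u + k / q" "L + (u - L) / q = u - (u - L) * (1 - 1 / q)"
  by (simp_all add: right_diff_distrib add_divide_distrib diff_divide_distrib)

section \<open>The base case\<close>

text \<open>Here all orders in \<open>b\<close> are \<open>1\<close> or \<open>l\<close>. With \<open>P\<close> the terms whose order is \<open>1\<close>, the cross number of \<open>S\<close> is the
  convex combination of the weights of \<open>P\<close> and of \<open>S\<close> over \<open>a\<close>, with coefficients \<open>1 - 1 / l\<close> and \<open>1 / l\<close>. The first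
  one is at most \<open>u\<close>, as \<open>P\<close> is zero-sum free over \<open>a\<close>; the second one exceeds \<open>u\<close> at most by the
  number of disjoint zero-sum subsequences, and every one of these contributes at least \<open>1 / l\<close> over \<open>b\<close>.\<close>

theorem cross_bound_base:
  assumes q: "prime q" and l: "prime l" and ql: "q \<noteq> l" and ij: "i \<noteq> j" and AB: "B \<le> A"
    and I: "finite I"
  shows "cross_bound (mprod (cyc2 i (q ^ A) j (q ^ B)) (\<lambda>k. if k \<in> I then l else 1))
    (2 - 1 / real (q ^ A) - 1 / real (q ^ B) + real (card I) * (1 - 1 / real l))"
proof -
  let ?a = "cyc2 i (q ^ A) j (q ^ B)" and ?b = "\<lambda>k. if k \<in> I then l else 1"
  let ?u = "2 - 1 / real (q ^ A) - 1 / real (q ^ B)"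
  have q1: "q > 1" and l1: "l > 1" using q l prime_gt_1_nat by blast+
  interpret coprime_moduli ?a ?b
  proof
    show "moduli ?a" using q1 by simp
    show "moduli ?b" using I l1 unfolding moduli_def by (auto intro: finite_subset[OF _ I])
    show "coprime (?a k) (?b k')" for k k' using q l ql by (auto simp: cyc2_def primes_coprime)
  qed
  have vb: "vord ?b x dvd l" for x by (rule vord_dvdI[OF b]) auto
  have KBb: "cross_bound ?b (real (card I) * (1 - 1 / real l))"
    unfolding cross_bound_def
  proof (intro allI impI)
    fix S assume "zs_free ?b S"
    then have "xnum ?b S \<le> (\<Sum>k\<in>I. 1 - 1 / real (l ^ min 1 1))"
      by (intro cross_number_p_group[OF l I, where a = "\<lambda>_. 1" and J = 1]) (auto simp: vb)
    then show "xnum ?b S \<le> real (card I) * (1 - 1 / real l)" by simp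
  qed
  show ?thesis unfolding cross_bound_def
  proof (intro allI impI)
    fix S assume S: "zs_free ab S"
    define P where "P = {#x \<in># S. nul ?b x#}"
    define N where "N = {#x \<in># S. \<not> nul ?b x#}"
    have PN: "S = P + N" by (simp add: P_def N_def)
    have zP: "zs_free ?a P" unfolding P_def using S by (rule zs_free_part)
    have P: "xnum ?a P \<le> ?u" by (rule cross_number_rank_two_full[OF q ij AB zP])
    obtain F where F: "zs_family ?a S F" "xnum ?a S \<le> ?u + real (size F)"
      using family_rank_two[OF q ij AB] by blast
    have "(\<Sum>T\<in>#F. 1 / real l) \<le> (\<Sum>T\<in>#F. 1 / real (vord ?b (sum_mset T)))"
      using l1 vb by (intro sum_mset_mono gain_vord) auto
    also have "\<dots> \<le> real (card I) * (1 - 1 / real l)" by (rule cross_bound_amalgamate[OF KBb S F(1)])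
    finally have m: "real (size F) / real l \<le> real (card I) * (1 - 1 / real l)" by simp
    have vP: "vord ?b x = 1" if "x \<in># P" for x using that vord_eq_1_iff[OF b, of x] by (simp add: P_def)
    have vN: "vord ?b x = l" if "x \<in># N" for x
    proof -
      have "vord ?b x \<noteq> 1" using that b vord_eq_1_iff by (auto simp: N_def)
      then show ?thesis using vb[of x] l by (metis prime_nat_iff)
    qed
    have "xnum ab S = xnum ?a P / real 1 + xnum ?a N / real l"
      unfolding PN xnum_add using xnum_ab_class[of P 1] xnum_ab_class[of N l] vP vN by simp
    also have "\<dots> = xnum ?a P * (1 - 1 / real l) + xnum ?a S / real l"
      unfolding PN xnum_add by (simp add: algebra_simps add_divide_distrib)
    also have "\<dots> \<le> ?u * (1 - 1 / real l) + (?u + real (size F)) / real l"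
      using P F(2) l1 by (intro add_mono mult_right_mono divide_right_mono) auto
    also have "\<dots> = ?u + real (size F) / real l" by (rule convex_rearrange)
    finally show "xnum ab S \<le> ?u + real (card I) * (1 - 1 / real l)" using m by simp
  qed
qed

section \<open>Peeling off a cyclic Sylow subgroup\<close>

text \<open>Up to the factor \<open>u\<close>, the total loss of the chains with \<open>d \<noteq> 1\<close>.\<close>

definition rho :: "nat \<Rightarrow> real" where
  "rho n = (\<Sum>d | d dvd n \<and> d \<noteq> 1. 1 / real d)"

lemma dvd_prime_power_mult:
  assumes "prime q" "D dvd q ^ A * (n::nat)"
  shows "\<exists>t d. d dvd n \<and> D = d * q ^ t"
proof -
  obtain x y where "D = x * y" "x dvd q ^ A" "y dvd n" using division_decomp[OF assms(2)] by blast
  then show ?thesis using divides_primepow_nat[OF assms(1)] by (metis mult.commute)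
qed

text \<open>Every divisor \<open>d\<close> of \<open>n\<close> has its chain \<open>d, d q, d q\<^sup>2, \<dots>\<close> of orders. For \<open>d = 1\<close> the bottom of the chain
  is a zero-sum free sequence over \<open>a\<close> of weight \<open>L\<close>, and this sharper information is used.\<close>

theorem peel_core:
  assumes "coprime_moduli (cyc i (p ^ \<alpha>)) b" and p: "prime p"
    and bn: "\<And>k. b k dvd q ^ A * n" and q: "prime q" and n: "n > 0"
    and B: "cross_bound b B" and S: "zs_free (mprod (cyc i (p ^ \<alpha>)) b) S"
    and L: "L = xnum (cyc i (p ^ \<alpha>)) {#x \<in># S. nul b x#}"
  shows "xnum (mprod (cyc i (p ^ \<alpha>)) b) S \<le> B + L + (1 - 1 / real (p ^ \<alpha>) - L) / real q
    + (1 - 1 / real (p ^ \<alpha>)) * rho n"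
proof -
  let ?a = "cyc i (p ^ \<alpha>)" and ?u = "1 - 1 / real (p ^ \<alpha>)"
  interpret coprime_moduli ?a b by fact
  have q1: "q > 1" using q prime_gt_1_nat by blast
  have u0: "?u \<ge> 0" using prime_gt_1_nat[OF p] by simp
  have "\<exists>t d. d dvd n \<and> vord b x = d * q ^ t" for x
    by (rule dvd_prime_power_mult[OF q]) (rule vord_dvdI[OF b bn])
  then obtain tt dd where td: "\<And>x. dd x dvd n" "\<And>x. vord b x = dd x * q ^ tt x" by metis
  have sh: "short_zs ?a ?u" by (rule short_zs_cyclic[OF p])
  let ?f = "\<lambda>z. 1 / real (vord b z)"
  define X where "X = (\<lambda>d. if d = 1 then L + (?u - L) / real q else ?u / real d)"
  have pos: "d > 0" if "d dvd n" for d using that n by (simp add: dvd_pos_nat)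
  have classes: "loss ?f {#x \<in># S. dd x = d#} (X d)" if d: "d dvd n" for d
  proof (cases "d = 1")
    case True
    have "loss ?f {#x \<in># S. dd x = d#} (L / real 1 + (?u - L) / real (1 * q))"
    proof (rule loss_chain[OF sh _ q1])
      show "vord b x = 1 * q ^ tt x" if "x \<in># {#x \<in># S. dd x = d#}" for x
        using that td(2)[of x] True by simp
      have "{#x \<in># {#x \<in># S. dd x = d#}. vord b x = 1#} = {#x \<in># S. nul b x#}"
        using True td(2) b by (intro multiset_eqI) (auto simp: vord_eq_1_iff[symmetric])
      then show "L = xnum ?a {#x \<in># {#x \<in># S. dd x = d#}. vord b x = 1#}" using L by simp
      show "L \<le> ?u" unfolding L by (rule cross_number_cyclic[OF p zs_free_part[OF S]])
      show "1 / real (1 * q ^ t) \<le> ?f (sum_mset T)" if "vord b (sum_mset T) dvd 1 * q ^ t" for t T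
        by (rule gain_vord[OF that]) (use q1 in simp)
    qed simp
    then show ?thesis using True by (simp add: X_def)
  next
    case False
    have "loss ?f {#x \<in># S. dd x = d#} (?u / real d)"
    proof (rule loss_chain0[OF sh u0 pos[OF d] q1])
      show "vord b x = d * q ^ tt x" if "x \<in># {#x \<in># S. dd x = d#}" for x
        using that td(2)[of x] by simp
      show "1 / real (d * q ^ t) \<le> ?f (sum_mset T)" if "vord b (sum_mset T) dvd d * q ^ t" for t T
        by (rule gain_vord[OF that]) (use q1 pos[OF d] in simp)
    qed
    then show ?thesis using False by (simp add: X_def)
  qed
  have fin: "finite {d. d dvd n}" using n by simp
  have "loss ?f {#x \<in># S. dd x \<in> {d. d dvd n}#} (\<Sum>d | d dvd n. X d)"
    using fin classes by (intro loss_classes) auto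
  moreover have "{#x \<in># S. dd x \<in> {d. d dvd n}#} = S"
    by (rule filter_mset_eq_conv[THEN iffD2]) (use td in auto)
  moreover have "(\<Sum>d | d dvd n. X d) = L + (?u - L) / real q + ?u * rho n"
  proof -
    have "{d. d dvd n} - {1} = {d. d dvd n \<and> d \<noteq> 1}" by auto
    then have "(\<Sum>d | d dvd n. X d) = X 1 + (\<Sum>d | d dvd n \<and> d \<noteq> 1. X d)"
      using fin by (subst sum.remove[of _ 1]) auto
    also have "(\<Sum>d | d dvd n \<and> d \<noteq> 1. X d) = (\<Sum>d | d dvd n \<and> d \<noteq> 1. ?u * (1 / real d))"
      by (intro sum.cong) (auto simp: X_def)
    also have "\<dots> = ?u * rho n" by (simp only: rho_def sum_distrib_left)
    finally show ?thesis by (simp add: X_def)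
  qed
  ultimately show ?thesis using loss_bound[OF B S] by (simp add: add.assoc)
qed

text \<open>Dense sequences are those whose weight cannot be preserved by replacing several terms by their sum.
  A sequence of minimal length among the counterexamples to a bound is dense.\<close>

definition dense :: "(nat \<Rightarrow> nat) \<Rightarrow> vec multiset \<Rightarrow> bool" where
  "dense m S \<longleftrightarrow> (\<forall>T. T \<subseteq># S \<longrightarrow> size T \<ge> 2 \<longrightarrow> xnum m T > 1 / real (vord m (sum_mset T)))"

lemma zs_free_replace:
  assumes "zs_free m S" "T \<subseteq># S" "T \<noteq> {#}"
  shows "zs_free m (add_mset (sum_mset T) (S - T))"
  unfolding zs_free_def
proof (intro allI impI)
  fix Y assume Y: "Y \<subseteq># add_mset (sum_mset T) (S - T)" "nul m (sum_mset Y)"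
  show "Y = {#}"
  proof (cases "Y \<subseteq># S - T")
    case True
    then have "Y \<subseteq># S" by (meson diff_subset_eq_self subset_mset.order_trans)
    then show ?thesis using zsfD[OF assms(1)] Y(2) by blast
  next
    case False
    define Z where "Z = Y - {#sum_mset T#}"
    have ZS: "Z \<subseteq># S - T" using Y(1) unfolding Z_def by (simp add: subset_eq_diff_conv)
    have "sum_mset T \<in># Y" using False ZS unfolding Z_def by (metis diff_single_trivial)
    then have "Y = add_mset (sum_mset T) Z" by (simp add: Z_def)
    then have "nul m (sum_mset (T + Z))" using Y(2) by simp
    moreover have "T + Z \<subseteq># S" using ZS assms(2)
      by (metis mset_subset_eq_mono_add_left_cancel subset_mset.add_diff_inverse)
    ultimately have "T + Z = {#}" using zsfD[OF assms(1)] by blast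
    then show ?thesis using assms(3) by simp
  qed
qed

lemma nul_cyc: "nul (cyc i q) x \<longleftrightarrow> int q dvd x i"
  by (auto simp: nul_def cyc_def)

text \<open>Passing to the quotient by the subgroup of order \<open>p\<close> divides nontrivial orders by \<open>p\<close>.\<close>

lemma vord_cyc_Suc:
  assumes p: "prime p" and v: "vord (cyc i (p ^ Suc \<alpha>)) x = p ^ j"
  shows "vord (cyc i (p ^ \<alpha>)) x = p ^ (j - 1)"
proof -
  have p0: "p > 0" using p prime_gt_0_nat by blast
  have "vord (cyc i (p ^ \<alpha>)) x dvd k \<longleftrightarrow> p ^ (j - 1) dvd k" for k
  proof -
    have "vord (cyc i (p ^ \<alpha>)) x dvd k \<longleftrightarrow> int (p ^ \<alpha>) dvd int k * x i"
      using p0 by (simp add: nul_cyc scale_def flip: nul_scale_iff)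
    also have "\<dots> \<longleftrightarrow> int p * int (p ^ \<alpha>) dvd int p * (int k * x i)" using p0 by simp
    also have "\<dots> \<longleftrightarrow> int (p ^ Suc \<alpha>) dvd int (p * k) * x i" by (simp add: mult.assoc)
    also have "\<dots> \<longleftrightarrow> vord (cyc i (p ^ Suc \<alpha>)) x dvd p * k"
      using p0 by (simp only: nul_cyc scale_def moduli_cyc zero_less_power flip: nul_scale_iff)
    also have "\<dots> \<longleftrightarrow> p ^ (j - 1) dvd k" unfolding v using p0 by (cases j) auto
    finally show ?thesis .
  qed
  then show ?thesis by (meson dvd_antisym dvd_refl)
qed

declare power_Suc [simp del]

text \<open>The \<open>p - 1\<close> terms in \<open>Y\<close> lie in the subgroup of order \<open>p\<close>. If a sum \<open>z\<close> of other terms vanishes in the quotient by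
  this subgroup, then \<open>z\<close> and \<open>Y\<close> together have cross number \<open>1\<close> over \<open>a\<close>, too much for a zero-sum free
  sequence, so \<open>z\<close> can be completed to a zero-sum by terms of \<open>Y\<close>.\<close>

lemma quotient_full:
  assumes cm: "coprime_moduli (cyc i (p ^ Suc \<alpha>)) b" and p: "prime p"
    and S: "zs_free (mprod (cyc i (p ^ Suc \<alpha>)) b) S"
    and Y: "Y \<subseteq># S" "size Y = p - 1" "\<And>y. y \<in># Y \<Longrightarrow> nul b y \<and> vord (cyc i (p ^ Suc \<alpha>)) y = p"
  shows "zs_free (mprod (cyc i (p ^ \<alpha>)) b) (S - Y)"
  unfolding zs_free_def
proof (intro allI impI)
  let ?a = "cyc i (p ^ Suc \<alpha>)"
  interpret coprime_moduli ?a b by fact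
  have p1: "p > 1" using p prime_gt_1_nat by blast
  fix T assume T: "T \<subseteq># S - Y" "nul (mprod (cyc i (p ^ \<alpha>)) b) (sum_mset T)"
  define z where "z = sum_mset T"
  have "int (p ^ \<alpha> * b i) dvd z i" "\<And>k. int (b k) dvd z k"
  proof -
    have *: "int (cyc i (p ^ \<alpha>) k * b k) dvd z k" for k
      using T(2) by (simp add: nul_def mprod_def z_def)
    show "int (p ^ \<alpha> * b i) dvd z i" using *[of i] by (simp add: cyc_def)
    show "int (b k) dvd z k" for k using *[of k] by (metis dvd_mult_right of_nat_mult)
  qed
  then have z: "nul b z" "int (p ^ \<alpha>) dvd z i"
    by (simp add: nul_def, metis dvd_mult_left of_nat_mult)
  have TS: "T \<subseteq># S" using T(1) by (meson diff_subset_eq_self subset_mset.order_trans)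
  show "T = {#}"
  proof (cases "nul ?a z")
    case True
    then show ?thesis using zsfD[OF S TS] z by (simp add: nul_ab z_def del: power_Suc)
  next
    case False
    have "nul ?a (scale p z)" using z(2) by (simp add: nul_cyc scale_def mult_dvd_mono power_Suc)
    then have "vord ?a z dvd p" using nul_scale_iff[OF a] by blast
    then have vz: "vord ?a z = p" using False vord_eq_1_iff[OF a] p by (metis prime_nat_iff)
    have "xnum ?a Y = real (size Y) / real p"
      unfolding xnum_def using Y(3) by (simp cong: image_mset_cong)
    then have "xnum ?a (add_mset z Y) = 1" using vz Y(2) p1 by (simp add: of_nat_diff field_simps)
    moreover have "1 / real (p ^ Suc \<alpha>) > 0" using p1 by simp
    ultimately have "\<not> zs_free ?a (add_mset z Y)"
      using cross_number_cyclic[OF p, of i "Suc \<alpha>" "add_mset z Y"] by linarith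
    then obtain E where E: "E \<subseteq># add_mset z Y" "nul ?a (sum_mset E)" "E \<noteq> {#}"
      unfolding zs_free_def by blast
    have nY: "nul b (sum_mset Z)" if "Z \<subseteq># Y" for Z
      by (rule nul_sum_mset) (use Y(3) mset_subset_eqD[OF that] in auto)
    have "\<not> E \<subseteq># Y"
    proof
      assume EY: "E \<subseteq># Y"
      then have "E = {#}" using zsfD[OF S subset_mset.order_trans[OF EY Y(1)]] E(2) nY[OF EY]
        by (simp add: nul_ab)
      then show False using E(3) by simp
    qed
    define Z where "Z = E - {#z#}"
    have ZY: "Z \<subseteq># Y" using E(1) unfolding Z_def by (simp add: subset_eq_diff_conv)
    have "z \<in># E" using \<open>\<not> E \<subseteq># Y\<close> ZY unfolding Z_def by (metis diff_single_trivial)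
    then have EZ: "E = add_mset z Z" by (simp add: Z_def)
    have "T + Z \<subseteq># (S - Y) + Y" using T(1) ZY by (rule mset_subset_eq_mono_add)
    then have "T + Z \<subseteq># S" using Y(1) by simp
    moreover have "nul ab (sum_mset (T + Z))"
      using E(2) nul_add[OF z(1) nY[OF ZY]] by (simp add: nul_ab EZ z_def)
    ultimately have "T + Z = {#}" using zsfD[OF S] by blast
    then show ?thesis by simp
  qed
qed

text \<open>A nontrivial order over \<open>a\<close> is \<open>p\<close> times as large as in the quotient, so the weights are divided by
  \<open>p\<close>; the terms that become trivial in the quotient are compensated by the last summand, where they are
  weighted over \<open>b\<close> alone.\<close>

lemma xnum_weight_split:
  assumes p: "prime p" and cm: "coprime_moduli (cyc i (p ^ Suc \<alpha>)) b" "coprime_moduli (cyc i (p ^ \<alpha>)) b"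
  shows "xnum (mprod (cyc i (p ^ Suc \<alpha>)) b) R \<le>
    xnum (mprod (cyc i (p ^ \<alpha>)) b) R / real p +
    (1 - 1 / real p) * xnum b {#x \<in># R. nul (cyc i (p ^ \<alpha>)) x#}"
proof (induction R)
  case (add x R)
  let ?a = "cyc i (p ^ Suc \<alpha>)" and ?a' = "cyc i (p ^ \<alpha>)"
  have p1: "p > 1" using p prime_gt_1_nat by blast
  have m: "moduli ?a" "moduli ?a'" "moduli b" using p1 cm(1) by (auto simp: coprime_moduli_def)
  have "vord ?a x dvd p ^ Suc \<alpha>"
    using m(1) by (rule vord_dvdI) (auto simp: cyc_def)
  then obtain j where j: "vord ?a x = p ^ j" using divides_primepow_nat[OF p] by blast
  have j': "vord ?a' x = p ^ (j - 1)" by (rule vord_cyc_Suc[OF p j])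
  have nul: "nul ?a' x \<longleftrightarrow> j \<le> 1"
    using p1 by (auto simp: j' simp flip: vord_eq_1_iff[OF m(2)])
  define D where "D = real (vord b x)"
  have D: "D > 0" using vord_pos[OF m(3)] by (simp add: D_def)
  have "1 / (real (p ^ j) * D) \<le> 1 / (real (p ^ (j - 1)) * D) / real p + (if j \<le> 1 then (1 - 1 / real p) / D else 0)"
  proof (cases "j \<le> 1")
    case True
    then have "j = 0 \<or> j = 1" by auto
    then show ?thesis using p1 D by (auto simp: field_simps)
  next
    case False
    then have "p ^ j = p ^ (j - 1) * p" by (cases j) (auto simp: power_Suc)
    then have eq: "1 / (real (p ^ j) * D) = 1 / (real (p ^ (j - 1)) * D) / real p"
      by (metis divide_divide_eq_left' mult.assoc mult.commute of_nat_mult)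
    show ?thesis unfolding eq using False by simp
  qed
  then have main: "1 / (real (p ^ j) * D) \<le> 1 / (real (p ^ (j - 1)) * D) / real p +
      (1 - 1 / real p) * (if j \<le> 1 then 1 / D else 0)"
    by (simp only: if_distrib[of "\<lambda>z. (1 - 1 / real p) * z"] times_divide_eq_right mult_1_right mult_zero_right)
  have e1: "xnum (mprod ?a b) (add_mset x R) = 1 / (real (p ^ j) * D) + xnum (mprod ?a b) R"
    by (simp add: coprime_moduli.vord_ab[OF cm(1)] j D_def)
  have e2: "xnum (mprod ?a' b) (add_mset x R) / real p =
      1 / (real (p ^ (j - 1)) * D) / real p + xnum (mprod ?a' b) R / real p"
    by (simp add: coprime_moduli.vord_ab[OF cm(2)] j' D_def add_divide_distrib)
  have e3: "(1 - 1 / real p) * xnum b {#y \<in># add_mset x R. nul ?a' y#} =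
      (1 - 1 / real p) * (if j \<le> 1 then 1 / D else 0) + (1 - 1 / real p) * xnum b {#y \<in># R. nul ?a' y#}"
    using nul by (simp add: D_def distrib_left)
  show ?case unfolding e1 e2 e3 using add.IH main by linarith
qed simp

text \<open>Induction on \<open>\<alpha>\<close>, and on the length of \<open>S\<close> for fixed \<open>\<alpha>\<close>. If \<open>S\<close> is not dense, it can be shortened; if it has \<open>p - 1\<close>
  terms of order \<open>p\<close> in \<open>a\<close> and trivial in \<open>b\<close>, pass to the quotient by the subgroup of order \<open>p\<close>. In the remaining case these terms have weight at most \<open>(p - 2) / p\<close>, and those of larger order in \<open>a\<close> (and trivial in \<open>b\<close>) are too sparse
  for a short zero-sum in the quotient, because \<open>S\<close> is dense.\<close>

theorem peel_frame:
  assumes p: "prime p" and b: "moduli b" and cop: "\<And>k. coprime p (b k)" and B: "cross_bound b B"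
    and core: "\<And>\<alpha> S. zs_free (mprod (cyc i (p ^ Suc \<alpha>)) b) S \<Longrightarrow> dense (mprod (cyc i (p ^ Suc \<alpha>)) b) S \<Longrightarrow>
      xnum (cyc i (p ^ Suc \<alpha>)) {#x \<in># S. nul b x#} \<le> 1 - 1 / real (p ^ Suc \<alpha>) - 1 / real p \<Longrightarrow>
      xnum (mprod (cyc i (p ^ Suc \<alpha>)) b) S \<le> B + 1 - 1 / real (p ^ Suc \<alpha>)"
  shows "cross_bound (mprod (cyc i (p ^ \<alpha>)) b) (B + 1 - 1 / real (p ^ \<alpha>))"
proof (induction \<alpha>)
  case 0
  have "mprod (cyc i (p ^ 0)) b = b" by (auto simp: mprod_def cyc_def)
  then show ?case using B by simp
next
  case (Suc \<alpha>)
  let ?a = "cyc i (p ^ Suc \<alpha>)" and ?a' = "cyc i (p ^ \<alpha>)"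
  have p1: "p > 1" using p prime_gt_1_nat by blast
  have "coprime_moduli (cyc i (p ^ k)) b" for k
    by (rule coprime_moduli_cyc[OF p b cop])
  then have cm: "coprime_moduli ?a b" "coprime_moduli ?a' b" by blast+
  interpret coprime_moduli ?a b by fact
  interpret ab': coprime_moduli ?a' b by fact
  have "xnum ab S \<le> B + 1 - 1 / real (p ^ Suc \<alpha>)" if "zs_free ab S" for S
    using that
  proof (induction "size S" arbitrary: S rule: less_induct)
    case less
    show ?case
    proof (cases "dense ab S")
      case False
      then obtain T where T: "T \<subseteq># S" "size T \<ge> 2" "xnum ab T \<le> 1 / real (vord ab (sum_mset T))"
        unfolding dense_def by (meson not_le_imp_less)
      let ?S = "add_mset (sum_mset T) (S - T)"
      have "zs_free ab ?S" using T by (intro zs_free_replace less.prems) auto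
      moreover have "size ?S < size S" using T(1,2) size_mset_mono[OF T(1)] by (simp add: size_Diff_submset)
      ultimately have "xnum ab ?S \<le> B + 1 - 1 / real (p ^ Suc \<alpha>)" by (intro less.hyps)
      then show ?thesis using T(1,3) by (simp add: xnum_diff)
    next
      case True
      define P1 where "P1 = {#x \<in># S. nul b x \<and> vord ?a x = p#}"
      show ?thesis
      proof (cases "size P1 \<ge> p - 1")
        case True
        then obtain Y where Y: "Y \<subseteq># P1" "size Y = p - 1"
          using mset_subset_of_size by blast
        have YS: "Y \<subseteq># S" using Y(1) multiset_filter_subset subset_mset.order_trans unfolding P1_def by blast
        have Yp: "nul b y \<and> vord ?a y = p" if "y \<in># Y" for y
          using mset_subset_eqD[OF Y(1) that] by (simp add: P1_def)
        have R: "zs_free ab'.ab (S - Y)" by (rule quotient_full[OF cm(1) p less.prems YS Y(2) Yp])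
        have "xnum ab Y = real (p - 1) / real p"
        proof -
          have "vord ab y = p" if "y \<in># Y" for y
            using Yp[OF that] vord_eq_1_iff[OF b, of y] by (simp add: vord_ab del: power_Suc)
          then show ?thesis unfolding xnum_def using Y(2) by (simp cong: image_mset_cong)
        qed
        moreover have "xnum ab (S - Y) \<le> xnum ab'.ab (S - Y) / real p +
            (1 - 1 / real p) * xnum b {#x \<in># S - Y. nul ?a' x#}"
          by (rule xnum_weight_split[OF p cm])
        moreover have "xnum ab'.ab (S - Y) / real p \<le> (B + 1 - 1 / real (p ^ \<alpha>)) / real p"
          using Suc.IH R unfolding cross_bound_def by (intro divide_right_mono) auto
        moreover have "(1 - 1 / real p) * xnum b {#x \<in># S - Y. nul ?a' x#} \<le> (1 - 1 / real p) * B"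
          using B ab'.zs_free_part'[OF R] p1 unfolding cross_bound_def by (intro mult_left_mono) auto
        moreover have "real (p - 1) / real p + ((B + 1 - 1 / real (p ^ \<alpha>)) / real p + (1 - 1 / real p) * B) =
            B + 1 - 1 / real (p ^ Suc \<alpha>)"
          using p1 by (simp add: of_nat_diff field_simps power_Suc)
        ultimately show ?thesis using xnum_diff[OF YS, of ab] by linarith
      next
        case False
        then have size: "real (size P1) \<le> real p - 2" by simp
        \<comment> \<open>The terms of order at least \<open>p\<^sup>2\<close>: they stay nonzero in the quotient and are \<open>p\<close> times as heavy there.\<close>
        define P2 where "P2 = {#x \<in># S. nul b x \<and> vord ?a x \<noteq> p#}"
        have P12: "{#x \<in># S. nul b x#} = P1 + P2" by (rule multiset_eqI) (auto simp: P1_def P2_def)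
        have xP1: "xnum ?a P1 = real (size P1) / real p"
        proof -
          have "vord ?a x = p" if "x \<in># P1" for x using that by (simp add: P1_def)
          then show ?thesis unfolding xnum_def by (simp cong: image_mset_cong)
        qed
        have ord2: "1 / real (vord ?a' x) = real p / real (vord ?a x) \<and> \<not> nul ?a' x" if x: "x \<in># P2" for x
        proof -
          have x': "x \<in># S" "nul b x" "vord ?a x \<noteq> p" using x by (auto simp: P2_def)
          have "\<not> nul ?a x" using zs_free_not_nul[OF less.prems x'(1)] x'(2) by (simp add: nul_ab)
          then have "vord ?a x \<noteq> 1" using vord_eq_1_iff[OF a] by blast
          have "vord ?a x dvd p ^ Suc \<alpha>"
            using a by (rule vord_dvdI) (auto simp: cyc_def)
          then obtain j where j: "vord ?a x = p ^ j" using divides_primepow_nat[OF p] by blast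
          have "j \<ge> 2"
          proof (rule ccontr)
            assume "\<not> j \<ge> 2"
            then have "j = 0 \<or> j = 1" by auto
            then show False using j x'(3) \<open>vord ?a x \<noteq> 1\<close> by auto
          qed
          then obtain k where k: "j = Suc (Suc k)" by (metis add_2_eq_Suc le_add_diff_inverse)
          have "vord ?a' x = p ^ Suc k" using vord_cyc_Suc[OF p j] k by simp
          moreover have "p ^ Suc k \<noteq> 1" using p1 by simp
          ultimately show ?thesis using j k p1 vord_eq_1_iff[OF ab'.a, of x] by (auto simp: power_Suc)
        qed
        have x2: "xnum ?a' T = real p * xnum ?a T" if "T \<subseteq># P2" for T
        proof -
          have "xnum ?a' T = (\<Sum>x\<in>#T. real p * (1 / real (vord ?a x)))"
            unfolding xnum_def using ord2 mset_subset_eqD[OF that]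
            by (intro arg_cong[of _ _ sum_mset] image_mset_cong) auto
          then show ?thesis unfolding xnum_def by (simp only: sum_mset_distrib_left)
        qed
        have "xnum ?a' P2 \<le> 1 - 1 / real (p ^ \<alpha>)"
        proof (rule ccontr)
          assume "\<not> ?thesis"
          then obtain T where T: "T \<subseteq># P2" "T \<noteq> {#}" "nul ?a' (sum_mset T)" "xnum ?a' T \<le> 1"
            using short_zs_cyclic[OF p, of i \<alpha>] unfolding short_zs_def by (meson not_le_imp_less)
          have TS: "T \<subseteq># S" using T(1) multiset_filter_subset subset_mset.order_trans unfolding P2_def by blast
          have nb: "nul b x" if "x \<in># T" for x using mset_subset_eqD[OF T(1) that] by (simp add: P2_def)
          then have nbT: "nul b (sum_mset T)" by (rule nul_sum_mset)
          have "size T \<noteq> 1"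
          proof
            assume "size T = 1"
            then obtain x where "T = {#x#}" using size_1_singleton_mset by blast
            then show False using T(1,3) ord2[of x] by simp
          qed
          moreover have "size T \<noteq> 0" using T(2) by simp
          ultimately have "size T \<ge> 2" by linarith
          then have d: "xnum ab T > 1 / real (vord ab (sum_mset T))"
            using \<open>dense ab S\<close> TS unfolding dense_def by blast
          have "xnum ab T = xnum ?a T / real 1"
            using nb vord_eq_1_iff[OF b] by (intro xnum_ab_class) auto
          then have "xnum ab T \<le> 1 / real p" using T(4) x2[OF T(1)] p1 by (simp add: field_simps)
          moreover have "vord ?a (sum_mset T) dvd p"
            using T(3) p1 by (simp add: nul_cyc scale_def mult_dvd_mono power_Suc flip: nul_scale_iff)
          then have "vord ab (sum_mset T) dvd p"
            using nbT vord_eq_1_iff[OF b, of "sum_mset T"] by (simp add: vord_ab)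
          then have "1 / real p \<le> 1 / real (vord ab (sum_mset T))"
            using p1 by (intro divide_left_mono) (auto dest: dvd_imp_le)
          ultimately show False using d by linarith
        qed
        then have "xnum ?a P2 \<le> (1 - 1 / real (p ^ \<alpha>)) / real p"
          using x2[of P2] p1 by (simp add: field_simps)
        moreover have "xnum ?a P1 \<le> (real p - 2) / real p"
          unfolding xP1 using size by (intro divide_right_mono) auto
        moreover have "(real p - 2) / real p + (1 - 1 / real (p ^ \<alpha>)) / real p = 1 - 1 / real (p ^ Suc \<alpha>) - 1 / real p"
          using p1 by (simp add: field_simps power_Suc)
        ultimately have "xnum ?a {#x \<in># S. nul b x#} \<le> 1 - 1 / real (p ^ Suc \<alpha>) - 1 / real p"
          unfolding P12 xnum_add by linarith
        then show ?thesis using core less.prems True by blast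
      qed
    qed
  qed
  then show ?case unfolding cross_bound_def by blast
qed

declare power_Suc [simp]

theorem peel:
  assumes p: "prime p" and b: "moduli b" and B: "cross_bound b B"
    and bn: "\<And>k. b k dvd q ^ A * n" and cop: "coprime p (q ^ A * n)"
    and q: "prime q" and n: "n > 0"
    and rho: "real p * real q * rho n \<le> real q - 1"
  shows "cross_bound (mprod (cyc i (p ^ \<alpha>)) b) (B + 1 - 1 / real (p ^ \<alpha>))"
proof (rule peel_frame[OF p b _ B])
  have p1: "p > 1" and q1: "q > 1" using p q prime_gt_1_nat by blast+
  show cb: "coprime p (b k)" for k using cop bn by (meson coprime_divisors dvd_refl)
  fix \<alpha> S
  let ?a = "cyc i (p ^ Suc \<alpha>)" and ?u = "1 - 1 / real (p ^ Suc \<alpha>)"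
  assume S: "zs_free (mprod ?a b) S" and L: "xnum ?a {#x \<in># S. nul b x#} \<le> ?u - 1 / real p"
  have cm: "coprime_moduli ?a b" by (rule coprime_moduli_cyc[OF p b cb])
  let ?L = "xnum ?a {#x \<in># S. nul b x#}"
  have r0: "rho n \<ge> 0" unfolding rho_def by (intro sum_nonneg) auto
  have "?L + (?u - ?L) / real q = ?u - (?u - ?L) * (1 - 1 / real q)" by (rule convex_rearrange)
  also have "\<dots> \<le> ?u - 1 / real p * (1 - 1 / real q)"
    using L q1 by (intro diff_left_mono mult_right_mono) auto
  finally have "?L + (?u - ?L) / real q \<le> ?u - 1 / real p * (1 - 1 / real q)" .
  moreover have "?u * rho n \<le> 1 * rho n" using r0 by (intro mult_right_mono) auto
  moreover have "rho n \<le> 1 / real p * (1 - 1 / real q)"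
    using rho p1 q1 by (simp add: field_simps)
  ultimately show "xnum (mprod ?a b) S \<le> B + 1 - 1 / real (p ^ Suc \<alpha>)"
    using peel_core[OF cm p bn q n B S refl] by linarith
qed

section \<open>Abundancy and wide primes\<close>

text \<open>This is \<open>\<sigma>(n) / n\<close>, where \<open>\<sigma>(n)\<close> is the sum of the divisors of \<open>n\<close>.\<close>

definition abundancy :: "nat \<Rightarrow> real" where
  "abundancy n = (\<Sum>d | d dvd n. 1 / real d)"

lemma abundancy_rho:
  assumes "n > 0" shows "abundancy n = 1 + rho n"
proof -
  have "{d. d dvd n} - {1} = {d. d dvd n \<and> d \<noteq> 1}" by auto
  then show ?thesis unfolding abundancy_def rho_def using assms by (subst sum.remove[of _ 1]) auto
qed

lemma rho_nonneg [simp]: "rho n \<ge> 0"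
  unfolding rho_def by (intro sum_nonneg) auto

lemma rho_1 [simp]: "rho (Suc 0) = 0"
  unfolding rho_def by (rule sum.neutral) auto

lemma abundancy_mono:
  assumes "m dvd n" "n > 0" shows "abundancy m \<le> abundancy n"
  unfolding abundancy_def using assms by (intro sum_mono2) (auto intro: dvd_trans)

lemma abundancy_mult:
  assumes cop: "coprime m n" and pos: "m > 0" "n > 0"
  shows "abundancy (m * n) = abundancy m * abundancy n"
proof -
  let ?f = "\<lambda>(x,y). x * y :: nat"
  have inj: "inj_on ?f ({d. d dvd m} \<times> {d. d dvd n})"
  proof (rule inj_onI)
    have g: "gcd (x * y) m = x" "gcd (x * y) n = y" if "x dvd m" "y dvd n" for x y
    proof -
      have "coprime m y" "coprime n x" using that cop
        by (meson coprime_commute coprime_divisors dvd_refl)+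
      then have "gcd (x * y) m = gcd x m" "gcd (x * y) n = gcd y n"
        by (metis gcd.commute gcd_mult_left_right_cancel gcd_mult_right_right_cancel,
          metis gcd.commute gcd_mult_right_left_cancel)
      then show "gcd (x * y) m = x" "gcd (x * y) n = y" using that by (simp_all add: gcd_nat.absorb1)
    qed
    fix u v assume "u \<in> {d. d dvd m} \<times> {d. d dvd n}" "v \<in> {d. d dvd m} \<times> {d. d dvd n}" "?f u = ?f v"
    then show "u = v" using g by (cases u, cases v) (auto, metis+)
  qed
  have img: "?f ` ({d. d dvd m} \<times> {d. d dvd n}) = {d. d dvd m * n}"
  proof safe
    fix x y assume "x dvd m" "y dvd n" then show "x * y dvd m * n" by (rule mult_dvd_mono)
  next
    fix x assume "x dvd m * n"
    then obtain y z where "x = y * z" "y dvd m" "z dvd n" using division_decomp by blast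
    then show "x \<in> ?f ` ({d. d dvd m} \<times> {d. d dvd n})" by (intro image_eqI[of _ _ "(y, z)"]) auto
  qed
  have "abundancy (m * n) = (\<Sum>u\<in>{d. d dvd m} \<times> {d. d dvd n}. 1 / real (?f u))"
    unfolding abundancy_def img[symmetric] by (subst sum.reindex[OF inj]) simp
  also have "\<dots> = (\<Sum>u\<in>{d. d dvd m} \<times> {d. d dvd n}. (1 / real (fst u)) * (1 / real (snd u)))"
    by (intro sum.cong) auto
  also have "\<dots> = abundancy m * abundancy n"
    unfolding abundancy_def sum_product by (simp add: sum.cartesian_product case_prod_beta)
  finally show ?thesis .
qed

text \<open>The induction step for the geometric sum \<open>S\<close> with ratio \<open>1 / Q\<close>, where \<open>Y\<close> stands for a power of \<open>Q\<close>.\<close>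

lemma geometric_step:
  fixes S Y Q :: real
  assumes "Q > 1" "Y > 0" "S = (Q * Y - 1) / (Q * Y - Y)"
  shows "S + 1 / (Q * Y) = (Q * (Q * Y) - 1) / (Q * (Q * Y) - Q * Y)"
proof -
  have "Q * Y - Y \<noteq> 0" using assms by (simp add: mult_eq_1_iff[symmetric])
  then have S: "S * (Q * Y - Y) = Q * Y - 1" using assms by simp
  have "(S + 1 / (Q * Y)) * (Q * (Q * Y) - Q * Y) = Q * (S * (Q * Y - Y)) + (Q - 1)"
    using assms(1,2) by (simp add: field_simps)
  also have "\<dots> = Q * (Q * Y) - 1" unfolding S by (simp add: algebra_simps)
  finally show ?thesis using \<open>Q * Y - Y \<noteq> 0\<close> assms(1) by (subst eq_divide_eq) (simp add: algebra_simps)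
qed

lemma abundancy_prime_power:
  assumes "prime q"
  shows "abundancy (q ^ A) = (real q ^ (A + 1) - 1) / (real q ^ (A + 1) - real q ^ A)"
proof -
  have q1: "q > 1" using assms prime_gt_1_nat by blast
  have "{d. d dvd q ^ A} = (\<lambda>k. q ^ k) ` {..A}"
    using divides_primepow_nat[OF assms] by (auto simp: le_imp_power_dvd)
  moreover have "inj_on (\<lambda>k. q ^ k) {..A}" using q1 by (auto simp: inj_on_def)
  ultimately have "abundancy (q ^ A) = (\<Sum>k\<le>A. 1 / real (q ^ k))"
    unfolding abundancy_def by (simp add: sum.reindex)
  also have "\<dots> = (\<Sum>k\<le>A. (1 / real q) ^ k)" by (simp add: power_one_over)
  also have "\<dots> = (real q ^ (A + 1) - 1) / (real q ^ (A + 1) - real q ^ A)"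
  proof (induction A)
    case 0
    then show ?case using q1 by (simp add: field_simps)
  next
    case (Suc A)
    show ?case using geometric_step[of "real q" "real q ^ A" "\<Sum>k\<le>A. (1 / real q) ^ k"] Suc.IH q1
      by (simp add: power_one_over)
  qed
  finally show ?thesis .
qed

lemma abundancy_prime_power_bound:
  assumes "prime q"
  shows "abundancy (q ^ A) \<le> 1 + 1 / (real q - 1)"
proof -
  have q1: "real q > 1" using prime_gt_1_nat[OF assms] by simp
  have e: "real q ^ (A + 1) - real q ^ A = real q ^ A * (real q - 1)" by (simp add: algebra_simps)
  have "abundancy (q ^ A) \<le> real q ^ (A + 1) / (real q ^ A * (real q - 1))"
    unfolding abundancy_prime_power[OF assms] e using q1 by (intro divide_right_mono) auto
  also have "\<dots> = 1 + 1 / (real q - 1)" using q1 by (simp add: field_simps)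
  finally show ?thesis .
qed

lemma abundancy_prod_prime_powers:
  assumes "finite Q" "\<And>q. q \<in> Q \<Longrightarrow> prime q"
  shows "abundancy (\<Prod>q\<in>Q. q ^ e q) = (\<Prod>q\<in>Q. abundancy (q ^ e q))"
  using assms
proof (induction Q rule: finite_induct)
  case empty
  show ?case by (simp add: abundancy_def)
next
  case (insert q Q)
  have "coprime (q ^ e q) (\<Prod>q\<in>Q. q ^ e q)"
  proof (rule prod_coprime_right)
    fix l assume "l \<in> Q"
    then have "q \<noteq> l" "prime q" "prime l" using insert by auto
    then show "coprime (q ^ e q) (l ^ e l)" by (simp add: primes_coprime)
  qed
  moreover have "q ^ e q > 0" using insert.prems prime_gt_0_nat by simp
  moreover have "(\<Prod>q\<in>Q. q ^ e q) > 0"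
    by (rule prod_pos) (use insert.prems prime_gt_0_nat in auto)
  ultimately have "abundancy (q ^ e q * (\<Prod>q\<in>Q. q ^ e q)) = abundancy (q ^ e q) * abundancy (\<Prod>q\<in>Q. q ^ e q)"
    by (rule abundancy_mult)
  then show ?case using insert by simp
qed

lemma wideD:
  assumes "wide p n"
  shows "n > 0" "prime p" "\<not> p dvd n"
    "(\<Prod>q\<in>prime_factors n. (real q ^ (multiplicity q n + 1) - 1) /
          (real q ^ (multiplicity q n + 1) - real q ^ multiplicity q n)) \<le> real p / (real p - 1)"
  subgoal using assms unfolding wide_def by (elim conjE)
  subgoal using assms unfolding wide_def by (elim conjE)
  subgoal using assms unfolding wide_def by (elim conjE)
  subgoal using assms unfolding wide_def by (elim conjE)
  done

text \<open>The product in the definition of a wide prime is the abundancy of \<open>n\<close>.\<close>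

lemma wide_abundancy:
  assumes "wide p n"
  shows "abundancy n \<le> 1 + 1 / (real p - 1)"
proof -
  note n = wideD(1)[OF assms] and p = wideD(2)[OF assms]
  have p1: "real p > 1" using prime_gt_1_nat[OF p] by simp
  have "abundancy n = abundancy (\<Prod>q\<in>prime_factors n. q ^ multiplicity q n)"
    by (rule arg_cong[OF prime_factorization_nat[OF n]])
  also have "\<dots> = (\<Prod>q\<in>prime_factors n. abundancy (q ^ multiplicity q n))"
    by (rule abundancy_prod_prime_powers) (auto intro: in_prime_factors_imp_prime)
  also have "\<dots> = (\<Prod>q\<in>prime_factors n. (real q ^ (multiplicity q n + 1) - 1) /
          (real q ^ (multiplicity q n + 1) - real q ^ multiplicity q n))"
    by (intro prod.cong refl abundancy_prime_power) (rule in_prime_factors_imp_prime)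
  also have "\<dots> \<le> real p / (real p - 1)" by (rule wideD(4)[OF assms])
  also have "\<dots> = 1 + 1 / (real p - 1)" using p1 by (simp add: field_simps)
  finally show ?thesis .
qed

lemma abundancy_prime_dvd:
  assumes "prime q" "q dvd n" "n > 0"
  shows "abundancy n \<ge> 1 + 1 / real q"
proof -
  have "q > 1" using assms(1) prime_gt_1_nat by blast
  then have "abundancy n \<ge> (\<Sum>d\<in>{1, q}. 1 / real d)"
    unfolding abundancy_def using assms by (intro sum_mono2) auto
  then show ?thesis using \<open>q > 1\<close> by simp
qed

text \<open>A prime divisor \<open>q\<close> contributes \<open>1 / q\<close> to the abundancy, whence \<open>q \<ge> p - 1\<close>. Two consecutive numbers are
  both prime only if they are \<open>2\<close> and \<open>3\<close>; then any further divisor of \<open>n\<close> would violate the bound.\<close>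

lemma wide_prime_divisor:
  assumes w: "wide p n" and q: "prime q" "q dvd n"
  shows "q > p \<or> p = 3 \<and> n = 2"
proof (rule disjCI)
  assume neg: "\<not> (p = 3 \<and> n = 2)"
  note n = wideD(1)[OF w] and p = wideD(2)[OF w] and pn = wideD(3)[OF w]
  have p1: "p > 1" and q1: "q > 1" using p q prime_gt_1_nat by blast+
  have "1 + 1 / real q \<le> 1 + 1 / (real p - 1)"
    using wide_abundancy[OF w] abundancy_prime_dvd[OF q n] by linarith
  then have "real p - 1 \<le> real q" using p1 q1 by (simp add: field_simps)
  then have ge: "q \<ge> p - 1" using p1 by linarith
  have "q \<noteq> p" using pn q(2) by auto
  moreover have "q \<noteq> p - 1"
  proof
    assume qp: "q = p - 1"
    have "p = 3 \<and> q = 2"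
    proof (cases "even p")
      case True
      then have "p = 2" using p by (metis primes_dvd_imp_eq two_is_prime_nat)
      then show ?thesis using qp q1 by simp
    next
      case False
      then have "even q" using qp p1 by simp
      then have "q = 2" using q(1) by (metis primes_dvd_imp_eq two_is_prime_nat)
      then show ?thesis using qp p1 by simp
    qed
    then have "p = 3" "q = 2" by auto
    then have "n \<noteq> 2" "n \<noteq> 1" using neg q by auto
    have "abundancy n \<ge> (\<Sum>d\<in>{1, 2, n}. 1 / real d)"
      unfolding abundancy_def using n q(2) \<open>q = 2\<close> by (intro sum_mono2) auto
    moreover have "(\<Sum>d\<in>{1, 2, n}. 1 / real d) = 1 + 1 / 2 + 1 / real n"
      using \<open>n \<noteq> 2\<close> \<open>n \<noteq> 1\<close> by simp
    moreover have "abundancy n \<le> 1 + 1 / 2" using wide_abundancy[OF w] \<open>p = 3\<close> by simp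
    moreover have "1 / real n > 0" using n by simp
    ultimately show False by linarith
  qed
  ultimately show "q > p" using ge by linarith
qed

text \<open>A multiple of the exponent of the direct sum of the summands that belong to \<open>p\<^sub>i\<^sub>+\<^sub>1, \<dots>, p\<^sub>r\<close>.\<close>

definition tail_exponent :: "nat \<Rightarrow> (nat \<Rightarrow> nat) \<Rightarrow> (nat \<Rightarrow> nat) \<Rightarrow> nat \<Rightarrow> nat" where
  "tail_exponent r p \<alpha> i = (\<Prod>j = i + 1..r - 1. p j ^ \<alpha> j) * p r"

lemma obtain_larger_prime: obtains l :: nat where "prime l" "l > q"
  using bigger_prime by blast

text \<open>Let \<open>q = p k\<close> be the smallest prime of the tail. If a prime of index \<open>j\<close> strictly
  between \<open>i\<close> and \<open>k\<close> occurred in the tail with \<open>j \<le> r - 2\<close>, it would be smaller than \<open>q\<close> by \<open>wide_prime_divisor\<close>. So for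
  \<open>k \<le> r - 2\<close> the cofactor of the power of \<open>q\<close> is the tail that follows \<open>k\<close>, and
  the wideness of \<open>p k\<close> bounds its abundancy. If \<open>k \<ge> r - 1\<close>, there is at most one more prime.\<close>

lemma tail_exponent_split:
  fixes p \<alpha> :: "nat \<Rightarrow> nat"
  assumes r: "r \<ge> 2" and pr: "\<And>i. i \<in> {1..r} \<Longrightarrow> prime (p i)" and inj: "inj_on p {1..r}"
    and w: "\<And>i. 1 \<le> i \<Longrightarrow> i \<le> r - 2 \<Longrightarrow> wide (p i) (tail_exponent r p \<alpha> i)"
    and i: "1 \<le> i" "i \<le> r - 2" and ne: "\<not> (p i = 3 \<and> tail_exponent r p \<alpha> i = 2)"
  shows "\<exists>q A n. prime q \<and> q > p i \<and> A \<ge> 1 \<and> n > 0 \<and> coprime q n \<and> tail_exponent r p \<alpha> i = q ^ A * n \<and>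
    ((\<exists>l e. prime l \<and> l > q \<and> n = l ^ e) \<or>
     (\<exists>k. i < k \<and> k \<le> r - 2 \<and> q = p k \<and> A = \<alpha> k \<and> n = tail_exponent r p \<alpha> k \<and>
        (\<forall>j. i < j \<and> j < k \<longrightarrow> \<alpha> j = 0)))"
proof -
  let ?N = "tail_exponent r p \<alpha>"
  have gt: "q > p i" if "prime q" "q dvd ?N i" for q
    using wide_prime_divisor[OF w[OF i] that] ne by blast
  have pi: "p i \<ge> 2" using pr[of i] i prime_ge_2_nat by auto
  \<comment> \<open>The indices of the primes that occur in the tail after \<open>i\<close>.\<close>
  define act where "act = (\<lambda>k. k \<in> {i + 1..r} \<and> (k < r \<longrightarrow> \<alpha> k > 0))"
  have actr: "act r" using i r by (auto simp: act_def)
  have dvdN: "p k dvd ?N j" if "act k" "i \<le> j" "j < k" for k j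
  proof (cases "k = r")
    case False
    then have "k \<in> {j + 1..r - 1}" "\<alpha> k > 0" using that by (auto simp: act_def)
    then have "p k dvd (\<Prod>j = j + 1..r - 1. p j ^ \<alpha> j)"
      by (intro dvd_trans[OF _ dvd_prodI[of _ k]]) (auto simp: dvd_power)
    then show ?thesis by (simp add: tail_exponent_def)
  qed (simp add: tail_exponent_def)
  have "finite {k. act k}" by (rule finite_subset[of _ "{..r}"]) (auto simp: act_def)
  then obtain k where k: "act k" "\<And>j. act j \<Longrightarrow> p k \<le> p j"
    using actr ex_min_if_finite[of "p ` {k. act k}"] by (force simp: not_less)
  let ?q = "p k"
  have ik: "i < k" "k \<le> r" using k(1) by (auto simp: act_def)
  have q: "prime ?q" using pr ik i by auto
  have qi: "?q > p i" using gt[OF q dvdN[OF k(1) order_refl ik(1)]] .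
  have zero: "\<alpha> j = 0" if j: "i < j" "j < k" "j \<le> r - 2" for j
  proof (rule ccontr)
    assume "\<alpha> j \<noteq> 0"
    then have "act j" using j ik by (auto simp: act_def)
    then have "?q \<le> p j" by (rule k(2))
    moreover have "?q > p j \<or> p j = 3 \<and> ?N j = 2"
      using wide_prime_divisor[OF w q dvdN[OF k(1)]] j i by auto
    ultimately have "p j = 3" "?N j = 2" by auto
    then have "?q dvd 2" using dvdN[OF k(1), of j] j by auto
    then have "?q = 2" using q by (metis primes_dvd_imp_eq two_is_prime_nat)
    then show False using qi pi by simp
  qed
  have Nsplit: "?N i = (\<Prod>j = i + 1..m. p j ^ \<alpha> j) * (\<Prod>j = m + 1..r - 1. p j ^ \<alpha> j) * p r"
    if "i \<le> m" "m \<le> r - 1" for m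
  proof -
    have "m + (r - 1 - m) = r - 1" using that by simp
    then show ?thesis
      unfolding tail_exponent_def using that prod.ub_add_nat[of "i + 1" m "\<lambda>j. p j ^ \<alpha> j" "r - 1 - m"]
      by simp
  qed
  have ones: "(\<Prod>j = i + 1..m. p j ^ \<alpha> j) = 1" if "m < k" "m \<le> r - 2" for m
    using that zero by (intro prod.neutral) auto
  have ppos: "p j > 0" if "j \<in> {1..r}" for j using pr[OF that] prime_gt_0_nat by blast
  have cop: "coprime ?q (p j ^ e)" if "j \<in> {1..r}" "j \<noteq> k" for j e
  proof -
    have "p j \<noteq> ?q" using inj that ik i by (auto dest: inj_onD)
    then show ?thesis using pr[OF that(1)] q by (simp add: primes_coprime)
  qed
  consider "k \<le> r - 2" | "k = r - 1" "k < r" | "k = r" using ik(2) by linarith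
  then show ?thesis
  proof cases
    case 1
    have "k \<le> r - 1" using 1 by linarith
    then have "?N i = (\<Prod>j = i + 1..k. p j ^ \<alpha> j) * ?N k"
      using Nsplit[OF less_imp_le[OF ik(1)]] by (auto simp: tail_exponent_def)
    also have "(\<Prod>j = i + 1..k. p j ^ \<alpha> j) = ?q ^ \<alpha> k"
    proof -
      have "(\<Prod>j = i + 1..k. p j ^ \<alpha> j) = (\<Prod>j = i + 1..k - 1. p j ^ \<alpha> j) * p k ^ \<alpha> k"
        using ik prod.cl_ivl_Suc[of "\<lambda>j. p j ^ \<alpha> j" "i + 1" "k - 1"] by simp
      then show ?thesis using ones[of "k - 1"] ik 1 by simp
    qed
    finally have N: "?N i = ?q ^ \<alpha> k * ?N k" .
    have "\<alpha> k \<ge> 1" using k(1) 1 r ik i by (auto simp: act_def)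
    moreover have "coprime ?q (?N k)"
    proof -
      have "coprime ?q (p j ^ \<alpha> j)" if "j \<in> {k + 1..r - 1}" for j using that by (intro cop) auto
      moreover have "coprime ?q (p r)" using cop[of r 1] 1 r ik i by auto
      moreover have "coprime ?q (\<Prod>j = k + 1..r - 1. p j ^ \<alpha> j)"
        by (rule prod_coprime_right) (rule calculation(1))
      ultimately show ?thesis unfolding tail_exponent_def by simp
    qed
    moreover have "?N k > 0" using wideD(1)[OF w[of k]] 1 ik i by simp
    ultimately show ?thesis using N q qi 1 ik zero by (intro exI[of _ ?q] exI[of _ "\<alpha> k"] exI[of _ "?N k"]) auto
  next
    case 2
    have "?N i = (\<Prod>j = i + 1..r - 2. p j ^ \<alpha> j) * (\<Prod>j = r - 2 + 1..r - 1. p j ^ \<alpha> j) * p r"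
      using i by (intro Nsplit) auto
    moreover have "{r - 2 + 1..r - 1} = {k}" using 2 r by auto
    ultimately have N: "?N i = ?q ^ \<alpha> k * p r" using ones[of "r - 2"] 2 r ik i by simp
    have "coprime ?q (p r)" using cop[of r 1] 2 r by auto
    moreover have "p r > ?q" using k(2)[OF actr] cop[of r 1] 2 r q
      by (metis \<open>coprime (p k) (p r)\<close> coprime_self le_neq_implies_less not_prime_unit)
    moreover have "\<alpha> k \<ge> 1" using k(1) 2 by (auto simp: act_def)
    moreover have "prime (p r)" using pr r by auto
    moreover have "\<exists>l e. prime l \<and> l > ?q \<and> p r = l ^ e"
      using calculation by (intro exI[of _ "p r"] exI[of _ 1]) auto
    ultimately show ?thesis using N q qi prime_gt_0_nat[of "p r"]
      by (rule_tac x = ?q in exI, rule_tac x = "\<alpha> k" in exI, rule_tac x = "p r" in exI) blast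
  next
    case 3
    let ?l = "p (r - 1)" and ?e = "\<alpha> (r - 1)"
    have "?N i = (\<Prod>j = i + 1..r - 2. p j ^ \<alpha> j) * (\<Prod>j = r - 2 + 1..r - 1. p j ^ \<alpha> j) * p r"
      using i by (intro Nsplit) auto
    moreover have "{r - 2 + 1..r - 1} = {r - 1}" using r by auto
    ultimately have N: "?N i = ?q ^ 1 * ?l ^ ?e" using ones[of "r - 2"] 3 r ik i by simp
    have l: "prime ?l" using pr r by auto
    have c: "coprime ?q (?l ^ ?e)" using 3 r by (intro cop) auto
    have c1: "coprime ?q ?l" using cop[of "r - 1" 1] 3 r by auto
    \<comment> \<open>If \<open>p\<^sub>r\<^sub>-\<^sub>1\<close> does not occur, the cofactor is \<open>1\<close>, a trivial power of any larger prime.\<close>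
    have "\<exists>l e. prime l \<and> l > ?q \<and> ?l ^ ?e = l ^ e"
    proof (cases "?e = 0")
      case True
      obtain l where "prime l" "l > ?q" by (rule obtain_larger_prime)
      then show ?thesis using True by (intro exI[of _ l] exI[of _ 0]) auto
    next
      case False
      then have "act (r - 1)" using i r by (auto simp: act_def)
      then have "?q \<le> ?l" by (rule k(2))
      then have "?q < ?l" using c1 q by (metis coprime_self le_neq_implies_less not_prime_unit)
      then show ?thesis using l by blast
    qed
    then show ?thesis using N q qi c prime_gt_0_nat[OF l]
      by (rule_tac x = ?q in exI, rule_tac x = 1 in exI, rule_tac x = "?l ^ ?e" in exI) simp
  qed
qed

section \<open>The exceptional pair of primes 2 and 3\<close>

context coprime_moduli
begin

text \<open>If the terms of orders \<open>1\<close> and \<open>d\<close> contain a zero-sum at all, it makes up for all the terms of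
  order \<open>d\<close>: these weigh no more than \<open>1 / d\<close>, and only the weight of \<open>P\<close> is lost.\<close>

lemma loss_one_zero_sum:
  assumes "T \<subseteq># P + C" "T \<noteq> {#}" "nul a (sum_mset T)"
    and "\<And>x. x \<in># P \<Longrightarrow> vord b x = 1" "\<And>x. x \<in># C \<Longrightarrow> vord b x = d"
    and "xnum a C \<le> 1" "1 / real d \<le> f (sum_mset T)"
  shows "loss f (P + C) (xnum a P)"
proof -
  have "xnum ab (P + C) = xnum a P / real 1 + xnum a C / real d"
    unfolding xnum_add using xnum_ab_class[of P 1] xnum_ab_class[of C d] assms(4,5) by simp
  also have "\<dots> \<le> xnum a P + 1 / real d" using assms(6) by (simp add: divide_right_mono)
  finally have "xnum ab (P + C) \<le> f (sum_mset T) + xnum a P" using assms(7) by simp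
  then show ?thesis unfolding loss_def using assms(1-3)
    by (intro exI[of _ "{#T#}"]) (simp add: zs_family_def)
qed

lemma loss_nul:
  assumes "\<And>x. x \<in># U \<Longrightarrow> nul a x"
  shows "loss (\<lambda>z. 1 / real (vord b z)) U 0"
proof -
  let ?F = "image_mset (\<lambda>x. {#x#}) U"
  have "zs_family a U ?F" using assms by (auto simp: zs_family_def)
  moreover have "xnum ab U = (\<Sum>T\<in>#?F. 1 / real (vord b (sum_mset T)))"
  proof -
    have "vord ab x = vord b x" if "x \<in># U" for x
      using assms[OF that] vord_eq_1_iff[OF a, of x] by (simp add: vord_ab)
    then show ?thesis unfolding xnum_def by (simp add: multiset.map_comp comp_def cong: image_mset_cong)
  qed
  ultimately show ?thesis unfolding loss_def by (intro exI[of _ ?F]) simp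
qed

text \<open>A short zero-sum of terms of the same order \<open>d\<close> over \<open>b\<close> would have a sum of order dividing \<open>d\<close>, against
  density.\<close>

lemma dense_class_bound:
  assumes dense: "dense ab S" and sh: "short_zs a u" and US: "U \<subseteq># S"
    and U: "\<And>x. x \<in># U \<Longrightarrow> \<not> nul a x \<and> vord b x = d" and d: "d > 0"
  shows "xnum a U \<le> u"
proof (rule ccontr)
  assume "\<not> ?thesis"
  then obtain T where T: "T \<subseteq># U" "T \<noteq> {#}" "nul a (sum_mset T)" "xnum a T \<le> 1"
    using sh unfolding short_zs_def by (meson not_le_imp_less)
  have UT: "\<not> nul a x \<and> vord b x = d" if "x \<in># T" for x using U mset_subset_eqD[OF T(1) that] by blast
  have "size T \<noteq> 1"
  proof
    assume "size T = 1"
    then obtain x where "T = {#x#}" using size_1_singleton_mset by blast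
    then show False using T(3) UT by auto
  qed
  moreover have "size T \<noteq> 0" using T(2) by simp
  ultimately have "size T \<ge> 2" by linarith
  moreover have "T \<subseteq># S" using T(1) US by (rule subset_mset.order_trans)
  ultimately have less: "1 / real (vord ab (sum_mset T)) < xnum ab T" using dense unfolding dense_def by blast
  have "xnum ab T = xnum a T / real d" using UT by (intro xnum_ab_class) auto
  also have "\<dots> \<le> 1 / real d" using T(4) d by (intro divide_right_mono) auto
  also have "\<dots> \<le> 1 / real (vord b (sum_mset T))"
    using UT d by (intro gain_vord vord_sum_mset_dvd[OF b]) auto
  also have "vord b (sum_mset T) = vord ab (sum_mset T)"
    using T(3) vord_eq_1_iff[OF a, of "sum_mset T"] by (simp add: vord_ab)
  finally show False using less by simp
qed

end

lemma subset_filter_msetI: "T \<subseteq># S \<Longrightarrow> (\<And>x. x \<in># T \<Longrightarrow> Q x) \<Longrightarrow> T \<subseteq># filter_mset Q S"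
  using multiset_filter_mono[of T S Q] filter_mset_eq_conv[of Q T T] by simp

text \<open>The linear arithmetic of the case of a zero-sum in \<open>C 1 + C q\<close> below, with \<open>y = 1 / q\<close>, \<open>s\<close> the
  weight of \<open>C 3\<close>, \<open>A = u \<rho>(n)\<close>, \<open>B = u y\<close> and \<open>r = \<rho>(n)\<close>.\<close>

lemma two_three_arith1:
  fixes \<kappa> y s u L A B r :: real
  assumes "\<kappa> \<le> 5 / 18 + 2 / 3 * y" "s \<le> u - L" "L \<le> u - 1 / 2" "A - 2 / 3 * B \<le> r - 2 / 3 * y" "u \<le> 1" "0 \<le> s"
  shows "A - B + (L + (s / 3 + (u - s) / 9) + B / 3) \<le> u + r - \<kappa>"
  using assms by argo

text \<open>Likewise for the case without such a zero-sum, with \<open>s = y\<close> times the weight of \<open>C q\<close> and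
  \<open>V = (u - L) y\<close>.\<close>

lemma two_three_arith2:
  fixes \<kappa> y s u L A B r V :: real
  assumes "\<kappa> \<le> 1 / 3 + 1 / 3 * y" "s \<le> V" "1 / 2 * (1 - y) \<le> u - L - V" "A - 2 / 3 * B \<le> r - 2 / 3 * y"
  shows "A - B + (L / 1 + (u - L) / 3) + (s + (B - s) / 3) \<le> u + r - \<kappa>"
  using assms by argo

text \<open>With \<open>C d\<close> the terms of order \<open>d\<close> over \<open>b\<close> (nonzero over \<open>a\<close>) and \<open>L\<close> the weight of \<open>C 1\<close>, the chains
  are chosen as follows. If \<open>C 1 + C 3\<close> has a zero-sum, it is one piece, and the terms of orders
  \<open>9, 27, \<dots>\<close> form a chain with loss \<open>u / 9\<close>. If not, then \<open>C 3\<close> weighs at most \<open>u - L\<close>. If \<open>C 1 + C q\<close> has a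
  zero-sum, it is a piece, the orders \<open>3, 9, \<dots>\<close> form a chain with a light bottom, and so do the orders
  \<open>3 q, 9 q, \<dots>\<close>. Otherwise \<open>C q\<close> weighs at most \<open>u - L\<close> too, and the chains \<open>1, 3, \<dots>\<close> and \<open>q, 3 q, \<dots>\<close> are
  both improved by a light bottom. All other divisors of \<open>n\<close> have the usual chains. In the last two cases every zero-sum that
  is used contains a term of order not dividing \<open>3\<close>, so that the credit \<open>f\<close> is needed for such zero-sums only.\<close>

lemma two_three_core:
  assumes cm: "coprime_moduli (cyc i (2 ^ m)) b" and bn: "\<And>k. b k dvd 3 ^ A * n"
    and n: "n > 0" "coprime 3 n" "coprime 2 n" and A: "A \<ge> 1" and q: "prime q" "q \<ge> 5" "q dvd n"
    and S: "zs_free (mprod (cyc i (2 ^ m)) b) S" and dense: "dense (mprod (cyc i (2 ^ m)) b) S"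
    and u: "u = 1 - 1 / real (2 ^ m)"
    and L: "L = xnum (cyc i (2 ^ m)) {#x \<in># S. nul b x#}" "L \<le> u - 1 / 2"
    and S1: "S1 = {#x \<in># S. \<not> nul (cyc i (2 ^ m)) x#}"
  shows "coprime_moduli.loss (cyc i (2 ^ m)) b (\<lambda>z. 1 / real (vord b z)) S1
      (L + (if A = 1 then 0 else u / 9) + u * rho n) \<or>
    (\<forall>f \<kappa>. (\<forall>T D. T \<subseteq># S1 \<longrightarrow> T \<noteq> {#} \<longrightarrow> nul (cyc i (2 ^ m)) (sum_mset T) \<longrightarrow>
         (\<forall>x\<in>#T. vord b x dvd D) \<longrightarrow> D > 0 \<longrightarrow> (\<exists>x\<in>#T. \<not> vord b x dvd 3) \<longrightarrow>
         1 / real D \<le> f (sum_mset T)) \<longrightarrow>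
       \<kappa> \<le> 5 / 18 + 2 / (3 * real q) \<longrightarrow> \<kappa> \<le> 1 / 3 + 1 / (3 * real q) \<longrightarrow>
       coprime_moduli.loss (cyc i (2 ^ m)) b f S1 (u + rho n - \<kappa>))"
proof -
  let ?a = "cyc i (2 ^ m)"
  interpret coprime_moduli ?a b by fact
  have u01: "0 \<le> u" "u \<le> 1" by (auto simp: u)
  have sh: "short_zs ?a u" unfolding u using short_zs_cyclic[of 2 i m] by simp
  have "\<exists>t d. d dvd n \<and> vord b x = d * 3 ^ t" for x
    by (rule dvd_prime_power_mult[of 3]) (simp, rule vord_dvdI[OF b bn])
  then obtain tt dd where td: "\<And>x. dd x dvd n" "\<And>x. vord b x = dd x * 3 ^ tt x" by metis
  have pos: "d > 0" if "d dvd n" for d using that n by (simp add: dvd_pos_nat)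
  have cop3: "coprime 3 d" if "d dvd n" for d :: nat using that n(2) by (meson coprime_divisors dvd_refl)
  have key: "vord b x = d * 3 ^ t \<longleftrightarrow> dd x = d \<and> tt x = t" if d: "d dvd n" for x d t
  proof
    assume "vord b x = d * 3 ^ t"
    then have e: "dd x * 3 ^ tt x = d * 3 ^ t" by (simp add: td)
    have c: "coprime (dd x) (3 ^ t)" "coprime d (3 ^ tt x)"
      using cop3[OF td(1)] cop3[OF d] by (simp_all add: coprime_commute)
    have "dd x dvd d" "d dvd dd x"
      using c e by (metis coprime_dvd_mult_left_iff dvd_triv_left)+
    then have "dd x = d" by (rule dvd_antisym)
    then show "dd x = d \<and> tt x = t" using e pos[OF d] by simp
  qed (simp add: td)
  have key1: "vord b x = 1 \<longleftrightarrow> dd x = 1 \<and> tt x = 0" for x using key[of 1 x 0] by simp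
  have key3: "vord b x = 3 \<longleftrightarrow> dd x = 1 \<and> tt x = 1" for x using key[of 1 x 1] by simp
  have keyd: "vord b x = d \<longleftrightarrow> dd x = d \<and> tt x = 0" if "d dvd n" for x d using key[OF that, of x 0] by simp
  have ttA: "tt x \<le> A" for x
  proof -
    have "3 ^ tt x dvd 3 ^ A * n" using vord_dvdI[OF b bn, of x] unfolding td(2) by (metis dvd_mult_right)
    moreover have "coprime (3 ^ tt x) n" using n(2) by simp
    ultimately have "3 ^ tt x dvd (3::nat) ^ A" by (simp add: coprime_dvd_mult_left_iff)
    then show ?thesis by (rule power_dvd_imp_le) simp
  qed
  have S1S: "S1 \<subseteq># S" by (simp add: S1)
  define C where "C = (\<lambda>d. {#x \<in># S1. vord b x = d#})"
  have CS: "C d \<subseteq># S" for d unfolding C_def using S1S multiset_filter_subset subset_mset.order_trans by blast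
  have P: "C 1 = {#x \<in># S. nul b x#}"
  proof (rule multiset_eqI)
    fix x
    have "count S x = 0" if "nul ?a x" "nul b x"
      using that zs_free_not_nul[OF S, of x] by (auto simp: nul_ab simp flip: not_in_iff)
    then show "count (C 1) x = count {#x \<in># S. nul b x#} x"
      using vord_eq_1_iff[OF b, of x] by (auto simp: C_def S1)
  qed
  have LP: "L = xnum ?a (C 1)" unfolding P by (rule L(1))
  have sd: "xnum ?a (C d) \<le> u" if "d > 0" for d
    by (rule dense_class_bound[OF dense sh CS _ that]) (auto simp: C_def S1)
  have mixed: "xnum ?a (C d) \<le> u - L" if "\<not> (\<exists>T. T \<subseteq># C 1 + C d \<and> T \<noteq> {#} \<and> nul ?a (sum_mset T))" for d
  proof -
    have "zs_free ?a (C 1 + C d)" using that unfolding zs_free_def by blast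
    then have "xnum ?a (C 1 + C d) \<le> u" unfolding u by (rule cross_number_cyclic[OF two_is_prime_nat])
    then show ?thesis by (simp add: LP)
  qed
  define K where "K = {d. d dvd n \<and> d \<noteq> 1}"
  have finK: "finite K" using n by (simp add: K_def)
  have qK: "q \<in> K" using q by (auto simp: K_def)
  have Cd: "vord b x = d" if "x \<in># C d" for x d using that by (simp add: C_def)
  have sumK: "(\<Sum>d\<in>K. u / real d) = u * rho n"
    unfolding rho_def K_def sum_distrib_left by simp
  have sumKq: "(\<Sum>d\<in>K - {q}. u / real d) = u * rho n - u / real q"
    using sum.remove[OF finK qK, of "\<lambda>d. u / real d"] by (simp add: sumK)
  \<comment> \<open>The chains that are the same in all cases.\<close>
  have rest: "loss f {#x \<in># S1. dd x \<in> K'#} (\<Sum>d\<in>K'. u / real d)"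
    if g: "\<And>T D. T \<subseteq># S1 \<Longrightarrow> T \<noteq> {#} \<Longrightarrow> nul ?a (sum_mset T) \<Longrightarrow> (\<And>x. x \<in># T \<Longrightarrow> vord b x dvd D) \<Longrightarrow>
      vord b (sum_mset T) dvd D \<Longrightarrow> D > 0 \<Longrightarrow> 1 / real D \<le> f (sum_mset T)" and K': "K' \<subseteq> K" for f K'
  proof (rule loss_classes)
    show "finite K'" using finK K' finite_subset by blast
    fix d assume "d \<in> K'"
    then have d: "d dvd n" "d > 0" using K' pos by (auto simp: K_def)
    show "loss f {#x \<in># S1. dd x = d#} (u / real d)"
    proof (rule loss_chain0[OF sh u01(1) d(2), of 3])
      show "vord b x = d * 3 ^ tt x" if "x \<in># {#x \<in># S1. dd x = d#}" for x using that td(2)[of x] by simp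
      show "1 / real (d * 3 ^ t) \<le> f (sum_mset T)"
        if "T \<subseteq># {#x \<in># S1. dd x = d#}" "T \<noteq> {#}" "nul ?a (sum_mset T)"
          "\<And>x. x \<in># T \<Longrightarrow> vord b x dvd d * 3 ^ t" "vord b (sum_mset T) dvd d * 3 ^ t" for t T
        using that d(2) by (intro g) (auto intro: subset_mset.order_trans[OF _ multiset_filter_subset])
    qed simp
  qed
  show ?thesis
  proof (cases "\<exists>T. T \<subseteq># C 1 + C 3 \<and> T \<noteq> {#} \<and> nul ?a (sum_mset T)")
    case True
    then obtain T where T: "T \<subseteq># C 1 + C 3" "T \<noteq> {#}" "nul ?a (sum_mset T)" by blast
    let ?f = "\<lambda>z. 1 / real (vord b z)"
    have l1: "loss ?f (C 1 + C 3) L"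
      unfolding LP
    proof (rule loss_one_zero_sum[OF T])
      have "vord b x dvd 3" if "x \<in># T" for x using mset_subset_eqD[OF T(1) that] Cd by auto
      then show "1 / real 3 \<le> ?f (sum_mset T)" by (intro gain_vord vord_sum_mset_dvd[OF b]) auto
      show "xnum ?a (C 3) \<le> 1" using sd[of 3] u01 by simp
    qed (use Cd in auto)
    have g: "1 / real D \<le> ?f (sum_mset T)" if "vord b (sum_mset T) dvd D" "D > 0" for T D
      using that by (rule gain_vord)
    define Z where "Z = {#x \<in># S1. dd x = 1 \<and> tt x \<ge> 2#}"
    have l2: "loss ?f Z (if A = 1 then 0 else u / 9)"
    proof (cases "A = 1")
      case True
      have "tt x < 2" for x using ttA[of x] True by simp
      then have "Z = {#}" by (simp add: Z_def flip: not_less)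
      then show ?thesis using True by (simp add: loss_empty)
    next
      case False
      have "loss ?f Z (u / real 9)"
      proof (rule loss_chain0[OF sh u01(1), of 9 3])
        show "vord b x = 9 * 3 ^ (tt x - 2)" if "x \<in># Z" for x
        proof -
          have "dd x = 1" "tt x \<ge> 2" using that by (auto simp: Z_def)
          moreover obtain k where "tt x = 2 + k" using \<open>tt x \<ge> 2\<close> le_Suc_ex by blast
          ultimately show ?thesis unfolding td(2) by (simp add: power_add)
        qed
      qed (auto intro!: g[simplified] simp del: of_nat_mult)
      then show ?thesis using False by simp
    qed
    have l3: "loss ?f {#x \<in># S1. dd x \<in> K#} (u * rho n)"
      using rest[of ?f K] g unfolding sumK by blast
    have "S1 = C 1 + C 3 + Z + {#x \<in># S1. dd x \<in> K#}"
    proof (rule multiset_eqI)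
      fix x
      consider "dd x = 1" "tt x = 0" | "dd x = 1" "tt x = 1" | "dd x = 1" "tt x \<ge> 2" | "dd x \<noteq> 1" by linarith
      then show "count S1 x = count (C 1 + C 3 + Z + {#x \<in># S1. dd x \<in> K#}) x"
        by cases (auto simp: C_def Z_def K_def key1[simplified] key3 td(1))
    qed
    then have "loss ?f S1 (L + (if A = 1 then 0 else u / 9) + u * rho n)"
      using loss_union[OF loss_union[OF l1 l2] l3] by simp
    then show ?thesis by blast
  next
    case nE3: False
    have "loss f S1 (u + rho n - \<kappa>)"
      if f: "\<forall>T D. T \<subseteq># S1 \<longrightarrow> T \<noteq> {#} \<longrightarrow> nul ?a (sum_mset T) \<longrightarrow>
         (\<forall>x\<in>#T. vord b x dvd D) \<longrightarrow> D > 0 \<longrightarrow> (\<exists>x\<in>#T. \<not> vord b x dvd 3) \<longrightarrow>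
         1 / real D \<le> f (sum_mset T)"
        and \<kappa>: "\<kappa> \<le> 5 / 18 + 2 / (3 * real q)" "\<kappa> \<le> 1 / 3 + 1 / (3 * real q)" for f \<kappa>
    proof -
      have g: "1 / real D \<le> f (sum_mset T)"
        if T: "T \<subseteq># S1" "T \<noteq> {#}" "nul ?a (sum_mset T)" "\<And>x. x \<in># T \<Longrightarrow> vord b x dvd D" "D > 0" for T D
      proof (cases "\<exists>x\<in>#T. \<not> vord b x dvd 3")
        case True
        then show ?thesis using f T by blast
      next
        case False
        have "vord b x = 1 \<or> vord b x = 3" if "x \<in># T" for x
        proof -
          have "prime (3::nat)" by simp
          then show ?thesis using False that unfolding prime_nat_iff by blast
        qed
        then have "T \<subseteq># {#x \<in># S1. vord b x = 1 \<or> vord b x = 3#}"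
          using T(1) by (intro subset_filter_msetI) auto
        also have "\<dots> = C 1 + C 3" by (rule multiset_eqI) (auto simp: C_def)
        finally show ?thesis using nE3 T(2,3) by blast
      qed
      have num: "real 1 = 1" "real 3 = 3" "real (1 * 3) = 3" "real (3 * 3) = 9" by simp_all
      define s3 where "s3 = xnum ?a (C 3)"
      have s3: "0 \<le> s3" "s3 \<le> u - L" using mixed[OF nE3] by (auto simp: s3_def)
      define y where "y = 1 / real q"
      have y: "0 < y" "y \<le> 1 / 5" using q(2) by (auto simp: y_def field_simps)
      have Ry: "rho n \<ge> y"
        unfolding rho_def y_def using finK qK unfolding K_def by (intro member_le_sum) auto
      have "u * (rho n - 2 / 3 * y) \<le> rho n - 2 / 3 * y" using u01 Ry y by (intro mult_left_le_one_le) auto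
      then have uR: "u * rho n - 2 / 3 * (u * y) \<le> rho n - 2 / 3 * y" by (simp add: algebra_simps)
      have K1: "{#x \<in># S1. dd x \<in> K - {q}#} + {#x \<in># S1. dd x = 1#} + {#x \<in># S1. dd x = q#} = S1"
        using qK by (intro multiset_eqI) (auto simp: K_def td(1))
      have l0: "loss f {#x \<in># S1. dd x \<in> K - {q}#} (u * rho n - u / real q)"
        unfolding sumKq[symmetric] by (rule rest) (auto intro: g)
      have sub: "T \<subseteq># S1" if "T \<subseteq># {#x \<in># S1. Q x#}" for T Q
        using that multiset_filter_subset by (rule subset_mset.order_trans)
      show ?thesis
      proof (cases "\<exists>T. T \<subseteq># C 1 + C q \<and> T \<noteq> {#} \<and> nul ?a (sum_mset T)")
        case True
        then obtain T where T: "T \<subseteq># C 1 + C q" "T \<noteq> {#}" "nul ?a (sum_mset T)" by blast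
        have l1: "loss f (C 1 + C q) L"
          unfolding LP
        proof (rule loss_one_zero_sum[OF T])
          have "vord b x dvd q" if "x \<in># T" for x using mset_subset_eqD[OF T(1) that] Cd by auto
          moreover have "C 1 + C q = {#x \<in># S1. vord b x = 1 \<or> vord b x = q#}"
            using q(2) by (intro multiset_eqI) (auto simp: C_def)
          ultimately show "1 / real q \<le> f (sum_mset T)" using T q(2) by (intro g) (auto intro: sub)
          show "xnum ?a (C q) \<le> 1" using sd[of q] q u01 by simp
        qed (use Cd in auto)
        define U1 where "U1 = {#x \<in># S1. dd x = 1 \<and> tt x \<ge> 1#}"
        have l2: "loss f U1 (s3 / real 3 + (u - s3) / real (3 * 3))"
        proof (rule loss_chain[OF sh, where tt = "\<lambda>x. tt x - 1"])
          show "vord b x = 3 * 3 ^ (tt x - 1)" if "x \<in># U1" for x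
            using that unfolding td(2) U1_def by (cases "tt x") auto
          show "1 / real (3 * 3 ^ t) \<le> f (sum_mset T)"
            if "T \<subseteq># U1" "T \<noteq> {#}" "nul ?a (sum_mset T)" "\<And>x. x \<in># T \<Longrightarrow> vord b x dvd 3 * 3 ^ t" for t T
            using that by (intro g) (auto intro: sub simp: U1_def)
          have "{#x \<in># U1. vord b x = 3#} = C 3"
            unfolding U1_def C_def by (intro multiset_eqI) (auto simp: key3)
          then show "s3 = xnum ?a {#x \<in># U1. vord b x = 3#}" by (simp add: s3_def)
          show "s3 \<le> u" using sd[of 3] by (simp add: s3_def)
        qed simp_all
        define U2 where "U2 = {#x \<in># S1. dd x = q \<and> tt x \<ge> 1#}"
        have l3: "loss f U2 (u / real (3 * q))"
        proof (rule loss_chain0[OF sh u01(1), where tt = "\<lambda>x. tt x - 1" and q = 3])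
          show "vord b x = 3 * q * 3 ^ (tt x - 1)" if "x \<in># U2" for x
            using that unfolding td(2) U2_def by (cases "tt x") auto
          show "1 / real (3 * q * 3 ^ t) \<le> f (sum_mset T)"
            if "T \<subseteq># U2" "T \<noteq> {#}" "nul ?a (sum_mset T)" "\<And>x. x \<in># T \<Longrightarrow> vord b x dvd 3 * q * 3 ^ t" for t T
            using that q(2) by (intro g) (auto intro: sub simp: U2_def)
          show "3 * q > 0" using q(2) by simp
        qed simp
        have "(C 1 + C q) + U1 + U2 = {#x \<in># S1. dd x = 1#} + {#x \<in># S1. dd x = q#}"
        proof (rule multiset_eqI)
          fix x
          show "count ((C 1 + C q) + U1 + U2) x = count ({#x \<in># S1. dd x = 1#} + {#x \<in># S1. dd x = q#}) x"
            using q(2) keyd[OF q(3), of x] key1[of x]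
            by (cases "tt x = 0") (auto simp: C_def U1_def U2_def)
        qed
        then have "loss f S1 (u * rho n - u / real q + (L + (s3 / real 3 + (u - s3) / real (3 * 3)) + u / real (3 * q)))"
          using loss_union[OF l0 loss_union[OF loss_union[OF l1 l2] l3]] K1 by (simp add: add.assoc)
        moreover have "u * rho n - u / real q + (L + (s3 / real 3 + (u - s3) / real (3 * 3)) + u / real (3 * q)) \<le> u + rho n - \<kappa>"
        proof -
          have e: "u / real q = u * y" "u / real (3 * q) = u * y / 3" by (auto simp: y_def)
          have "\<kappa> \<le> 5 / 18 + 2 / 3 * y" using \<kappa>(1) by (simp add: y_def)
          then show ?thesis unfolding e num
            by (rule two_three_arith1[OF _ s3(2) L(2) uR u01(2) s3(1)])
        qed
        ultimately show ?thesis by (rule loss_mono)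
      next
        case False
        define sq where "sq = xnum ?a (C q)"
        have sq: "0 \<le> sq" "sq \<le> u - L" using mixed[OF False] by (auto simp: sq_def)
        have l1: "loss f {#x \<in># S1. dd x = 1#} (L / real 1 + (u - L) / real (1 * 3))"
        proof (rule loss_chain[OF sh])
          show "vord b x = 1 * 3 ^ tt x" if "x \<in># {#x \<in># S1. dd x = 1#}" for x using that td(2)[of x] by simp
          show "1 / real (1 * 3 ^ t) \<le> f (sum_mset T)"
            if "T \<subseteq># {#x \<in># S1. dd x = 1#}" "T \<noteq> {#}" "nul ?a (sum_mset T)" "\<And>x. x \<in># T \<Longrightarrow> vord b x dvd 1 * 3 ^ t" for t T
            using that by (intro g) (auto intro: sub)
          have "{#x \<in># {#x \<in># S1. dd x = 1#}. vord b x = 1#} = C 1"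
            unfolding C_def using key1 by (intro multiset_eqI) auto
          then show "L = xnum ?a {#x \<in># {#x \<in># S1. dd x = 1#}. vord b x = 1#}" by (simp add: LP)
          show "L \<le> u" using L(2) by simp
        qed simp_all
        have l2: "loss f {#x \<in># S1. dd x = q#} (sq / real q + (u - sq) / real (q * 3))"
        proof (rule loss_chain[OF sh])
          show "vord b x = q * 3 ^ tt x" if "x \<in># {#x \<in># S1. dd x = q#}" for x using that td(2)[of x] by simp
          show "1 / real (q * 3 ^ t) \<le> f (sum_mset T)"
            if "T \<subseteq># {#x \<in># S1. dd x = q#}" "T \<noteq> {#}" "nul ?a (sum_mset T)" "\<And>x. x \<in># T \<Longrightarrow> vord b x dvd q * 3 ^ t" for t T
            using that q(2) by (intro g) (auto intro: sub)
          have "{#x \<in># {#x \<in># S1. dd x = q#}. vord b x = q#} = C q"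
            unfolding C_def using keyd[OF q(3)] by (intro multiset_eqI) auto
          then show "sq = xnum ?a {#x \<in># {#x \<in># S1. dd x = q#}. vord b x = q#}" by (simp add: sq_def)
          show "sq \<le> u" unfolding sq_def using q(2) by (intro sd) simp
          show "q > 0" using q(2) by simp
        qed simp_all
        have "loss f S1 (u * rho n - u / real q + (L / real 1 + (u - L) / real (1 * 3)) + (sq / real q + (u - sq) / real (q * 3)))"
          using loss_union[OF loss_union[OF l0 l1] l2] K1 by simp
        moreover have "u * rho n - u / real q + (L / real 1 + (u - L) / real (1 * 3)) + (sq / real q + (u - sq) / real (q * 3)) \<le> u + rho n - \<kappa>"
        proof -
          have 1: "sq * y \<le> (u - L) * y" using sq y by (intro mult_right_mono) auto
          have "1 / 2 * (1 - y) \<le> (u - L) * (1 - y)" using L(2) y by (intro mult_right_mono) auto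
          then have 2: "1 / 2 * (1 - y) \<le> u - L - (u - L) * y" by (simp add: algebra_simps)
          have e: "u / real q = u * y" "sq / real q = sq * y" "(u - sq) / real (q * 3) = (u * y - sq * y) / 3"
            by (auto simp: y_def diff_divide_distrib)
          have "\<kappa> \<le> 1 / 3 + 1 / 3 * y" using \<kappa>(2) by (simp add: y_def)
          then show ?thesis unfolding e num by (rule two_three_arith2[OF _ 1 2 uR])
        qed
        ultimately show ?thesis by (rule loss_mono)
      qed
    qed
    then show ?thesis by blast
  qed
qed

lemma (in coprime_moduli) xnum_ab_le: "xnum ab U \<le> xnum b U"
proof (induction U)
  case (add x U)
  have "vord b x \<le> vord ab x" using vord_pos[OF a, of x] by (simp add: vord_ab Suc_leI)
  then have "1 / real (vord ab x) \<le> 1 / real (vord b x)"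
    using vord_pos[OF b, of x] by (intro divide_left_mono) auto
  then show ?case using add by simp
qed simp

text \<open>With \<open>R = \<rho>(q\<^sup>e n)\<close>, \<open>peel\<close> applies if \<open>R \<le> 1 / 3\<close>. Otherwise \<open>q\<close> is \<open>5\<close> or \<open>7\<close>, and the bound \<open>2\<close> on the abundancy
  gives \<open>R \<le> 1 / 2\<close>, and \<open>R \<le> 5 / 13\<close> if \<open>A \<ge> 2\<close>. The losses from \<open>two_three_core\<close> are small enough, unless \<open>A = 1\<close> and
  \<open>q = 5\<close>. In that case the missing amount of at most \<open>1 / 10\<close> comes from the elements of order \<open>3\<close>: two of them in \<open>S\<close>
  allow to pass to the quotient by the group of order \<open>3\<close>; an amalgamated one carries much more weight than is
  credited to it; and if there is at most one, the amalgamated sequence obeys a better bound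
  by \<open>peel_core\<close> for the prime \<open>3\<close>.\<close>

theorem two_three:
  assumes c: "moduli c" and cn: "\<And>k. c k dvd q ^ e * n" and q: "prime q" "q \<ge> 5" and n: "n > 0"
    and cops: "coprime q n" "coprime 2 (q ^ e * n)" "coprime 3 (q ^ e * n)" and e: "e \<ge> 1" and A: "A \<ge> 1"
    and Bc: "cross_bound c B" and B3: "cross_bound (mprod (cyc j (3 ^ A)) c) (B + 1 - 1 / real (3 ^ A))"
    and B2: "\<And>m. cross_bound (mprod (cyc i (2 ^ m)) c) (B + 1 - 1 / real (2 ^ m))"
    and abund: "abundancy (3 ^ A) * abundancy (q ^ e * n) \<le> 2" and rn: "rho n \<le> 1 / (real q - 1)"
  shows "cross_bound (mprod (cyc i (2 ^ m)) (mprod (cyc j (3 ^ A)) c))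
    (B + 1 - 1 / real (3 ^ A) + 1 - 1 / real (2 ^ m))"
proof -
  let ?c3 = "cyc j (3 ^ A)" and ?N = "q ^ e * n"
  let ?b = "mprod ?c3 c"
  define R where "R = rho ?N"
  have N0: "?N > 0" using n q by simp
  have c3: "coprime 3 (c k)" and c2: "coprime 2 (c k)" for k
    using cops cn by (meson coprime_divisors dvd_refl)+
  have p3: "prime (3::nat)" by simp
  interpret c3: coprime_moduli ?c3 c by (rule coprime_moduli_cyc[OF p3 c c3])
  have mb: "moduli ?b" by simp
  have bN: "?b k dvd 3 ^ A * ?N" for k
    unfolding mprod_def by (rule mult_dvd_mono[OF _ cn]) (simp add: cyc_def)
  have b2: "coprime 2 (?b k)" for k
    unfolding mprod_def using c2[of k] by (simp add: cyc_def)
  have hN: "abundancy ?N = 1 + R" using abundancy_rho[OF N0] by (simp add: R_def)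
  have R0: "0 \<le> R" by (simp add: R_def)
  have "4 / 3 \<le> abundancy (3 ^ A)" using abundancy_prime_dvd[OF p3, of "3 ^ A"] A by simp
  then have "4 / 3 * (1 + R) \<le> abundancy (3 ^ A) * (1 + R)" using R0 by (intro mult_right_mono) auto
  then have R2: "R \<le> 1 / 2" using abund hN by simp
  have R13: "R \<le> 5 / 13" if "A \<noteq> 1"
  proof -
    \<comment> \<open>The abundancy of \<open>9\<close> is \<open>13 / 9\<close>, and \<open>5 / 13 = 18 / 13 - 1\<close>.\<close>
    have "abundancy (3 ^ 2) \<le> abundancy (3 ^ A)" using A that by (intro abundancy_mono le_imp_power_dvd) auto
    then have "13 / 9 \<le> abundancy (3 ^ A)" unfolding abundancy_prime_power[OF p3] by simp
    then have "13 / 9 * (1 + R) \<le> abundancy (3 ^ A) * (1 + R)" using R0 by (intro mult_right_mono) auto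
    then show ?thesis using abund hN by simp
  qed
  show ?thesis
  proof (cases "R \<le> 1 / 3")
    case True
    show ?thesis
    proof (rule peel[OF two_is_prime_nat mb B3 bN _ p3 N0])
      show "coprime 2 (3 ^ A * ?N)" using cops(2) by simp
      show "real 2 * real 3 * rho ?N \<le> real 3 - 1" using True by (simp add: R_def)
    qed
  next
    case False
    have q57: "q = 5 \<or> q = 7"
    proof -
      \<comment> \<open>For \<open>q \<ge> 8\<close> the abundancy of \<open>q\<^sup>e n\<close> is at most \<open>(8 / 7)\<^sup>2\<close>, which is less than \<open>4 / 3\<close>.\<close>
      have "q < 8"
      proof (rule ccontr)
        assume "\<not> q < 8"
        then have "1 / (real q - 1) \<le> 1 / 7" by (simp add: field_simps)
        then have "abundancy (q ^ e) \<le> 8 / 7" "abundancy n \<le> 8 / 7"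
          using abundancy_prime_power_bound[OF q(1), of e] rn abundancy_rho[OF n] by auto
        then have "abundancy (q ^ e) * abundancy n \<le> 8 / 7 * (8 / 7)"
          using abundancy_rho[OF n] by (intro mult_mono) auto
        moreover have "abundancy ?N = abundancy (q ^ e) * abundancy n" using cops(1) n q by (intro abundancy_mult) auto
        ultimately show False using False hN by simp
      qed
      moreover have "q \<noteq> 6" using q(1) by auto
      ultimately show ?thesis using q(2) by auto
    qed
    have R7: "R \<le> 13 / 36" if "q = 7"
    proof -
      have "abundancy (q ^ e) \<le> 7 / 6" "abundancy n \<le> 7 / 6"
        using abundancy_prime_power_bound[OF q(1), of e] rn abundancy_rho[OF n] that by auto
      then have "abundancy (q ^ e) * abundancy n \<le> 7 / 6 * (7 / 6)"
        using abundancy_rho[OF n] by (intro mult_mono) auto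
      moreover have "abundancy ?N = abundancy (q ^ e) * abundancy n" using cops(1) n q by (intro abundancy_mult) auto
      ultimately show ?thesis using hN by simp
    qed
    show ?thesis
    proof (rule peel_frame[OF two_is_prime_nat mb b2 B3])
      fix m S
      let ?a = "cyc i (2 ^ Suc m)"
      assume S: "zs_free (mprod ?a ?b) S" and dense: "dense (mprod ?a ?b) S"
        and L: "xnum ?a {#x \<in># S. nul ?b x#} \<le> 1 - 1 / real (2 ^ Suc m) - 1 / real 2"
      define u where "u = 1 - 1 / real (2 ^ Suc m)"
      have u01: "0 \<le> u" "u \<le> 1" by (simp_all add: u_def del: power_Suc)
      have cm: "coprime_moduli ?a ?b" by (rule coprime_moduli_cyc[OF two_is_prime_nat mb b2])
      interpret coprime_moduli ?a ?b by fact
      define S0 where "S0 = {#x \<in># S. nul ?a x#}"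
      define S1 where "S1 = {#x \<in># S. \<not> nul ?a x#}"
      have S01: "S = S0 + S1" by (simp add: S0_def S1_def)
      let ?f = "\<lambda>z. 1 / real (vord ?b z)"
      have l0: "loss ?f S0 0" by (rule loss_nul) (simp add: S0_def)
      have conclude: "xnum ab S \<le> B + 1 - 1 / real (3 ^ A) + u" if "loss ?f S1 X" "X \<le> u" for X
        using loss_bound[OF B3 S, of X] loss_union[OF l0 that(1)] that(2) S01 by simp
      let ?L = "xnum ?a {#x \<in># S. nul ?b x#}"
      have qN: "q dvd ?N" using e by (simp add: dvd_power)
      have uR: "u * R \<le> R" "u * R \<le> u" using u01 R0 R2 by (auto intro: mult_left_le_one_le mult_left_le)
      from two_three_core[OF cm bN N0 cops(3) cops(2) A q qN S dense u_def refl _ S1_def]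
      consider (E3) "loss ?f S1 (?L + (if A = 1 then 0 else u / 9) + u * rho ?N)" |
        (nE3) "\<And>f \<kappa>. (\<And>T D. T \<subseteq># S1 \<Longrightarrow> T \<noteq> {#} \<Longrightarrow> nul ?a (sum_mset T) \<Longrightarrow>
         (\<forall>x\<in>#T. vord ?b x dvd D) \<Longrightarrow> D > 0 \<Longrightarrow> (\<exists>x\<in>#T. \<not> vord ?b x dvd 3) \<Longrightarrow>
         1 / real D \<le> f (sum_mset T)) \<Longrightarrow>
         \<kappa> \<le> 5 / 18 + 2 / (3 * real q) \<Longrightarrow> \<kappa> \<le> 1 / 3 + 1 / (3 * real q) \<Longrightarrow>
         loss f S1 (u + rho ?N - \<kappa>)"
        using L unfolding u_def[symmetric] by (simp only: of_nat_numeral) blast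
      then show "xnum ab S \<le> B + 1 - 1 / real (3 ^ A) + 1 - 1 / real (2 ^ Suc m)"
      proof cases
        case E3
        have "?L + (if A = 1 then 0 else u / 9) + u * R \<le> u"
          using L R2 R13 uR(1) u01 unfolding u_def[symmetric] by auto
        then show ?thesis using conclude[OF E3[folded R_def]] by (simp add: u_def)
      next
        case nE3
        have gain: "1 / real D \<le> ?f (sum_mset T)" if "\<forall>x\<in>#T. vord ?b x dvd D" "D > 0" for T D
          using that by (intro gain_vord vord_sum_mset_dvd[OF mb]) auto
        show ?thesis
        proof (cases "A \<noteq> 1 \<or> q = 7")
          case True
          \<comment> \<open>The smaller bound for \<open>\<kappa>\<close> is \<open>5 / 18 + 2 / 21 = 47 / 126\<close> if \<open>q = 7\<close>, and \<open>1 / 3 + 1 / 15 = 2 / 5\<close> if \<open>q = 5\<close>.\<close>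
          have "loss ?f S1 (u + rho ?N - (if q = 7 then 47 / 126 else 2 / 5))"
            by (rule nE3) (use gain q57 in auto)
          moreover have "u + R - (if q = 7 then 47 / 126 else 2 / 5) \<le> u"
            using True R13 R7 q57 by auto
          ultimately show ?thesis using conclude by (force simp: u_def R_def)
        next
          case False
          then have A1: "A = 1" and q5: "q = 5" using q57 by auto
          have mac: "moduli (mprod ?a c)" and cac: "coprime 3 (mprod ?a c k)" for k
          proof -
            interpret ac: coprime_moduli ?a c by (rule coprime_moduli_cyc[OF two_is_prime_nat c c2])
            show "moduli (mprod ?a c)" by (rule ac.moduli_ab)
            show "coprime 3 (mprod ?a c k)" unfolding mprod_def using c3[of k] by (simp add: cyc_def)
          qed
          have cm3: "coprime_moduli (cyc j (3 ^ k)) (mprod ?a c)" for k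
            by (rule coprime_moduli_cyc[OF p3 mac cac])
          interpret t: coprime_moduli "cyc j (3 ^ Suc 0)" "mprod ?a c" by (rule cm3)
          have ab_t: "ab = t.ab" unfolding A1 by (simp add: mprod_left_commute)
          have nulac: "nul (mprod ?a c) x \<longleftrightarrow> nul ?a x \<and> nul c x" for x
            by (rule coprime_moduli.nul_ab, rule coprime_moduli_cyc[OF two_is_prime_nat c c2])
          \<comment> \<open>The terms of order \<open>3\<close> in the full group.\<close>
          define O3 where "O3 = {#x \<in># S. nul ?a x \<and> nul c x#}"
          have v3: "vord (cyc j 3) x = 3" if "\<not> nul (cyc j 3) x" for x
          proof -
            have "vord (cyc j 3) x dvd 3" by (rule vord_dvdI[OF moduli_cyc]) (auto simp: cyc_def)
            moreover have "vord (cyc j 3) x \<noteq> 1" using that vord_eq_1_iff[of "cyc j 3" x] by simp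
            ultimately show ?thesis using p3 unfolding prime_nat_iff by blast
          qed
          have O3v: "vord (cyc j 3) x = 3" if "x \<in># O3" for x
          proof (rule v3)
            have "\<not> nul t.ab x" using zs_free_not_nul[OF S[unfolded ab_t]] that by (simp add: O3_def)
            then show "\<not> nul (cyc j 3) x" using that unfolding t.nul_ab nulac by (simp add: O3_def)
          qed
          show ?thesis
          proof (cases "size O3 \<ge> 2")
            case True
            then obtain Y where Y: "Y \<subseteq># O3" "size Y = 2" using mset_subset_of_size by blast
            have YS: "Y \<subseteq># S" using Y(1) multiset_filter_subset subset_mset.order_trans unfolding O3_def by blast
            have Yp: "nul (mprod ?a c) y \<and> vord (cyc j (3 ^ Suc 0)) y = 3" if "y \<in># Y" for y
              using mset_subset_eqD[OF Y(1) that] O3v nulac by (auto simp: O3_def)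
            have "zs_free (mprod (cyc j (3 ^ 0)) (mprod ?a c)) (S - Y)"
              by (rule quotient_full[OF cm3 p3 S[unfolded ab_t] YS _ Yp]) (use Y in auto)
            moreover have "mprod (cyc j (3 ^ 0)) (mprod ?a c) = mprod ?a c" by (auto simp: mprod_def cyc_def)
            ultimately have "zs_free (mprod ?a c) (S - Y)" by simp
            then have "xnum (mprod ?a c) (S - Y) \<le> B + 1 - 1 / real (2 ^ Suc m)"
              using B2[of "Suc m"] unfolding cross_bound_def by blast
            moreover have "xnum ab (S - Y) \<le> xnum (mprod ?a c) (S - Y)" unfolding ab_t by (rule t.xnum_ab_le)
            moreover have "xnum ab Y = 2 / 3"
            proof -
              have "vord ab y = 3" if "y \<in># Y" for y
                using Yp[OF that] vord_eq_1_iff[OF mac, of y] unfolding ab_t t.vord_ab by simp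
              then show ?thesis unfolding xnum_def using Y(2) by (simp cong: image_mset_cong)
            qed
            ultimately show ?thesis using xnum_diff[OF YS, of ab] A1 by simp
          next
            case O3: False
            \<comment> \<open>Sums of order \<open>3\<close> that involve another order have \<open>D \<ge> 15\<close>, so a credit of \<open>1 / 15\<close> is enough for them;
              their weight \<open>1 / 3\<close> exceeds it by \<open>4 / 15\<close>.\<close>
            define f where "f = (\<lambda>z. if vord ?b z = 3 then 1 / 15 else 1 / real (vord ?b z))"
            have "loss f S1 (u + rho ?N - 2 / 5)"
            proof (rule nE3)
              fix T D
              assume T: "\<forall>x\<in>#T. vord ?b x dvd D" "D > 0" "\<exists>x\<in>#T. \<not> vord ?b x dvd 3"
              show "1 / real D \<le> f (sum_mset T)"
              proof (cases "vord ?b (sum_mset T) = 3")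
                case True
                have d3: "3 dvd D" using vord_sum_mset_dvd[OF mb, of T D] T(1) True by auto
                obtain x where x: "x \<in># T" "\<not> vord ?b x dvd 3" using T(3) by blast
                have v: "vord ?b x dvd 3 ^ 1 * ?N" using vord_dvdI[OF mb bN] A1 by simp
                then obtain t d where td: "d dvd ?N" "vord ?b x = d * 3 ^ t"
                  using dvd_prime_power_mult[OF p3] by blast
                have cd: "coprime 3 d" "coprime 2 d" using td(1) cops(2,3) by (meson coprime_divisors dvd_refl)+
                have "3 ^ t dvd 3 * ?N" using v unfolding td(2) by (metis dvd_mult_right power_one_right)
                moreover have "coprime (3 ^ t) ?N" using cops(3) unfolding coprime_power_left_iff by blast
                ultimately have "3 ^ t dvd (3::nat)" by (simp add: coprime_dvd_mult_left_iff)
                then have "d \<noteq> 1" using x(2) td(2) by auto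
                moreover have "d \<noteq> 0" using td(1) N0 by (metis dvd_0_left_iff neq0_conv)
                moreover have "d \<noteq> 2" "d \<noteq> 3" "d \<noteq> 4" using cd by auto
                ultimately have "d \<ge> 5" by linarith
                moreover have "d dvd D" using T(1) x(1) td(2) by (metis dvd_mult_left)
                then have "3 * d dvd D" using d3 cd(1) by (simp add: divides_mult)
                ultimately have "D \<ge> 15" using T(2) by (auto dest!: dvd_imp_le)
                then show ?thesis using True by (simp add: f_def field_simps)
              qed (use gain[OF T(1,2)] in \<open>simp add: f_def\<close>)
            qed (use q5 in auto)
            then obtain F where F: "zs_family ?a S1 F" "xnum ab S1 \<le> (\<Sum>T\<in>#F. f (sum_mset T)) + (u + R - 2 / 5)"
              unfolding loss_def R_def by blast
            have ff: "f z \<le> ?f z" for z by (simp add: f_def)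
            show ?thesis
            proof (cases "\<exists>T\<in>#F. vord ?b (sum_mset T) = 3")
              case True
              then obtain T F' where T: "F = add_mset T F'" "vord ?b (sum_mset T) = 3"
                by (metis multi_member_split)
              have "(\<Sum>T\<in>#F'. f (sum_mset T)) \<le> (\<Sum>T\<in>#F'. ?f (sum_mset T))" by (intro sum_mset_mono ff)
              then have "(\<Sum>T\<in>#F. f (sum_mset T)) \<le> (\<Sum>T\<in>#F. ?f (sum_mset T)) - 4 / 15"
                using T by (simp add: f_def)
              then have "loss ?f S1 (u + R - 2 / 5 - 4 / 15)"
                unfolding loss_def using F by (intro exI[of _ F]) simp
              then show ?thesis using conclude R2 by (force simp: u_def)
            next
              case False
              define Z where "Z = S0 + image_mset sum_mset F"
              let ?F0 = "image_mset (\<lambda>x. {#x#}) S0"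
              have "zs_family ?a S0 ?F0" by (auto simp: zs_family_def S0_def)
              then have "zs_family ?a S (?F0 + F)" unfolding S01 using F(1) by (rule zs_family_union)
              then have "zs_free ?b (image_mset sum_mset (?F0 + F))" by (rule zs_free_amalgamate[OF S])
              then have zZ: "zs_free ?b Z" by (simp add: Z_def multiset.map_comp comp_def)
              have "f (sum_mset T) = ?f (sum_mset T)" if "T \<in># F" for T using False that by (auto simp: f_def)
              then have "(\<Sum>T\<in>#F. f (sum_mset T)) = xnum ?b (image_mset sum_mset F)"
                unfolding xnum_def by (simp add: multiset.map_comp comp_def cong: image_mset_cong)
              moreover have "xnum ab S0 \<le> xnum ?b S0" by (rule xnum_ab_le)
              ultimately have 1: "xnum ab S \<le> xnum ?b Z + (u + R - 2 / 5)"
                using F(2) by (simp add: S01 Z_def)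
              define L' where "L' = xnum ?c3 {#z \<in># Z. nul c z#}"
              have 2: "xnum ?b Z \<le> B + L' + (1 - 1 / real (3 ^ A) - L') / real q + (1 - 1 / real (3 ^ A)) * rho n"
                by (rule peel_core[OF c3.coprime_moduli_axioms p3 cn q(1) n Bc zZ]) (simp add: L'_def)
              have "{#z \<in># Z. nul c z#} = O3"
              proof -
                have "\<not> nul c z" if z: "z \<in># image_mset sum_mset F" for z
                proof
                  assume nc: "nul c z"
                  have "z \<in># Z" using z by (simp add: Z_def)
                  then have "\<not> nul ?c3 z" using zs_free_not_nul[OF zZ] nc c3.nul_ab by blast
                  then have "vord ?b z = 3" using v3[of z] nc vord_eq_1_iff[OF c, of z] c3.vord_ab[of z] A1
                    by simp
                  then show False using False z by auto
                qed
                then have "{#z \<in># image_mset sum_mset F. nul c z#} = {#}"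
                  by (intro multiset_eqI) (auto simp: not_in_iff[symmetric])
                then show ?thesis unfolding Z_def O3_def S0_def by (simp add: filter_filter_mset conj_commute)
              qed
              then have "L' = (\<Sum>x\<in>#O3. 1 / real (vord (cyc j 3) x))" by (simp add: L'_def xnum_def A1)
              also have "\<dots> = real (size O3) / 3" using O3v by (simp cong: image_mset_cong)
              finally have "L' \<le> 1 / 3" using O3 by simp
              moreover have "xnum ?b Z \<le> B + L' + (2 / 3 - L') / 5 + 2 / 3 * rho n" using 2 by (simp add: A1 q5)
              moreover have "rho n \<le> 1 / 4" using rn q5 by simp
              ultimately have "xnum ab S \<le> B + 2 / 3 + u" using 1 R2 by argo
              then show ?thesis by (simp add: u_def A1)
            qed
          qed
        qed
      qed
    qed
  qed
qed

section \<open>Peeling off all the cyclic parts\<close>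

locale wide_tails =
  fixes r s \<alpha>' :: nat and p \<alpha> :: "nat \<Rightarrow> nat"
  assumes r: "r \<ge> 2" and pr: "\<And>i. i \<in> {1..r} \<Longrightarrow> prime (p i)" and inj: "inj_on p {1..r}"
    and le: "\<alpha> (r - 1) \<ge> \<alpha>'"
    and w: "\<And>i. 1 \<le> i \<Longrightarrow> i \<le> r - 2 \<Longrightarrow> wide (p i) (tail_exponent r p \<alpha> i)"
begin

text \<open>Coordinates \<open>1, \<dots>, r - 1\<close> carry the summands of the primes with these indices, coordinate \<open>r\<close> carries the
  second summand for \<open>p\<^sub>r\<^sub>-\<^sub>1\<close>, and the next \<open>s\<close> coordinates carry the summands of order \<open>p\<^sub>r\<close>.\<close>

definition base_moduli where
  "base_moduli = mprod (cyc2 (r - 1) (p (r - 1) ^ \<alpha> (r - 1)) r (p (r - 1) ^ \<alpha>'))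
     (\<lambda>k. if k \<in> {r + 1..r + s} then p r else 1)"

text \<open>The direct sum without the summands for \<open>p\<^sub>1, \<dots>, p\<^sub>i\<close>.\<close>

definition tail_moduli where
  "tail_moduli i = (\<lambda>k. if i < k \<and> k \<le> r - 2 then p k ^ \<alpha> k else base_moduli k)"

definition tail_bound where
  "tail_bound i = 2 - 1 / real (p (r - 1) ^ \<alpha> (r - 1)) - 1 / real (p (r - 1) ^ \<alpha>') + real s * (1 - 1 / real (p r))
     + (\<Sum>j\<in>{i<..r - 2}. 1 - 1 / real (p j ^ \<alpha> j))"

lemma prr: "prime (p r)" "prime (p (r - 1))" "p (r - 1) \<noteq> p r"
  using pr r inj by (auto dest: inj_onD)

lemma base_moduli_eq: "base_moduli k = (if k = r - 1 then p (r - 1) ^ \<alpha> (r - 1) else if k = r then p (r - 1) ^ \<alpha>'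
    else if k \<in> {r + 1..r + s} then p r else 1)"
  using r by (auto simp: base_moduli_def mprod_def cyc2_def)

lemma tail_moduli_pos: "tail_moduli i k > 0"
proof -
  have "prime (p k)" if "i < k" "k \<le> r - 2" using that by (intro pr) auto
  then show ?thesis using prr prime_gt_0_nat by (auto simp: tail_moduli_def base_moduli_eq)
qed

lemma moduli_tail_moduli: "moduli (tail_moduli i)"
proof -
  have "tail_moduli i k = 1" if "k > r + s" for k
  proof -
    have "k \<noteq> r - 1" "k \<noteq> r" "\<not> k \<le> r - 2" "k \<notin> {r + 1..r + s}" using that by auto
    then show ?thesis by (simp add: tail_moduli_def base_moduli_eq)
  qed
  then have "{k. tail_moduli i k \<noteq> 1} \<subseteq> {..r + s}" by (metis (mono_tags) atMost_iff linorder_not_less mem_Collect_eq subsetI)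
  then have "finite {k. tail_moduli i k \<noteq> 1}" by (rule finite_subset) simp
  then show ?thesis unfolding moduli_def using tail_moduli_pos by simp
qed

lemma tail_moduli_dvd: "i \<le> r - 2 \<Longrightarrow> tail_moduli i k dvd tail_exponent r p \<alpha> i"
proof -
  assume i: "i \<le> r - 2"
  have *: "p j ^ \<alpha> j dvd tail_exponent r p \<alpha> i" if "j \<in> {i + 1..r - 1}" for j
    unfolding tail_exponent_def using that by (intro dvd_mult2 dvd_prodI) auto
  have "p (r - 1) ^ \<alpha>' dvd p (r - 1) ^ \<alpha> (r - 1)" using le by (rule le_imp_power_dvd)
  moreover have "r - 1 \<in> {i + 1..r - 1}" using i r by auto
  ultimately have **: "p (r - 1) ^ \<alpha>' dvd tail_exponent r p \<alpha> i" using * dvd_trans by blast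
  have "p r dvd tail_exponent r p \<alpha> i" by (simp add: tail_exponent_def)
  then show ?thesis using * ** i r by (auto simp: tail_moduli_def base_moduli_eq)
qed

lemma tail_moduli_peel:
  assumes "1 \<le> i" "i \<le> r - 2"
  shows "tail_moduli (i - 1) = mprod (cyc i (p i ^ \<alpha> i)) (tail_moduli i)"
proof
  fix k
  have "base_moduli i = 1" using assms by (auto simp: base_moduli_eq)
  moreover have "i - 1 < k \<longleftrightarrow> i < k \<or> k = i" using assms by auto
  ultimately show "tail_moduli (i - 1) k = mprod (cyc i (p i ^ \<alpha> i)) (tail_moduli i) k"
    using assms by (auto simp: tail_moduli_def mprod_def cyc_def)
qed

lemma tail_bound_peel:
  assumes "1 \<le> i" "i \<le> r - 2"
  shows "tail_bound (i - 1) = tail_bound i + 1 - 1 / real (p i ^ \<alpha> i)"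
proof -
  have "{i - 1<..r - 2} = insert i {i<..r - 2}" using assms by auto
  then show ?thesis by (simp add: tail_bound_def)
qed

text \<open>Summands with exponent \<open>0\<close> may be left out.\<close>

lemma skip_trivial:
  assumes "i < k" "k \<le> r - 2" "\<And>j. i < j \<Longrightarrow> j < k \<Longrightarrow> \<alpha> j = 0"
  shows "tail_moduli i = mprod (cyc k (p k ^ \<alpha> k)) (tail_moduli k)" "tail_bound i = tail_bound k + 1 - 1 / real (p k ^ \<alpha> k)"
proof -
  have "tail_moduli i j = tail_moduli (k - 1) j" for j
  proof (cases "i < j \<and> j < k")
    case True
    then have "\<alpha> j = 0" using assms by blast
    moreover have "base_moduli j = 1" using True assms by (auto simp: base_moduli_eq)
    ultimately show ?thesis using True assms by (auto simp: tail_moduli_def)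
  next
    case False
    then show ?thesis using assms by (auto simp: tail_moduli_def)
  qed
  then have "tail_moduli i = tail_moduli (k - 1)" by blast
  then show "tail_moduli i = mprod (cyc k (p k ^ \<alpha> k)) (tail_moduli k)" using tail_moduli_peel[of k] assms by simp
  have "(\<Sum>j\<in>{i<..r - 2}. 1 - 1 / real (p j ^ \<alpha> j)) = (\<Sum>j\<in>{k - 1<..r - 2}. 1 - 1 / real (p j ^ \<alpha> j))"
    by (rule sum.mono_neutral_right) (use assms in auto)
  then have "tail_bound i = tail_bound (k - 1)" by (simp add: tail_bound_def)
  then show "tail_bound i = tail_bound k + 1 - 1 / real (p k ^ \<alpha> k)" using tail_bound_peel[of k] assms by simp
qed

lemma cross_bound_last: "cross_bound (tail_moduli (r - 2)) (tail_bound (r - 2))"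
proof -
  have "tail_moduli (r - 2) = base_moduli" by (auto simp: tail_moduli_def)
  then show ?thesis
    using cross_bound_base[OF prr(2,1,3) _ le, of "r - 1" r "{r + 1..r + s}"] r
    by (simp add: base_moduli_def tail_bound_def)
qed

lemma consecutive_primes:
  fixes a b :: nat
  assumes "prime a" "prime b" "b = a + 1"
  shows "a = 2" "b = 3"
proof -
  have "even a \<or> even b" using assms(3) by auto
  then have "a = 2 \<or> b = 2" using assms(1,2) by (metis primes_dvd_imp_eq two_is_prime_nat)
  then show "a = 2" "b = 3" using assms prime_ge_2_nat by fastforce+
qed

text \<open>Besides the exceptional \<open>p i = 3\<close>, \<open>N = 2\<close>, where \<open>n = 1\<close> and \<open>\<rho>(n) = 0\<close>, \<open>tail_exponent_split\<close> gives the prime \<open>q\<close>, and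
  \<open>q \<ge> p i + 2\<close> unless \<open>p i = 2\<close>, \<open>q = 3\<close>. For \<open>2\<close> and \<open>3\<close> followed by a power of a single prime \<open>l \<ge> 5\<close> the estimate
  \<open>\<rho>(n) \<le> 1 / 4\<close> is good enough; for a longer tail, \<open>two_three\<close> adds both primes on top of the tail after \<open>3\<close>.\<close>

lemma cross_bound_step:
  assumes i: "1 \<le> i" "i \<le> r - 2" and IH: "\<And>k. i \<le> k \<Longrightarrow> k \<le> r - 2 \<Longrightarrow> cross_bound (tail_moduli k) (tail_bound k)"
  shows "cross_bound (tail_moduli (i - 1)) (tail_bound (i - 1))"
proof -
  let ?N = "tail_exponent r p \<alpha>"
  have pi: "prime (p i)" using pr i by auto
  note wi = w[OF i]
  have Bi: "cross_bound (tail_moduli i) (tail_bound i)" using IH i by auto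
  have dN: "tail_moduli i k dvd ?N i" for k using i(2) by (rule tail_moduli_dvd)
  have cp: "coprime (p i) (?N i)" using pi wideD(3)[OF wi] by (rule prime_imp_coprime)
  have "cross_bound (mprod (cyc i (p i ^ \<alpha> i)) (tail_moduli i)) (tail_bound i + 1 - 1 / real (p i ^ \<alpha> i))"
  proof (cases "p i = 3 \<and> ?N i = 2")
    case True
    show ?thesis
      by (rule peel[OF pi moduli_tail_moduli Bi, of 2 1 1]) (use True dN cp in auto)
  next
    case False
    from tail_exponent_split[OF r pr inj w i False] obtain q A n where
      q: "prime q" "q > p i" and A: "A \<ge> 1" and n: "n > 0" "coprime q n" and N: "?N i = q ^ A * n" and
      alt: "(\<exists>l e. prime l \<and> l > q \<and> n = l ^ e) \<or>
        (\<exists>k. i < k \<and> k \<le> r - 2 \<and> q = p k \<and> A = \<alpha> k \<and> n = ?N k \<and> (\<forall>j. i < j \<and> j < k \<longrightarrow> \<alpha> j = 0))"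
      by blast
    have q1: "real q > 1" using prime_gt_1_nat[OF q(1)] by simp
    have rn: "rho n \<le> 1 / (real q - 1)"
      using alt
    proof (elim disjE exE conjE)
      fix l e assume l: "prime l" "l > q" "n = l ^ e"
      then have "rho n \<le> 1 / (real l - 1)" using abundancy_prime_power_bound[of l e] abundancy_rho[OF n(1)] by simp
      also have "\<dots> \<le> 1 / (real q - 1)" using l q1 by (intro divide_left_mono) auto
      finally show ?thesis .
    next
      fix k assume k: "i < k" "k \<le> r - 2" "q = p k" "n = ?N k"
      then show ?thesis using wide_abundancy[OF w[of k]] abundancy_rho[OF n(1)] i by simp
    qed
    have dqn: "tail_moduli i k dvd q ^ A * n" for k using dN N by simp
    have cqn: "coprime (p i) (q ^ A * n)" using cp N by simp
    show ?thesis
    proof (cases "q \<ge> p i + 2")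
      case True
      have "real (p i) * real q * rho n \<le> (real q - 2) * real q * (1 / (real q - 1))"
        using True rn q1 by (intro mult_mono) auto
      also have "\<dots> \<le> real q - 1" using q1 by (simp add: field_simps)
      finally show ?thesis by (intro peel[OF pi moduli_tail_moduli Bi dqn cqn q(1) n(1)])
    next
      case False
      then have "q = p i + 1" using q(2) by simp
      then have p2: "p i = 2" and q3: "q = 3" using consecutive_primes[OF pi q(1)] by auto
      from alt show ?thesis
      proof (elim disjE exE conjE)
        fix l e assume l: "prime l" "l > q" "n = l ^ e"
        have "l \<noteq> 4" using l(1) by auto
        then have "l \<ge> 5" using l(2) q3 by simp
        have "rho n \<le> 1 / (real l - 1)" using abundancy_prime_power_bound[of l e] abundancy_rho[OF n(1)] l by simp
        also have "\<dots> \<le> 1 / 4" using \<open>l \<ge> 5\<close> by (simp add: field_simps)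
        finally have "real (p i) * real q * rho n \<le> real q - 1" using p2 q3 by simp
        then show ?thesis by (intro peel[OF pi moduli_tail_moduli Bi dqn cqn q(1) n(1)])
      next
        fix k assume k: "i < k" "k \<le> r - 2" "q = p k" "A = \<alpha> k" "n = ?N k"
          "\<forall>j. i < j \<and> j < k \<longrightarrow> \<alpha> j = 0"
        have k1: "1 \<le> k" using k by simp
        have c2n: "coprime 2 n" using cqn p2 by simp
        then have "\<not> (p k = 3 \<and> ?N k = 2)" using k(5) by auto
        from tail_exponent_split[OF r pr inj w k1 k(2) this] obtain q' e n' where
          q': "prime q'" "q' > p k" "e \<ge> 1" "n' > 0" "coprime q' n'" "?N k = q' ^ e * n'" and
          alt': "(\<exists>l e. prime l \<and> l > q' \<and> n' = l ^ e) \<or>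
            (\<exists>k'. k < k' \<and> k' \<le> r - 2 \<and> q' = p k' \<and> e = \<alpha> k' \<and> n' = ?N k')"
          by blast
        have "q' \<noteq> 4" using q'(1) by auto
        then have q5: "q' \<ge> 5" using q'(2) k(3) q3 by simp
        have rn': "rho n' \<le> 1 / (real q' - 1)"
          using alt'
        proof (elim disjE exE conjE)
          fix l e assume l: "prime l" "l > q'" "n' = l ^ e"
          then have "rho n' \<le> 1 / (real l - 1)" using abundancy_prime_power_bound[of l e] abundancy_rho[OF q'(4)] by simp
          also have "\<dots> \<le> 1 / (real q' - 1)" using l q5 by (intro divide_left_mono) auto
          finally show ?thesis .
        next
          fix k' assume k': "k < k'" "k' \<le> r - 2" "q' = p k'" "n' = ?N k'"
          then show ?thesis using wide_abundancy[OF w[of k']] abundancy_rho[OF q'(4)] k1 by simp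
        qed
        note skip = skip_trivial[OF k(1,2)]
        have MB: "tail_moduli i = mprod (cyc k (3 ^ A)) (tail_moduli k)" "tail_bound i = tail_bound k + 1 - 1 / real (3 ^ A)"
          using skip k q3 by auto
        have Bk: "cross_bound (tail_moduli k) (tail_bound k)" using IH[of k] k by auto
        have dk: "tail_moduli k j dvd q' ^ e * n'" for j using tail_moduli_dvd[OF k(2)] q'(6) by simp
        have n'': "n = q' ^ e * n'" using k(5) q'(6) by simp
        have "cross_bound (mprod (cyc i (2 ^ \<alpha> i)) (mprod (cyc k (3 ^ A)) (tail_moduli k)))
            (tail_bound k + 1 - 1 / real (3 ^ A) + 1 - 1 / real (2 ^ \<alpha> i))"
        proof (rule two_three[OF moduli_tail_moduli dk q'(1) q5 q'(4,5) _ _ q'(3) A Bk])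
          show "coprime 2 (q' ^ e * n')" using c2n n'' by simp
          show "coprime 3 (q' ^ e * n')" using n(2) n'' q3 by simp
          show "cross_bound (mprod (cyc k (3 ^ A)) (tail_moduli k)) (tail_bound k + 1 - 1 / real (3 ^ A))" using Bi MB by simp
          show "cross_bound (mprod (cyc i (2 ^ m)) (tail_moduli k)) (tail_bound k + 1 - 1 / real (2 ^ m))" for m
          proof (rule peel[OF two_is_prime_nat moduli_tail_moduli Bk dk _ q'(1,4)])
            show "coprime 2 (q' ^ e * n')" using c2n n'' by simp
            have "real 2 * real q' * rho n' \<le> real 2 * real q' * (1 / (real q' - 1))"
              by (intro mult_left_mono rn') auto
            also have "\<dots> \<le> real q' - 1"
            proof -
              have "4 * (real q' - 1) \<le> (real q' - 1) * (real q' - 1)"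
                using q5 by (intro mult_right_mono) auto
              moreover have "2 * real q' \<le> 4 * (real q' - 1)" using q5 by simp
              ultimately have "2 * real q' \<le> (real q' - 1) * (real q' - 1)" by (rule order_trans[rotated])
              then show ?thesis using q5 by (simp add: pos_divide_le_eq)
            qed
            finally show "real 2 * real q' * rho n' \<le> real q' - 1" .
          qed
          have "abundancy (3 ^ A * n) = abundancy (3 ^ A) * abundancy n" using n q3 by (intro abundancy_mult) auto
          then show "abundancy (3 ^ A) * abundancy (q' ^ e * n') \<le> 2"
            using wide_abundancy[OF wi] N p2 q3 n'' by simp
        qed (rule rn')
        then show ?thesis using MB p2 by simp
      qed
    qed
  qed
  then show ?thesis using tail_moduli_peel[OF i] tail_bound_peel[OF i] by simp
qed

theorem cross_bound_all: "i \<le> r - 2 \<Longrightarrow> cross_bound (tail_moduli i) (tail_bound i)"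
proof (induction "r - 2 - i" arbitrary: i rule: less_induct)
  case less
  show ?case
  proof (cases "i = r - 2")
    case True
    then show ?thesis using cross_bound_last by simp
  next
    case False
    have "cross_bound (tail_moduli (Suc i - 1)) (tail_bound (Suc i - 1))"
    proof (rule cross_bound_step)
      show "cross_bound (tail_moduli k) (tail_bound k)" if "Suc i \<le> k" "k \<le> r - 2" for k
        by (rule less.hyps) (use that less.prems in linarith)+
      show "Suc i \<le> r - 2" using False less.prems by linarith
    qed simp
    then show ?thesis by simp
  qed
qed

end

section \<open>Transfer to abstract groups\<close>

declare zero_fun_apply [simp del]

text \<open>An abstract group together with a homomorphism from the integer vectors onto it whose kernel is given by
  the moduli \<open>m\<close>.\<close>

locale presentation = comm_group G for G (structure) +
  fixes m :: "nat \<Rightarrow> nat" and \<psi> :: "vec \<Rightarrow> 'a"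
  assumes fin: "finite (carrier G)" and m: "moduli m"
    and closed: "\<psi> x \<in> carrier G" and add: "\<psi> (x + y) = \<psi> x \<otimes> \<psi> y"
    and one_iff: "\<psi> x = \<one> \<longleftrightarrow> nul m x" and surj: "carrier G \<subseteq> range \<psi>"
begin

abbreviation supp where "supp \<equiv> {i. m i \<noteq> 1}"

lemma fin_supp: "finite supp" using m by (simp add: moduli_def)

lemma zero: "\<psi> 0 = \<one>" by (simp add: one_iff)

lemma scale: "\<psi> (scale k x) = \<psi> x [^] k"
proof (induction k)
  case 0
  have "scale 0 x = 0" by (auto simp: scale_def zero_fun_def)
  then show ?case by (simp add: zero)
next
  case (Suc k)
  have "scale (Suc k) x = scale k x + x" by (auto simp: scale_def plus_fun_apply algebra_simps)
  then show ?case using Suc by (simp add: add)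
qed

lemma ord: "ord (\<psi> x) = vord m x"
proof -
  have "ord (\<psi> x) dvd k \<longleftrightarrow> vord m x dvd k" for k
    using pow_eq_id[OF closed[of x], of k] nul_scale_iff[OF m, of k x] one_iff[of "scale k x"] by (simp add: scale)
  then show ?thesis by (meson dvd_antisym dvd_refl)
qed

lemma eq_iff: "\<psi> x = \<psi> y \<longleftrightarrow> (\<forall>i. int (m i) dvd x i - y i)"
proof -
  define d where "d = (\<lambda>i. x i - y i)"
  have x: "x = d + y" by (auto simp: d_def plus_fun_apply)
  have "\<psi> x = \<psi> d \<otimes> \<psi> y" unfolding x by (rule add)
  then have "\<psi> x = \<psi> y \<longleftrightarrow> \<psi> d \<otimes> \<psi> y = \<psi> y" by simp
  also have "\<dots> \<longleftrightarrow> \<psi> d = \<one>" using closed by (simp add: r_cancel_one)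
  also have "\<psi> d = \<one> \<longleftrightarrow> nul m d" by (rule one_iff)
  finally show ?thesis by (simp only: nul_def d_def)
qed

text \<open>Adding one labelled term, by which sums and cross numbers of indexed sequences can be computed by
  induction.\<close>

lemma iseq_insert:
  assumes "finite T" "T \<subseteq> (carrier G - {\<one>}) \<times> UNIV" "g \<in> carrier G - {\<one>}" "(g, n) \<notin> T"
  shows "iseq_sum G (insert (g, n) T) = g \<otimes> iseq_sum G T"
    and "cross_number G (insert (g, n) T) = 1 / real (ord g) + cross_number G T"
proof -
  have mult: "iseq_mult h (insert (g, n) T) = (if h = g then 1 else 0) + iseq_mult h T" for h
  proof -
    have f: "finite {k. (h, k) \<in> T}" by (rule finite_subset[of _ "snd ` T"]) (use assms(1) in force)+
    have "{k. (h, k) \<in> insert (g, n) T} = (if h = g then insert n {k. (h, k) \<in> T} else {k. (h, k) \<in> T})"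
      by auto
    then show ?thesis unfolding iseq_mult_def using f assms(4) by (cases "h = g") auto
  qed
  let ?A = "carrier G - {\<one>}"
  have finA: "finite ?A" using fin by simp
  have "iseq_sum G (insert (g, n) T) =
      finprod G (\<lambda>h. (if g = h then h else \<one>) \<otimes> h [^] iseq_mult h T) ?A"
    unfolding iseq_sum_def by (intro finprod_cong') (auto simp: mult nat_pow_mult[symmetric])
  also have "\<dots> = finprod G (\<lambda>h. if g = h then h else \<one>) ?A \<otimes> iseq_sum G T"
    unfolding iseq_sum_def by (rule finprod_multf) auto
  also have "finprod G (\<lambda>h. if g = h then h else \<one>) ?A = g"
    using finprod_singleton[OF assms(3) finA, of "\<lambda>h. h"] by auto
  finally show "iseq_sum G (insert (g, n) T) = g \<otimes> iseq_sum G T" .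
  have "cross_number G (insert (g, n) T) =
      (\<Sum>h\<in>?A. (if h = g then 1 / real (ord h) else 0) + real (iseq_mult h T) / real (ord h))"
    unfolding cross_number_def by (intro sum.cong) (auto simp: mult add_divide_distrib)
  also have "\<dots> = 1 / real (ord g) + cross_number G T"
    unfolding cross_number_def sum.distrib using assms(3) finA by (simp add: sum.delta)
  finally show "cross_number G (insert (g, n) T) = 1 / real (ord g) + cross_number G T" .
qed

text \<open>Choose a vector \<open>\<phi> g\<close> for every \<open>g\<close> and forget the labels.\<close>

definition lift :: "('a \<Rightarrow> vec) \<Rightarrow> ('a \<times> nat) set \<Rightarrow> vec multiset" where
  "lift \<phi> T = image_mset (\<phi> \<circ> fst) (mset_set T)"

lemma iseq_lift:
  assumes "finite T" "T \<subseteq> (carrier G - {\<one>}) \<times> UNIV" "\<And>t. t \<in> T \<Longrightarrow> \<psi> (\<phi> (fst t)) = fst t"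
  shows "iseq_sum G T = \<psi> (sum_mset (lift \<phi> T)) \<and> cross_number G T = xnum m (lift \<phi> T)"
  using assms
proof (induction T rule: finite_induct)
  case empty
  have "iseq_mult h {} = 0" for h :: 'a by (simp add: iseq_mult_def)
  then show ?case by (simp add: lift_def iseq_sum_def cross_number_def zero)
next
  case (insert t T)
  obtain g n where t: "t = (g, n)" by (cases t)
  have g: "g \<in> carrier G - {\<one>}" using insert.prems t by auto
  have \<phi>: "\<psi> (\<phi> g) = g" using insert.prems(2)[of t] t by simp
  have IH: "iseq_sum G T = \<psi> (sum_mset (lift \<phi> T))" "cross_number G T = xnum m (lift \<phi> T)"
    using insert by auto
  have l: "lift \<phi> (insert (g, n) T) = add_mset (\<phi> g) (lift \<phi> T)"
    using insert(1,2) by (simp add: lift_def t)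
  show ?case unfolding t l using iseq_insert[OF insert(1) _ g, of n] insert.prems(1) insert(2) IH \<phi> ord[of "\<phi> g"]
    by (auto simp: add t)
qed

lemma zs_free_lift:
  assumes S: "indexed_sequence G S" "zero_sum_free G S" and \<phi>: "\<And>g. g \<in> carrier G \<Longrightarrow> \<psi> (\<phi> g) = g"
  shows "zs_free m (lift \<phi> S)"
  unfolding zs_free_def
proof (intro allI impI)
  fix T assume T: "T \<subseteq># lift \<phi> S" "nul m (sum_mset T)"
  have fS: "finite S" "S \<subseteq> (carrier G - {\<one>}) \<times> UNIV" using S(1) by (auto simp: indexed_sequence_def)
  obtain C where "lift \<phi> S = T + C" using T(1) by (metis subset_mset.add_diff_inverse)
  then obtain A D where A: "mset_set S = A + D" "T = image_mset (\<phi> \<circ> fst) A"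
    unfolding lift_def by (metis image_mset_eq_plusD)
  define A' where "A' = set_mset A"
  have A'S: "A' \<subseteq> S" 
  proof -
    have "set_mset (mset_set S) = S" using fS(1) by simp
    then show ?thesis unfolding A'_def A(1) by auto
  qed
  have c1: "count A x \<le> 1" for x
  proof -
    have "count A x \<le> count (mset_set S) x" using A(1) by simp
    also have "\<dots> \<le> 1" by (simp add: count_mset_set')
    finally show ?thesis .
  qed
  have "A = mset_set A'"
  proof (rule multiset_eqI)
    fix x show "count A x = count (mset_set A') x"
      using c1[of x] by (cases "x \<in># A") (auto simp: A'_def count_mset_set' not_in_iff intro: le_antisym)
  qed
  then have T': "T = lift \<phi> A'" using A(2) by (simp add: lift_def)
  have sub: "A' \<subseteq> (carrier G - {\<one>}) \<times> UNIV" using A'S fS by blast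
  have "iseq_sum G A' = \<psi> (sum_mset (lift \<phi> A'))"
  proof -
    have "\<psi> (\<phi> (fst t)) = fst t" if "t \<in> A'" for t
    proof (rule \<phi>)
      show "fst t \<in> carrier G" using that sub by auto
    qed
    then show ?thesis using iseq_lift[OF finite_subset[OF A'S fS(1)] sub] by blast
  qed
  then have "iseq_sum G A' = \<one>" using T(2) one_iff T' by simp
  then have "A' = {}" using S(2) A'S unfolding zero_sum_free_def by blast
  then show "T = {#}" by (simp add: T' lift_def)
qed

lemma cross_number_le:
  assumes "cross_bound m B" "indexed_sequence G S" "zero_sum_free G S"
  shows "cross_number G S \<le> B"
proof -
  define \<phi> where "\<phi> = (\<lambda>g. SOME x. \<psi> x = g)"
  have \<phi>: "\<psi> (\<phi> g) = g" if "g \<in> carrier G" for g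
  proof -
    have "g \<in> range \<psi>" using surj that by (rule subsetD)
    then obtain x where "\<psi> x = g" by (elim rangeE) simp
    then show ?thesis unfolding \<phi>_def by (rule someI[of "\<lambda>x. \<psi> x = g"])
  qed
  have fS: "finite S" "S \<subseteq> (carrier G - {\<one>}) \<times> UNIV" using assms(2) by (auto simp: indexed_sequence_def)
  have \<phi>': "\<psi> (\<phi> (fst t)) = fst t" if "t \<in> S" for t
  proof (rule \<phi>)
    show "fst t \<in> carrier G" using that fS(2) by auto
  qed
  have "cross_number G S = xnum m (lift \<phi> S)"
    by (rule conjunct2[OF iseq_lift[OF fS \<phi>']])
  moreover have "zs_free m (lift \<phi> S)" by (rule zs_free_lift[OF assms(2,3) \<phi>])
  ultimately show ?thesis using assms(1) unfolding cross_bound_def by metis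
qed

abbreviation unit :: "nat \<Rightarrow> vec" where "unit i \<equiv> axis 1 i"

lemma vord_unit: "vord m (unit i) = m i"
proof -
  have "vord m (unit i) dvd k \<longleftrightarrow> m i dvd k" for k
  proof -
    have "vord m (unit i) dvd k \<longleftrightarrow> (\<forall>j. int (m j) dvd int k * unit i j)"
      by (simp add: nul_def scale_def flip: nul_scale_iff[OF m])
    also have "\<dots> \<longleftrightarrow> m i dvd k" by (auto simp: axis_def)
    finally show ?thesis .
  qed
  then show ?thesis by (meson dvd_antisym dvd_refl)
qed

lemma inj_unit: "inj_on (\<lambda>i. \<psi> (unit i)) supp"
proof (rule inj_onI)
  fix i j assume i: "i \<in> supp" "j \<in> supp" and e: "\<psi> (unit i) = \<psi> (unit j)"
  show "i = j"
  proof (rule ccontr)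
    assume "i \<noteq> j"
    moreover have "int (m i) dvd unit i i - unit j i" using e unfolding eq_iff by blast
    ultimately show False using i by (simp add: axis_def)
  qed
qed

text \<open>The sequence of \<open>m i - 1\<close> copies of every unit vector: in a zero-sum subsequence, the
  number of occurrences of each of them is divisible by \<open>m i\<close>.\<close>

lemma cross_number_attained:
  "\<exists>S. indexed_sequence G S \<and> zero_sum_free G S \<and> cross_number G S = (\<Sum>i\<in>supp. 1 - 1 / real (m i))"
proof -
  let ?e = "\<lambda>i. \<psi> (unit i)"
  define S where "S = (\<Union>i\<in>supp. {?e i} \<times> {..<m i - 1})"
  define \<phi> where "\<phi> = (\<lambda>g. unit (inv_into supp ?e g))"
  have \<phi>e: "\<phi> (?e i) = unit i" if "i \<in> supp" for i
    unfolding \<phi>_def using inv_into_f_f[OF inj_unit that] by simp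
  have fS: "finite S" unfolding S_def using fin_supp by simp
  have ne: "?e i \<noteq> \<one>" if "i \<in> supp" for i
  proof
    assume "?e i = \<one>"
    then have "nul m (unit i)" by (simp only: one_iff)
    then have "vord m (unit i) = 1" using vord_eq_1_iff[OF m] by blast
    then show False using that by (simp add: vord_unit del: One_nat_def)
  qed
  have sub: "S \<subseteq> (carrier G - {\<one>}) \<times> UNIV" unfolding S_def using closed ne by auto
  have \<phi>: "\<psi> (\<phi> (fst t)) = fst t" if "t \<in> S" for t using that \<phi>e unfolding S_def by auto
  have zs: "zero_sum_free G S"
    unfolding zero_sum_free_def
  proof (rule notI, elim exE conjE)
    fix T assume T: "T \<subseteq> S" "T \<noteq> {}" "iseq_sum G T = \<one>"
    have fT: "finite T" using T(1) fS finite_subset by blast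
    have "\<psi> (sum_mset (lift \<phi> T)) = \<one>" 
    proof -
      have "T \<subseteq> (carrier G - {\<one>}) \<times> UNIV" using T(1) sub by blast
      moreover have "\<psi> (\<phi> (fst t)) = fst t" if "t \<in> T" for t using that T(1) \<phi> by blast
      ultimately show ?thesis using iseq_lift[OF fT, of \<phi>] T(3) by simp
    qed
    then have nul: "nul m (sum_mset (lift \<phi> T))" by (simp add: one_iff)
    obtain t where t: "t \<in> T" using T(2) by blast
    then obtain i where i: "i \<in> supp" "fst t = ?e i" using T(1) unfolding S_def by auto
    define Ti where "Ti = {t \<in> T. fst t = ?e i}"
    have "sum_mset (lift \<phi> T) i = (\<Sum>t\<in>T. \<phi> (fst t) i)"
      unfolding sum_mset_apply lift_def by (simp add: multiset.map_comp comp_def sum_unfold_sum_mset)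
    also have "\<dots> = (\<Sum>t\<in>T. if t \<in> Ti then 1 else 0)"
    proof (rule sum.cong[OF refl])
      fix t assume t: "t \<in> T"
      then obtain j where j: "j \<in> supp" "fst t = ?e j" using T(1) unfolding S_def by auto
      have "fst t = ?e i \<longleftrightarrow> j = i" using j i inj_onD[OF inj_unit] by auto
      then show "\<phi> (fst t) i = (if t \<in> Ti then 1 else 0)"
        using \<phi>e[OF j(1)] j t by (auto simp: Ti_def axis_def)
    qed
    also have "\<dots> = int (card Ti)" using fT by (simp add: Ti_def sum.If_cases Int_def)
    finally have "int (m i) dvd int (card Ti)" using nul unfolding nul_def by metis
    then have "m i dvd card Ti" by simp
    moreover have "card Ti > 0"
    proof -
      have "t \<in> Ti" using t i(2) unfolding Ti_def by blast
      moreover have "finite Ti" using fT unfolding Ti_def by simp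
      ultimately show ?thesis by (metis card_gt_0_iff empty_iff)
    qed
    ultimately have "m i \<le> card Ti" by (rule dvd_imp_le)
    moreover have "Ti \<subseteq> {?e i} \<times> {..<m i - 1}"
    proof
      fix t assume "t \<in> Ti"
      then have "t \<in> S" "fst t = ?e i" using T(1) by (auto simp: Ti_def)
      then obtain j where "j \<in> supp" "t \<in> {?e j} \<times> {..<m j - 1}" "?e j = ?e i" unfolding S_def by auto
      then show "t \<in> {?e i} \<times> {..<m i - 1}" using i(1) inj_onD[OF inj_unit] by auto
    qed
    then have "card Ti \<le> card ({?e i} \<times> {..<m i - 1})" by (intro card_mono) auto
    moreover have "m i > 0" using m by simp
    ultimately show False by (simp add: card_cartesian_product)
  qed
  have "cross_number G S = xnum m (lift \<phi> S)" using iseq_lift[OF fS sub \<phi>] by blast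
  also have "\<dots> = (\<Sum>t\<in>S. 1 / real (vord m (\<phi> (fst t))))"
    unfolding xnum_def lift_def by (simp add: multiset.map_comp comp_def sum_unfold_sum_mset)
  also have "\<dots> = (\<Sum>i\<in>supp. \<Sum>t\<in>{?e i} \<times> {..<m i - 1}. 1 / real (vord m (\<phi> (fst t))))"
    unfolding S_def
  proof (rule sum.UNION_disjoint[OF fin_supp])
    show "\<forall>i\<in>supp. finite ({?e i} \<times> {..<m i - 1})" by simp
    show "\<forall>i\<in>supp. \<forall>j\<in>supp. i \<noteq> j \<longrightarrow> ({?e i} \<times> {..<m i - 1}) \<inter> ({?e j} \<times> {..<m j - 1}) = {}"
    proof (intro ballI impI)
      fix i j assume "i \<in> supp" "j \<in> supp" "i \<noteq> j"
      then have "?e i \<noteq> ?e j" using inj_onD[OF inj_unit] by blast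
      then show "({?e i} \<times> {..<m i - 1}) \<inter> ({?e j} \<times> {..<m j - 1}) = {}" by blast
    qed
  qed
  also have "\<dots> = (\<Sum>i\<in>supp. 1 - 1 / real (m i))"
  proof (rule sum.cong[OF refl])
    fix i assume i: "i \<in> supp"
    have m0: "m i > 0" using m by simp
    have "(\<Sum>t\<in>{?e i} \<times> {..<m i - 1}. 1 / real (vord m (\<phi> (fst t)))) =
        (\<Sum>t\<in>{?e i} \<times> {..<m i - 1}. 1 / real (m i))"
    proof (rule sum.cong[OF refl])
      fix t assume "t \<in> {?e i} \<times> {..<m i - 1}"
      then have "\<phi> (fst t) = unit i" using \<phi>e[OF i] by (simp only: mem_Times_iff singleton_iff)
      then show "1 / real (vord m (\<phi> (fst t))) = 1 / real (m i)" by (simp only: vord_unit)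
    qed
    also have "\<dots> = real (m i - 1) / real (m i)" by (simp add: card_cartesian_product)
    also have "\<dots> = 1 - 1 / real (m i)" using m0 by (simp add: of_nat_diff field_simps)
    finally show "(\<Sum>t\<in>{?e i} \<times> {..<m i - 1}. 1 / real (vord m (\<phi> (fst t)))) = 1 - 1 / real (m i)" .
  qed
  finally have "cross_number G S = (\<Sum>i\<in>supp. 1 - 1 / real (m i))" .
  moreover have "indexed_sequence G S" unfolding indexed_sequence_def using fS sub by (rule conjI)
  ultimately show ?thesis using zs by blast
qed

theorem little_cross_number_eq:
  assumes "cross_bound m (\<Sum>i\<in>supp. 1 - 1 / real (m i))"
  shows "little_cross_number G = (\<Sum>i\<in>supp. 1 - 1 / real (m i))"
  unfolding little_cross_number_def
proof (rule Max_eqI)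
  show "finite {cross_number G S |S. indexed_sequence G S \<and> zero_sum_free G S}"
    by (rule finite_zero_sum_free_cross_numbers[OF comm_group_axioms fin])
  show "(\<Sum>i\<in>supp. 1 - 1 / real (m i)) \<in> {cross_number G S |S. indexed_sequence G S \<and> zero_sum_free G S}"
  proof -
    obtain S where "indexed_sequence G S" "zero_sum_free G S" "cross_number G S = (\<Sum>i\<in>supp. 1 - 1 / real (m i))"
      using cross_number_attained by (elim exE conjE)
    then show ?thesis by (intro CollectI exI[of _ S] conjI) simp_all
  qed
  show "y \<le> (\<Sum>i\<in>supp. 1 - 1 / real (m i))"
    if "y \<in> {cross_number G S |S. indexed_sequence G S \<and> zero_sum_free G S}" for y
    using that by (elim CollectE exE conjE, hypsubst) (rule cross_number_le[OF assms])
qed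

end

section \<open>The number \<open>k\<^sup>*\<close> is well defined\<close>

text \<open>The solutions are the multiples of \<open>m / gcd(c, m)\<close>.\<close>

lemma card_annihilated_residues:
  assumes "m > 0"
  shows "card {x \<in> {0..<int m}. int m dvd int c * x} = gcd c m"
proof -
  define d where "d = m div gcd m c"
  have m: "m = d * gcd c m" by (simp add: d_def gcd.commute)
  have "d > 0" using m assms by (metis gr0I mult_0)
  have iff: "int m dvd int c * int y \<longleftrightarrow> d dvd y" for y
    using dvd_mult_iff_div_gcd_nat[OF assms, of y c] unfolding d_def
    by (simp add: mult.commute flip: of_nat_mult)
  have "{x \<in> {0..<int m}. int m dvd int c * x} = (\<lambda>y. int (d * y)) ` {..<gcd c m}"
  proof (intro equalityI subsetI)
    fix x assume x: "x \<in> {x \<in> {0..<int m}. int m dvd int c * x}"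
    then have "d dvd nat x" using iff[of "nat x"] by simp
    then obtain y where y: "nat x = d * y" by (rule dvdE)
    have "d * y < d * gcd c m" using x m y by (metis (no_types, lifting) atLeastLessThan_iff mem_Collect_eq nat_less_iff)
    then have "y < gcd c m" using \<open>d > 0\<close> by simp
    moreover have "x = int (d * y)" using x y by (metis (no_types, lifting) atLeastLessThan_iff int_nat_eq mem_Collect_eq)
    ultimately show "x \<in> (\<lambda>y. int (d * y)) ` {..<gcd c m}" by blast
  next
    fix x assume "x \<in> (\<lambda>y. int (d * y)) ` {..<gcd c m}"
    then obtain y where y: "y < gcd c m" "x = int (d * y)" by blast
    have "d * y < d * gcd c m" using y(1) \<open>d > 0\<close> by simp
    then have "x < int m" unfolding y(2) of_nat_less_iff using m by argo
    moreover have "int m dvd int c * x" unfolding y(2) iff by simp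
    moreover have "x \<ge> 0" unfolding y(2) by simp
    ultimately show "x \<in> {x \<in> {0..<int m}. int m dvd int c * x}" by simp
  qed
  moreover have "inj_on (\<lambda>y. int (d * y)) {..<gcd c m}" using \<open>d > 0\<close> by (auto simp: inj_on_def)
  ultimately show ?thesis by (simp add: card_image)
qed

lemma pow_product_group:
  fixes I :: "nat set" and m :: "nat \<Rightarrow> nat"
  assumes "x \<in> carrier (product_group I (\<lambda>i. integer_mod_group (m i)))"
  shows "x [^]\<^bsub>product_group I (\<lambda>i. integer_mod_group (m i))\<^esub> (c :: nat) = (\<lambda>i\<in>I. int c * x i mod int (m i))"
proof (induction c)
  case (Suc c)
  have "x [^]\<^bsub>product_group I (\<lambda>i. integer_mod_group (m i))\<^esub> Suc c =
      (\<lambda>i\<in>I. (int c * x i mod int (m i) + x i) mod int (m i))"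
    by (simp add: Suc cong: restrict_cong)
  also have "\<dots> = (\<lambda>i\<in>I. int (Suc c) * x i mod int (m i))"
    by (rule restrict_ext) (simp add: mod_add_left_eq mod_add_right_eq algebra_simps)
  finally show ?case .
qed simp

lemma bij_betw_Collect_iff:
  assumes "bij_betw h A B" "\<And>x. x \<in> A \<Longrightarrow> P x \<longleftrightarrow> Q (h x)"
  shows "bij_betw h {x \<in> A. P x} {y \<in> B. Q y}"
proof (rule bij_betw_subset[OF assms(1)])
  show "h ` {x \<in> A. P x} = {y \<in> B. Q y}" using assms by (auto simp: bij_betw_def)
qed auto

lemma card_torsion:
  fixes m :: "nat \<Rightarrow> nat"
  assumes "group G" and iso: "G \<cong> product_group {..<n} (\<lambda>i. integer_mod_group (m i))"
    and m: "\<And>i. i < n \<Longrightarrow> m i > 0"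
  shows "card {g \<in> carrier G. g [^]\<^bsub>G\<^esub> c = \<one>\<^bsub>G\<^esub>} = (\<Prod>i<n. gcd c (m i))"
proof -
  let ?P = "product_group {..<n} (\<lambda>i. integer_mod_group (m i))"
  obtain h where h: "h \<in> iso G ?P" using iso by (auto simp: is_iso_def)
  interpret G: group G by fact
  interpret P: group ?P by (rule product_group) simp
  interpret h: group_hom G ?P h by unfold_locales (use h in \<open>simp add: iso_def\<close>)
  have bij: "bij_betw h (carrier G) (carrier ?P)" using h by (simp add: iso_def)
  have "g [^]\<^bsub>G\<^esub> c = \<one>\<^bsub>G\<^esub> \<longleftrightarrow> h g [^]\<^bsub>?P\<^esub> c = \<one>\<^bsub>?P\<^esub>" if g: "g \<in> carrier G" for g
  proof -
    have "g [^]\<^bsub>G\<^esub> c = \<one>\<^bsub>G\<^esub> \<longleftrightarrow> h (g [^]\<^bsub>G\<^esub> c) = h \<one>\<^bsub>G\<^esub>"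
      using bij g by (intro inj_on_eq_iff[symmetric, of h "carrier G"]) (auto simp: bij_betw_def)
    then show ?thesis by (simp only: h.hom_nat_pow[OF g] h.hom_one)
  qed
  then have "bij_betw h {g \<in> carrier G. g [^]\<^bsub>G\<^esub> c = \<one>\<^bsub>G\<^esub>} {x \<in> carrier ?P. x [^]\<^bsub>?P\<^esub> c = \<one>\<^bsub>?P\<^esub>}"
    by (rule bij_betw_Collect_iff[OF bij])
  then have "card {g \<in> carrier G. g [^]\<^bsub>G\<^esub> c = \<one>\<^bsub>G\<^esub>} = card {x \<in> carrier ?P. x [^]\<^bsub>?P\<^esub> c = \<one>\<^bsub>?P\<^esub>}"
    by (rule bij_betw_same_card)
  also have "{x \<in> carrier ?P. x [^]\<^bsub>?P\<^esub> c = \<one>\<^bsub>?P\<^esub>} =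
      (\<Pi>\<^sub>E i\<in>{..<n}. {x \<in> {0..<int (m i)}. int (m i) dvd int c * x})"
  proof -
    have pw: "x [^]\<^bsub>?P\<^esub> c = \<one>\<^bsub>?P\<^esub> \<longleftrightarrow> (\<forall>i<n. int (m i) dvd int c * x i)" if "x \<in> carrier ?P" for x
      unfolding pow_product_group[OF that] by (auto simp: fun_eq_iff restrict_def dvd_eq_mod_eq_0)
    have carr: "x \<in> carrier ?P \<longleftrightarrow> x \<in> (\<Pi>\<^sub>E i\<in>{..<n}. {0..<int (m i)})" for x
      using m by (auto simp: PiE_iff carrier_integer_mod_group split: if_splits)
    show ?thesis
    proof (rule Set.set_eqI)
      fix x
      have "x \<in> {x \<in> carrier ?P. x [^]\<^bsub>?P\<^esub> c = \<one>\<^bsub>?P\<^esub>} \<longleftrightarrow>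
          x \<in> carrier ?P \<and> (\<forall>i<n. int (m i) dvd int c * x i)"
        using pw by blast
      also have "\<dots> \<longleftrightarrow> x \<in> (\<Pi>\<^sub>E i\<in>{..<n}. {x \<in> {0..<int (m i)}. int (m i) dvd int c * x})"
        unfolding carr by (auto simp: PiE_iff)
      finally show "x \<in> {x \<in> carrier ?P. x [^]\<^bsub>?P\<^esub> c = \<one>\<^bsub>?P\<^esub>} \<longleftrightarrow>
          x \<in> (\<Pi>\<^sub>E i\<in>{..<n}. {x \<in> {0..<int (m i)}. int (m i) dvd int c * x})" .
    qed
  qed
  also have "card \<dots> = (\<Prod>i<n. gcd c (m i))"
    unfolding card_PiE[OF finite_lessThan]
    by (intro prod.cong refl card_annihilated_residues m) simp
  finally show ?thesis .
qed

lemma geometric_prime_sum: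
  fixes x :: real
  assumes "x > 0"
  shows "(\<Sum>k = 1..a. (x - 1) / x ^ k) = 1 - 1 / x ^ a"
proof (induction a)
  case (Suc a)
  have "(\<Sum>k = 1..Suc a. (x - 1) / x ^ k) = 1 - 1 / x ^ a + (x - 1) / x ^ Suc a"
    using Suc by simp
  also have "\<dots> = 1 - 1 / x ^ Suc a" using assms by (simp add: field_simps)
  finally show ?case .
qed simp

text \<open>The quotient of the two greatest common divisors is \<open>p\<close> if \<open>P = p\<close> and \<open>k \<le> a\<close>, and \<open>1\<close> otherwise, so the sum
  is a geometric one. The logarithm turns the numbers of solutions in a direct sum, which are
  products, into sums over the summands.\<close>

lemma log_formula:
  assumes p: "prime p" and a: "a \<ge> 1" and N: "p ^ a \<le> N"
  shows "(\<Sum>P | prime P \<and> P \<le> N. \<Sum>k = 1..N. (real P - 1) / real P ^ k *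
      (ln (real (gcd (P ^ k) (p ^ a))) - ln (real (gcd (P ^ (k - 1)) (p ^ a)))) / ln (real P))
    = 1 - 1 / real (p ^ a)"
proof -
  let ?t = "\<lambda>P k. (real P - 1) / real P ^ k *
      (ln (real (gcd (P ^ k) (p ^ a))) - ln (real (gcd (P ^ (k - 1)) (p ^ a)))) / ln (real P)"
  have p1: "p > 1" using p by (rule prime_gt_1_nat)
  have pN: "p \<le> N"
  proof -
    have "p ^ 1 \<le> p ^ a" using a p1 by (intro power_increasing) auto
    then show ?thesis using N by simp
  qed
  have aN: "a \<le> N"
  proof -
    have "a < p ^ a" using p1 by (intro power_gt_expt) simp
    then show ?thesis using N by simp
  qed
  have "(\<Sum>P | prime P \<and> P \<le> N. \<Sum>k = 1..N. ?t P k) = (\<Sum>P\<in>{p}. \<Sum>k = 1..N. ?t P k)"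
  proof (rule sum.mono_neutral_right)
    show "\<forall>P\<in>{P. prime P \<and> P \<le> N} - {p}. (\<Sum>k = 1..N. ?t P k) = 0"
    proof (intro ballI sum.neutral)
      fix P k assume P: "P \<in> {P. prime P \<and> P \<le> N} - {p}"
      have "coprime P p" using P p by (intro primes_coprime) auto
      then have "gcd (P ^ k) (p ^ a) = 1" "gcd (P ^ (k - 1)) (p ^ a) = 1" for k by simp_all
      then show "?t P k = 0" by simp
    qed
  qed (use p pN in auto)
  also have "\<dots> = (\<Sum>k = 1..N. ?t p k)" by simp
  also have "\<dots> = (\<Sum>k = 1..a. (real p - 1) / real p ^ k)"
  proof (rule sum.mono_neutral_cong_right)
    have g: "gcd (p ^ k) (p ^ a) = p ^ min k a" for k
    proof (cases "k \<le> a")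
      case True
      then have "p ^ k dvd p ^ a" by (rule le_imp_power_dvd)
      then show ?thesis using True by (simp add: gcd_proj1_if_dvd_nat)
    next
      case False
      then have "p ^ a dvd p ^ k" by (intro le_imp_power_dvd) simp
      then show ?thesis using False by (simp add: gcd_proj2_if_dvd_nat)
    qed
    have lp: "ln (real p) > 0" using p1 by simp
    show "?t p k = (real p - 1) / real p ^ k" if "k \<in> {1..a}" for k
    proof -
      have "ln (real p ^ k) = real k * ln (real p)" "ln (real p ^ (k - 1)) = real (k - 1) * ln (real p)"
        using p1 by (intro ln_realpow; simp)+
      moreover have "real (k - 1) = real k - 1" using that by (simp add: of_nat_diff)
      ultimately have "ln (real p ^ k) - ln (real p ^ (k - 1)) = ln (real p)"
        by (simp add: algebra_simps)
      moreover have "min k a = k" "min (k - 1) a = k - 1" using that by auto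
      ultimately show ?thesis using lp by (simp add: g)
    qed
    show "\<forall>k\<in>{1..N} - {1..a}. ?t p k = 0"
    proof
      fix k assume "k \<in> {1..N} - {1..a}"
      then have "min k a = a" "min (k - 1) a = a" by auto
      then show "?t p k = 0" by (simp add: g)
    qed
  qed (use aN in auto)
  also have "\<dots> = 1 - 1 / real (p ^ a)" using geometric_prime_sum[of "real p" a] p1 by simp
  finally show ?thesis .
qed

text \<open>The right-hand side does not mention the decomposition.\<close>

lemma kstar_value:
  fixes n :: nat and p a :: "nat \<Rightarrow> nat"
  assumes G: "group G" and iso: "G \<cong> product_group {..<n} (\<lambda>i. integer_mod_group (p i ^ a i))"
    and pa: "\<forall>i<n. prime (p i) \<and> a i \<ge> 1" and N: "\<And>i. i < n \<Longrightarrow> p i ^ a i \<le> N"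
  shows "(\<Sum>i<n. 1 - 1 / real (p i ^ a i)) =
    (\<Sum>P | prime P \<and> P \<le> N. \<Sum>k = 1..N. (real P - 1) / real P ^ k *
      (ln (real (card {g \<in> carrier G. g [^]\<^bsub>G\<^esub> (P ^ k) = \<one>\<^bsub>G\<^esub>})) -
       ln (real (card {g \<in> carrier G. g [^]\<^bsub>G\<^esub> (P ^ (k - 1)) = \<one>\<^bsub>G\<^esub>}))) / ln (real P))"
proof -
  have F: "card {g \<in> carrier G. g [^]\<^bsub>G\<^esub> c = \<one>\<^bsub>G\<^esub>} = (\<Prod>i<n. gcd c (p i ^ a i))" for c :: nat
  proof (rule card_torsion[OF G iso])
    show "p i ^ a i > 0" if "i < n" for i using pa that prime_gt_0_nat by simp
  qed
  have lnF: "ln (real (card {g \<in> carrier G. g [^]\<^bsub>G\<^esub> (P ^ k) = \<one>\<^bsub>G\<^esub>})) = (\<Sum>i<n. ln (real (gcd (P ^ k) (p i ^ a i))))"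
    if "prime P" for P k
  proof -
    have "P > 0" using that by (rule prime_gt_0_nat)
    then show ?thesis unfolding F of_nat_prod by (intro ln_prod) simp_all
  qed
  have "(\<Sum>i<n. 1 - 1 / real (p i ^ a i)) =
    (\<Sum>i<n. \<Sum>P | prime P \<and> P \<le> N. \<Sum>k = 1..N. (real P - 1) / real P ^ k *
      (ln (real (gcd (P ^ k) (p i ^ a i))) - ln (real (gcd (P ^ (k - 1)) (p i ^ a i)))) / ln (real P))"
  proof (rule sum.cong[OF refl])
    fix i assume "i \<in> {..<n}"
    then show "1 - 1 / real (p i ^ a i) = (\<Sum>P | prime P \<and> P \<le> N. \<Sum>k = 1..N. (real P - 1) / real P ^ k *
      (ln (real (gcd (P ^ k) (p i ^ a i))) - ln (real (gcd (P ^ (k - 1)) (p i ^ a i)))) / ln (real P))"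
      using log_formula[of "p i" "a i" N] pa N by simp
  qed
  also have "\<dots> = (\<Sum>P | prime P \<and> P \<le> N. \<Sum>k = 1..N. \<Sum>i<n. (real P - 1) / real P ^ k *
      (ln (real (gcd (P ^ k) (p i ^ a i))) - ln (real (gcd (P ^ (k - 1)) (p i ^ a i)))) / ln (real P))"
    by (subst sum.swap, intro sum.cong refl sum.swap)
  also have "\<dots> = (\<Sum>P | prime P \<and> P \<le> N. \<Sum>k = 1..N. (real P - 1) / real P ^ k *
      (ln (real (card {g \<in> carrier G. g [^]\<^bsub>G\<^esub> (P ^ k) = \<one>\<^bsub>G\<^esub>})) -
       ln (real (card {g \<in> carrier G. g [^]\<^bsub>G\<^esub> (P ^ (k - 1)) = \<one>\<^bsub>G\<^esub>}))) / ln (real P))"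
    by (intro sum.cong refl)
      (simp only: lnF mem_Collect_eq sum_subtractf sum_distrib_left[symmetric] sum_divide_distrib[symmetric])
  finally show ?thesis .
qed

lemma kstar_eqI:
  fixes n :: nat and p a :: "nat \<Rightarrow> nat"
  assumes G: "group G" and iso: "G \<cong> product_group {..<n} (\<lambda>i. integer_mod_group (p i ^ a i))"
    and pa: "\<forall>i<n. prime (p i) \<and> a i \<ge> 1"
  shows "kstar G = (\<Sum>i<n. 1 - 1 / real (p i ^ a i))"
  unfolding kstar_def
proof (rule the_equality)
  show "\<exists>n' (p' :: nat \<Rightarrow> nat) (a' :: nat \<Rightarrow> nat). (\<forall>i<n'. prime (p' i) \<and> 1 \<le> a' i) \<and>
      G \<cong> product_group {..<n'} (\<lambda>i. integer_mod_group (p' i ^ a' i)) \<and>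
      (\<Sum>i<n. 1 - 1 / real (p i ^ a i)) = (\<Sum>i<n'. 1 - 1 / real (p' i ^ a' i))"
    by (rule exI[of _ n], rule exI[of _ p], rule exI[of _ a], rule conjI[OF pa], rule conjI[OF iso], rule refl)
next
  fix x assume "\<exists>n (p :: nat \<Rightarrow> nat) (a :: nat \<Rightarrow> nat). (\<forall>i<n. prime (p i) \<and> 1 \<le> a i) \<and>
      G \<cong> product_group {..<n} (\<lambda>i. integer_mod_group (p i ^ a i)) \<and>
      x = (\<Sum>i<n. 1 - 1 / real (p i ^ a i))"
  then obtain n' and p' a' :: "nat \<Rightarrow> nat" where *: "\<forall>i<n'. prime (p' i) \<and> 1 \<le> a' i"
      "G \<cong> product_group {..<n'} (\<lambda>i. integer_mod_group (p' i ^ a' i))"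
      "x = (\<Sum>i<n'. 1 - 1 / real (p' i ^ a' i))"
    by blast
  define N where "N = (\<Sum>i<n. p i ^ a i) + (\<Sum>i<n'. p' i ^ a' i)"
  have "p i ^ a i \<le> N" if "i < n" for i
    unfolding N_def using that by (intro trans_le_add1 member_le_sum) auto
  note 1 = kstar_value[OF G iso pa this]
  have "p' i ^ a' i \<le> N" if "i < n'" for i
    unfolding N_def using that by (intro trans_le_add2 member_le_sum) auto
  note 2 = kstar_value[OF G *(2,1) this]
  show "x = (\<Sum>i<n. 1 - 1 / real (p i ^ a i))" by (rule trans[OF *(3) trans[OF 2 1[symmetric]]])
qed

context presentation
begin

text \<open>Coordinates with modulus \<open>1\<close> are dropped and the others are numbered by \<open>e\<close>.\<close>

lemma iso_product:
  fixes n :: nat and e :: "nat \<Rightarrow> nat"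
  assumes e: "bij_betw e {..<n} supp"
  shows "G \<cong> product_group {..<n} (\<lambda>i. integer_mod_group (m (e i)))"
proof -
  let ?P = "product_group {..<n} (\<lambda>i. integer_mod_group (m (e i)))"
  define e' where "e' = inv_into {..<n} e"
  have e'e: "e' (e i) = i" if "i < n" for i
    unfolding e'_def using e that by (intro inv_into_f_f) (auto simp: bij_betw_def)
  have es: "e i \<in> supp" if "i < n" for i using e that by (auto simp: bij_betw_def)
  have ee': "e (e' k) = k" "e' k < n" if "k \<in> supp" for k
  proof -
    have "k \<in> e ` {..<n}" using e that by (simp add: bij_betw_def)
    then show "e (e' k) = k" "e' k < n"
      using f_inv_into_f[of k e "{..<n}"] inv_into_into[of k e "{..<n}"] by (simp_all add: e'_def)
  qed
  have m0: "m k > 0" for k using m by simp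
  define c where "c x = (\<lambda>k. if k \<in> supp then x (e' k) else 0)" for x :: "nat \<Rightarrow> int"
  have c_eq: "\<psi> (c x) = \<psi> v \<longleftrightarrow> (\<forall>i<n. int (m (e i)) dvd x i - v (e i))" for x v
  proof -
    have "(\<forall>k. int (m k) dvd c x k - v k) \<longleftrightarrow> (\<forall>k\<in>supp. int (m k) dvd x (e' k) - v k)"
      by (auto simp: c_def)
    also have "\<dots> \<longleftrightarrow> (\<forall>i<n. int (m (e i)) dvd x i - v (e i))"
    proof (intro iffI allI impI ballI)
      fix i assume "\<forall>k\<in>supp. int (m k) dvd x (e' k) - v k" "i < n"
      then show "int (m (e i)) dvd x i - v (e i)" using e'e es by metis
    next
      fix k assume "\<forall>i<n. int (m (e i)) dvd x i - v (e i)" "k \<in> supp"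
      then show "int (m k) dvd x (e' k) - v k" using ee' by metis
    qed
    finally show ?thesis by (simp only: eq_iff)
  qed
  have carr: "x \<in> carrier ?P \<longleftrightarrow> x \<in> extensional {..<n} \<and> (\<forall>i<n. 0 \<le> x i \<and> x i < int (m (e i)))" for x
    using m0 by (auto simp: PiE_iff carrier_integer_mod_group)
  have "(\<psi> \<circ> c) \<in> iso ?P G"
  proof (rule isoI)
    show "\<psi> \<circ> c \<in> hom ?P G"
    proof (rule homI)
      fix x y assume "x \<in> carrier ?P" "y \<in> carrier ?P"
      have "\<psi> (c (x \<otimes>\<^bsub>?P\<^esub> y)) = \<psi> (c x + c y)"
        unfolding c_eq using e'e es by (auto simp: c_def plus_fun_apply mod_eq_dvd_iff[symmetric])
      then show "(\<psi> \<circ> c) (x \<otimes>\<^bsub>?P\<^esub> y) = (\<psi> \<circ> c) x \<otimes> (\<psi> \<circ> c) y" by (simp add: add)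
    qed (simp add: closed)
    show "bij_betw (\<psi> \<circ> c) (carrier ?P) (carrier G)"
    proof (rule bij_betw_imageI)
      show "inj_on (\<psi> \<circ> c) (carrier ?P)"
      proof (rule inj_onI)
        fix x y assume xy: "x \<in> carrier ?P" "y \<in> carrier ?P" "(\<psi> \<circ> c) x = (\<psi> \<circ> c) y"
        have d: "int (m (e i)) dvd x i - y i" if "i < n" for i
          using xy(3) that e'e[OF that] es[OF that] unfolding comp_def c_eq by (auto simp: c_def)
        show "x = y"
        proof (rule extensionalityI)
          show "x \<in> extensional {..<n}" "y \<in> extensional {..<n}"
            by (rule conjunct1[OF xy(1)[unfolded carr]], rule conjunct1[OF xy(2)[unfolded carr]])
          fix i assume "i \<in> {..<n}"
          then have i: "i < n" by simp
          have "x i mod int (m (e i)) = y i mod int (m (e i))" using d[OF i] by (simp add: mod_eq_dvd_iff)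
          then show "x i = y i" using xy(1,2) i unfolding carr by simp
        qed
      qed
      show "(\<psi> \<circ> c) ` carrier ?P = carrier G"
      proof (intro equalityI subsetI)
        fix g assume "g \<in> carrier G"
        then have "g \<in> range \<psi>" by (rule subsetD[OF surj])
        then obtain v where v: "g = \<psi> v" by (rule rangeE)
        define x where "x = (\<lambda>i\<in>{..<n}. v (e i) mod int (m (e i)))"
        have "x \<in> carrier ?P" unfolding carr using m0 by (simp add: x_def)
        moreover have "\<psi> (c x) = g" unfolding v c_eq by (simp add: x_def mod_eq_dvd_iff[symmetric])
        ultimately show "g \<in> (\<psi> \<circ> c) ` carrier ?P" by (intro image_eqI[of _ _ x]) simp_all
      qed (use closed in auto)
    qed
  qed
  then have "?P \<cong> G" by (rule is_isoI)
  moreover have "group ?P" by simp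
  ultimately show ?thesis using group.iso_sym by blast
qed

lemma kstar_eq:
  assumes "\<And>i. i \<in> supp \<Longrightarrow> \<exists>q b. prime q \<and> m i = q ^ b"
  shows "kstar G = (\<Sum>i\<in>supp. 1 - 1 / real (m i))"
proof -
  obtain e where e: "bij_betw e {..<card supp} supp"
    using ex_bij_betw_nat_finite[OF fin_supp] by (auto simp: atLeast0LessThan)
  have es: "e i \<in> supp" if "i < card supp" for i using e that by (auto simp: bij_betw_def)
  have "\<exists>q b. i < card supp \<longrightarrow> prime q \<and> b \<ge> 1 \<and> m (e i) = q ^ b" for i
  proof (cases "i < card supp")
    case True
    obtain q b where qb: "prime q" "m (e i) = q ^ b" using assms es[OF True] by blast
    have "b \<noteq> 0" using qb(2) es[OF True] by (intro notI) simp
    then have "b \<ge> 1" by simp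
    then show ?thesis using qb by blast
  qed blast
  then obtain q b where qb: "prime (q i)" "b i \<ge> 1" "m (e i) = q i ^ b i" if "i < card supp" for i
    by metis
  have "product_group {..<card supp} (\<lambda>i. integer_mod_group (m (e i))) =
      product_group {..<card supp} (\<lambda>i. integer_mod_group (q i ^ b i))"
    unfolding product_group_def using qb(3) by (auto simp: fun_eq_iff restrict_def PiE_iff intro!: PiE_cong)
  then have "G \<cong> product_group {..<card supp} (\<lambda>i. integer_mod_group (q i ^ b i))"
    using iso_product[OF e] by simp
  then have "kstar G = (\<Sum>i<card supp. 1 - 1 / real (q i ^ b i))"
    using qb by (intro kstar_eqI is_group) auto
  also have "\<dots> = (\<Sum>i<card supp. 1 - 1 / real (m (e i)))" by (rule sum.cong) (use qb in auto)
  also have "\<dots> = (\<Sum>i\<in>supp. 1 - 1 / real (m i))" by (rule sum.reindex_bij_betw[OF e])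
  finally show ?thesis .
qed

theorem little_cross_number_eq_kstar:
  assumes "cross_bound m (\<Sum>i\<in>supp. 1 - 1 / real (m i))" "\<And>i. i \<in> supp \<Longrightarrow> \<exists>q b. prime q \<and> m i = q ^ b"
  shows "little_cross_number G = kstar G"
  by (simp only: little_cross_number_eq[OF assms(1)] kstar_eq[OF assms(2)])

end

section \<open>The groups of the theorem\<close>

lemma presentationI:
  fixes \<theta> :: "vec \<Rightarrow> 'b"
  assumes G: "comm_group G" "finite (carrier G)" and iso: "G \<cong> D" and D: "group D" and m: "moduli m"
    and closed: "\<And>x. \<theta> x \<in> carrier D" and add: "\<And>x y. \<theta> (x + y) = \<theta> x \<otimes>\<^bsub>D\<^esub> \<theta> y"
    and one: "\<And>x. \<theta> x = \<one>\<^bsub>D\<^esub> \<longleftrightarrow> nul m x" and surj: "carrier D \<subseteq> range \<theta>"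
  shows "\<exists>\<psi>. presentation G m \<psi>"
proof -
  interpret G: comm_group G by fact
  obtain h where h: "h \<in> iso D G"
    using G.iso_sym[OF iso] by (auto simp: is_iso_def)
  interpret D: group D by fact
  interpret h: group_hom D G h by unfold_locales (use h in \<open>simp add: iso_def\<close>)
  have bij: "bij_betw h (carrier D) (carrier G)" using h by (simp add: iso_def)
  have "presentation G m (h \<circ> \<theta>)"
  proof
    show "(h \<circ> \<theta>) x \<in> carrier G" for x using closed by simp
    show "(h \<circ> \<theta>) (x + y) = (h \<circ> \<theta>) x \<otimes>\<^bsub>G\<^esub> (h \<circ> \<theta>) y" for x y using closed by (simp add: add)
    show "(h \<circ> \<theta>) x = \<one>\<^bsub>G\<^esub> \<longleftrightarrow> nul m x" for x
    proof -
      have "h (\<theta> x) = h \<one>\<^bsub>D\<^esub> \<longleftrightarrow> \<theta> x = \<one>\<^bsub>D\<^esub>"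
        using bij closed by (intro inj_on_eq_iff[of h "carrier D"]) (auto simp: bij_betw_def)
      then show ?thesis by (simp add: one)
    qed
    show "carrier G \<subseteq> range (h \<circ> \<theta>)"
    proof
      fix g assume "g \<in> carrier G"
      then have "g \<in> h ` carrier D" using bij by (simp add: bij_betw_def)
      then obtain d where "d \<in> carrier D" "g = h d" by blast
      moreover from this surj have "d \<in> range \<theta>" by blast
      ultimately show "g \<in> range (h \<circ> \<theta>)" by auto
    qed
  qed (use G m in auto)
  then show ?thesis by blast
qed

context wide_tails
begin

definition direct_sum where
  "direct_sum = product_group {1..r - 2} (\<lambda>i. integer_mod_group (p i ^ \<alpha> i))
              \<times>\<times> integer_mod_group (p (r - 1) ^ \<alpha> (r - 1))
              \<times>\<times> integer_mod_group (p (r - 1) ^ \<alpha>')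
              \<times>\<times> product_group {..<s} (\<lambda>_. integer_mod_group (p r))"

text \<open>Reduces the vector in every coordinate and arranges the residues in the form of the direct sum \<open>D\<close>.\<close>

definition tup :: "vec \<Rightarrow> (nat \<Rightarrow> int) \<times> int \<times> int \<times> (nat \<Rightarrow> int)" where
  "tup v = (\<lambda>i\<in>{1..r - 2}. v i mod int (p i ^ \<alpha> i), v (r - 1) mod int (p (r - 1) ^ \<alpha> (r - 1)),
     v r mod int (p (r - 1) ^ \<alpha>'), \<lambda>i\<in>{..<s}. v (r + 1 + i) mod int (p r))"

lemma tail_moduli_cases:
  shows "i \<in> {1..r - 2} \<Longrightarrow> tail_moduli 0 i = p i ^ \<alpha> i" "tail_moduli 0 (r - 1) = p (r - 1) ^ \<alpha> (r - 1)"
    "tail_moduli 0 r = p (r - 1) ^ \<alpha>'" "i < s \<Longrightarrow> tail_moduli 0 (r + 1 + i) = p r"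
    "k \<notin> {1..r + s} \<Longrightarrow> tail_moduli 0 k = 1"
  using r by (auto simp: tail_moduli_def base_moduli_eq)

lemma index_cases:
  "k \<notin> {1..r + s} \<or> k \<in> {1..r - 2} \<or> k = r - 1 \<or> k = r \<or> (\<exists>i<s. k = r + 1 + i)"
proof -
  consider "k < r + 1" | "k > r + s" | "r + 1 \<le> k" "k \<le> r + s" by linarith
  then show ?thesis
  proof cases
    case 3
    then have "k - (r + 1) < s" "k = r + 1 + (k - (r + 1))" by auto
    then show ?thesis by blast
  qed (use r in auto)
qed

lemma all_index:
  "(\<forall>k. int (tail_moduli 0 k) dvd v k) \<longleftrightarrow> (\<forall>i\<in>{1..r - 2}. int (p i ^ \<alpha> i) dvd v i) \<and>
     int (p (r - 1) ^ \<alpha> (r - 1)) dvd v (r - 1) \<and> int (p (r - 1) ^ \<alpha>') dvd v r \<and>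
     (\<forall>i<s. int (p r) dvd v (r + 1 + i))" (is "?L \<longleftrightarrow> ?R")
proof
  assume L: ?L
  show ?R
    using L[rule_format, of "r - 1"] L[rule_format, of r] L tail_moduli_cases by metis
next
  assume R: ?R
  show ?L
  proof
    fix k show "int (tail_moduli 0 k) dvd v k"
      using index_cases[of k] R tail_moduli_cases(1)[of k] tail_moduli_cases(2,3) tail_moduli_cases(4) tail_moduli_cases(5)[of k]
      by (elim disjE exE conjE) simp_all
  qed
qed

lemma prime_powers_pos: "i \<in> {1..r - 2} \<Longrightarrow> p i ^ \<alpha> i > 0" "p (r - 1) ^ e > 0" "p r > 0"
  using tail_moduli_pos[of 0 i] tail_moduli_cases(1) prr prime_gt_0_nat by auto

lemma ex_presentation:
  fixes G :: "('a, 'b) monoid_scheme"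
  assumes "comm_group G" "finite (carrier G)" "G \<cong> direct_sum"
  shows "\<exists>\<psi>. presentation G (tail_moduli 0) \<psi>"
proof (rule presentationI[OF assms, of _ tup])
  show "group direct_sum" unfolding direct_sum_def by (intro DirProd_group) simp_all
  show "moduli (tail_moduli 0)" by (rule moduli_tail_moduli)
  note pos = prime_powers_pos
  have cyc: "carrier (integer_mod_group k) = {0..<int k}" if "k > 0" for k
    using that by (simp add: carrier_integer_mod_group)
  have carr: "carrier direct_sum = (\<Pi>\<^sub>E i\<in>{1..r - 2}. {0..<int (p i ^ \<alpha> i)}) \<times> {0..<int (p (r - 1) ^ \<alpha> (r - 1))} \<times>
      {0..<int (p (r - 1) ^ \<alpha>')} \<times> (\<Pi>\<^sub>E i\<in>{..<s}. {0..<int (p r)})"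
    unfolding direct_sum_def carrier_DirProd carrier_product_group
    by (intro arg_cong2[where f = "(\<times>)"] PiE_cong cyc pos)
  have ipos: "i \<in> {1..r - 2} \<Longrightarrow> int (p i ^ \<alpha> i) > 0" "int (p (r - 1) ^ e) > 0" "int (p r) > 0" for i e
    by (simp_all only: of_nat_0_less_iff pos)
  show "tup x \<in> carrier direct_sum" for x
    unfolding carr tup_def mem_Times_iff fst_conv snd_conv restrict_PiE_iff atLeastLessThan_iff
    by (intro conjI ballI pos_mod_sign pos_mod_bound ipos)
  show "tup (x + y) = tup x \<otimes>\<^bsub>direct_sum\<^esub> tup y" for x y
    by (auto simp: tup_def direct_sum_def plus_fun_apply mod_add_eq intro!: restrict_ext)
  have one: "\<one>\<^bsub>direct_sum\<^esub> = (\<lambda>i\<in>{1..r - 2}. 0, 0, 0, \<lambda>i\<in>{..<s}. 0)"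
    unfolding direct_sum_def by simp
  have rz: "(\<lambda>i\<in>I. f i) = (\<lambda>i\<in>I. 0) \<longleftrightarrow> (\<forall>i\<in>I. f i = 0)" for I :: "nat set" and f :: "nat \<Rightarrow> int"
    by (auto simp: fun_eq_iff restrict_def)
  show "tup x = \<one>\<^bsub>direct_sum\<^esub> \<longleftrightarrow> nul (tail_moduli 0) x" for x
    unfolding nul_def all_index one tup_def prod.inject rz
    by (simp only: dvd_eq_mod_eq_0 lessThan_iff Ball_def)
  show "carrier direct_sum \<subseteq> range tup"
  proof
    fix d assume d: "d \<in> carrier direct_sum"
    obtain f a b g where fabg: "d = (f, a, b, g)" by (metis surj_pair)
    define v where "v = (\<lambda>k. if k \<le> r - 2 then f k else if k = r - 1 then a else if k = r then b else g (k - (r + 1)))"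
    have F: "f \<in> extensional {1..r - 2}" "\<And>i. i \<in> {1..r - 2} \<Longrightarrow> 0 \<le> f i \<and> f i < int (p i ^ \<alpha> i)"
      "0 \<le> a" "a < int (p (r - 1) ^ \<alpha> (r - 1))" "0 \<le> b" "b < int (p (r - 1) ^ \<alpha>')"
      "g \<in> extensional {..<s}" "\<And>i. i \<in> {..<s} \<Longrightarrow> 0 \<le> g i \<and> g i < int (p r)"
      using d unfolding fabg carr by (simp_all only: mem_Times_iff fst_conv snd_conv PiE_iff atLeastLessThan_iff simp_thms)
    have "(\<lambda>i\<in>{1..r - 2}. v i mod int (p i ^ \<alpha> i)) = f"
    proof (rule extensionalityI[OF restrict_extensional F(1)])
      fix i assume i: "i \<in> {1..r - 2}"
      have "v i = f i" using i by (simp add: v_def)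
      then show "(\<lambda>i\<in>{1..r - 2}. v i mod int (p i ^ \<alpha> i)) i = f i"
        using i F(2)[OF i] by (simp only: restrict_apply' mod_pos_pos_trivial)
    qed
    moreover have "(\<lambda>i\<in>{..<s}. v (r + 1 + i) mod int (p r)) = g"
    proof (rule extensionalityI[OF restrict_extensional F(7)])
      fix i assume i: "i \<in> {..<s}"
      have "\<not> r + 1 + i \<le> r - 2" "r + 1 + i \<noteq> r - 1" "r + 1 + i \<noteq> r" using r by linarith+
      then have "v (r + 1 + i) = g (r + 1 + i - (r + 1))" unfolding v_def by (simp only: if_False)
      then have "v (r + 1 + i) = g i" by simp
      then show "(\<lambda>i\<in>{..<s}. v (r + 1 + i) mod int (p r)) i = g i"
        using i F(8)[OF i] by (simp only: restrict_apply' mod_pos_pos_trivial)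
    qed
    moreover have "v (r - 1) = a" "v r = b" using r by (auto simp: v_def)
    ultimately have "tup v = d"
      using F(3-6) unfolding tup_def fabg by (simp only: mod_pos_pos_trivial)
    then show "d \<in> range tup" by (metis rangeI)
  qed
qed

lemma tail_bound_eq: "(\<Sum>k | tail_moduli 0 k \<noteq> 1. 1 - 1 / real (tail_moduli 0 k)) = tail_bound 0"
proof -
  let ?f = "\<lambda>k. 1 - 1 / real (tail_moduli 0 k)"
  have "(\<Sum>k | tail_moduli 0 k \<noteq> 1. ?f k) = (\<Sum>k\<in>{0<..r - 2} \<union> {r - 1, r} \<union> {r + 1..r + s}. ?f k)"
  proof (rule sum.mono_neutral_left)
    show "{k. tail_moduli 0 k \<noteq> 1} \<subseteq> {0<..r - 2} \<union> {r - 1, r} \<union> {r + 1..r + s}"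
    proof
      fix k assume "k \<in> {k. tail_moduli 0 k \<noteq> 1}"
      then have "k \<in> {1..r + s}" using tail_moduli_cases(5)[of k] by blast
      then show "k \<in> {0<..r - 2} \<union> {r - 1, r} \<union> {r + 1..r + s}" using index_cases[of k] by auto
    qed
  qed auto
  also have "\<dots> = (\<Sum>k\<in>{0<..r - 2}. ?f k) + (\<Sum>k\<in>{r - 1, r}. ?f k) + (\<Sum>k\<in>{r + 1..r + s}. ?f k)"
    using r by (subst sum.union_disjoint; (subst sum.union_disjoint)?) auto
  also have "(\<Sum>k\<in>{0<..r - 2}. ?f k) = (\<Sum>j\<in>{0<..r - 2}. 1 - 1 / real (p j ^ \<alpha> j))"
    by (rule sum.cong) (use tail_moduli_cases(1) in auto)
  also have "(\<Sum>k\<in>{r - 1, r}. ?f k) = 2 - 1 / real (p (r - 1) ^ \<alpha> (r - 1)) - 1 / real (p (r - 1) ^ \<alpha>')"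
    using r tail_moduli_cases(2,3) by simp
  also have "(\<Sum>k\<in>{r + 1..r + s}. ?f k) = (\<Sum>k\<in>{r + 1..r + s}. 1 - 1 / real (p r))"
    using r by (intro sum.cong refl) (auto simp: tail_moduli_def base_moduli_eq)
  also have "\<dots> = real s * (1 - 1 / real (p r))" by simp
  finally show ?thesis by (simp add: tail_bound_def)
qed

end

theorem corollary9:
  fixes G :: "('a, 'b) monoid_scheme"
    and r s \<alpha>' :: nat
    and p \<alpha> :: "nat \<Rightarrow> nat"
  assumes "r \<ge> 2"
    and "\<And>i. i \<in> {1..r} \<Longrightarrow> prime (p i)"
    and "inj_on p {1..r}"
    and "\<alpha> (r - 1) \<ge> \<alpha>'"
    and "\<And>i. 1 \<le> i \<Longrightarrow> i \<le> r - 2 \<Longrightarrow>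
           wide (p i) ((\<Prod>j = i + 1..r - 1. p j ^ \<alpha> j) * p r)"
    and "comm_group G" and "finite (carrier G)"
    and "G \<cong> product_group {1..r - 2} (\<lambda>i. integer_mod_group (p i ^ \<alpha> i))
              \<times>\<times> integer_mod_group (p (r - 1) ^ \<alpha> (r - 1))
              \<times>\<times> integer_mod_group (p (r - 1) ^ \<alpha>')
              \<times>\<times> product_group {..<s} (\<lambda>_. integer_mod_group (p r))"
  shows "little_cross_number G = kstar G"
proof -
  interpret wide_tails r s \<alpha>' p \<alpha>
    by unfold_locales (use assms(1-5) in \<open>simp_all add: tail_exponent_def\<close>)
  obtain \<psi> where "presentation G (tail_moduli 0) \<psi>"
    using ex_presentation[OF assms(6,7)] assms(8) by (auto simp: direct_sum_def)
  then interpret presentation G "tail_moduli 0" \<psi> .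
  show ?thesis
  proof (rule little_cross_number_eq_kstar)
    show "cross_bound (tail_moduli 0) (\<Sum>i | tail_moduli 0 i \<noteq> 1. 1 - 1 / real (tail_moduli 0 i))"
      unfolding tail_bound_eq by (rule cross_bound_all) simp
    show "\<exists>q b. prime q \<and> tail_moduli 0 i = q ^ b" if "i \<in> {i. tail_moduli 0 i \<noteq> 1}" for i
    proof -
      have "tail_moduli 0 i \<in> (\<Union>q\<in>{q. prime q}. range ((^) q))"
        using index_cases[of i] that
      proof (elim disjE exE conjE)
        assume "i \<in> {1..r - 2}"
        then have "tail_moduli 0 i = p i ^ \<alpha> i" "prime (p i)" using tail_moduli_cases(1)[of i] assms(2)[of i] by auto
        then show ?thesis by auto
      next
        fix j assume "j < s" "i = r + 1 + j"
        then have "tail_moduli 0 i = p r ^ 1" using tail_moduli_cases(4) by simp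
        then show ?thesis using prr by blast
      qed (use tail_moduli_cases(2,3,5) prr in auto)
      then show ?thesis by blast
    qed
  qed
qed

end
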